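(* Let $\mathfrak{A}$ be a unital AF algebra with unit $1_{\mathfrak{A}}$, and let $\mathcal{U}=(\mathfrak{A}_n)_{n\in\mathbb{N}}$ be an increasing sequence of unital finite dimensional C*-subalgebras such that $\mathfrak{A}=\overline{\cup_{n\in\mathbb{N}}\mathfrak{A}_n}^{\|\cdot\|_{\mathfrak{A}}}$, with $\mathfrak{A}_0=\mathbb{C}1_{\mathfrak{A}}$. For each $n\in\mathbb{N}$, denote by $S_n$ the quotient norm of $\mathfrak{A}/\mathfrak{A}_n$ with respect to $\|\cdot\|_{\mathfrak{A}}$, i.e. $S_n(a)=\inf\{\|a-b\|_{\mathfrak{A}}:b\in\mathfrak{A}_n\}$. Let $\beta:\mathbb{N}\to(0,\infty)$ have limit $0$ at infinity. For all $a\in\mathfrak{A}$, set $$\mathsf{L}^\beta_{\mathcal{U}}(a)=\sup\left\{\frac{S_n(a)}{\beta(n)}:n\in\mathbb{N}\right\}.$$ Then the domain of $\mathsf{L}^\beta_{\mathcal{U}}$ contains $\cup_{n\in\mathbb{N}}\mathfrak{A}_n$, and: (1) $(\mathfrak{A},\mathsf{L}^\beta_{\mathcal{U}})$, $(\mathfrak{A}_n,\mathsf{L}^\beta_{\mathcal{U}})$, $(\mathfrak{A},\overline{\mathsf{L}^\beta_{\mathcal{U}}})$ and $(\mathfrak{A}_n,\overline{\mathsf{L}^\beta_{\mathcal{U}}})$, for all $n\in\mathbb{N}$, are Leibniz quantum compact metric spaces, where $\mathsf{L}^\beta_{\mathcal{U}}$ is viewed as restricted to $\mathfrak{sa}(\mathfrak{A})$;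 (2) $\displaystyle\lim_{n\to\infty}\mathsf{\Lambda}_{1,0}\left((\mathfrak{A}_n,\overline{\mathsf{L}^\beta_{\mathcal{U}}}),(\mathfrak{A},\overline{\mathsf{L}^\beta_{\mathcal{U}}})\right)=0$ and $\displaystyle\lim_{n\to\infty}\mathsf{\Lambda}_{1,0}\left((\mathfrak{A}_n,\mathsf{L}^\beta_{\mathcal{U}}),(\mathfrak{A},\overline{\mathsf{L}^\beta_{\mathcal{U}}})\right)=0$, where $\mathsf{\Lambda}_{1,0}$ is the quantum Gromov-Hausdorff propinquity.
   Context: **The closure $\overline{\mathsf{L}}$.** For $\mathsf{L}=\mathsf{L}^\beta_{\mathcal{U}}$ restricted to $\mathfrak{sa}(\mathfrak{A})$, let $L_{f,1}$ be the norm closure in $\mathfrak{A}$ of $\{a\in\mathfrak{sa}(\cup_{n\in\mathbb{N}}\mathfrak{A}_n):\mathsf{L}(a)\leq1\}$; then $\overline{\mathsf{L}}(a)=\inf\{r>0:\frac1r a\in L_{f,1}\}$ for $a\in\mathfrak{sa}(\mathfrak{A})$ (with $\inf\emptyset=\infty$). On $\mathfrak{A}_n$ the seminorms are restricted to $\mathfrak{sa}(\mathfrak{A}_n)$. The subalgebras $\mathfrak{A}_n$ contain $1_{\mathfrak{A}}$. **Quantum compact metric spaces.** For a unital C*-algebra $\mathfrak{A}$: $1_{\mathfrak{A}}$ is its unit, $\mathfrak{sa}(\mathfrak{A})$ its self-adjoint part, $\mathscr{S}(\mathfrak{A})$ its state space. For $C\geq1$, $D\geq0$, a $(C,D)$-quasi-Leibniz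 quantum compact metric space $(\mathfrak{A},\mathsf{L})$ is a unital C*-algebra $\mathfrak{A}$ with a seminorm $\mathsf{L}:\mathfrak{sa}(\mathfrak{A})\to[0,\infty]$ such that $\mathrm{dom}(\mathsf{L})=\{a\in\mathfrak{sa}(\mathfrak{A}):\mathsf{L}(a)<\infty\}$ is a dense unital Jordan-Lie subalgebra of $\mathfrak{sa}(\mathfrak{A})$ and: (i) $\{a:\mathsf{L}(a)=0\}=\mathbb{R}1_{\mathfrak{A}}$; (ii) for all $a,b\in\mathrm{dom}(\mathsf{L})$, $\max\{\mathsf{L}(\frac{ab+ba}{2}),\mathsf{L}(\frac{ab-ba}{2i})\}\leq C(\|a\|\mathsf{L}(b)+\|b\|\mathsf{L}(a))+D\mathsf{L}(a)\mathsf{L}(b)$; (iii) the metric $\mathsf{mk}_{\mathsf{L}}(\varphi,\psi)=\sup\{|\varphi(a)-\psi(a)|:a\in\mathrm{dom}(\mathsf{L}),\mathsf{L}(a)\leq1\}$ metrizes the weak* topology of $\mathscr{S}(\mathfrak{A})$; (iv) $\mathsf{L}$ is lower semi-continuous for $\|\cdot\|_{\mathfrak{A}}$. "Leibniz" means $(C,D)=(1,0)$. **Quantum propinquity.** A bridge $\gamma=(\mathfrak{D},\pi_{\mathfrak{A}},\pi_{\mathfrak{B}},\omega)$ from $\mathfrak{A}$ to $\mathfrak{B}$ consists of a unital C*-algebra $\mathfrak{D}$, unital *-monomorphisms $\pi_{\mathfrak{A}}:\mathfrak{A}\to\mathfrak{D}$, $\pi_{\mathfrak{B}}:\mathfrak{B}\to\mathfrak{D}$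 and $\omega\in\mathfrak{D}$ such that $\mathscr{S}_1(\mathfrak{D}|\omega)=\{\varphi\in\mathscr{S}(\mathfrak{D}):\varphi(1-\omega^*\omega)=\varphi(1-\omega\omega^* )=0\}\neq\emptyset$. Its height is the maximum of the Hausdorff distances, for $\mathsf{mk}_{\mathsf{L}_{\mathfrak{A}}}$ and $\mathsf{mk}_{\mathsf{L}_{\mathfrak{B}}}$ respectively, between $\mathscr{S}(\mathfrak{A})$ and $\{\varphi\circ\pi_{\mathfrak{A}}:\varphi\in\mathscr{S}_1(\mathfrak{D}|\omega)\}$, and between $\mathscr{S}(\mathfrak{B})$ and $\{\varphi\circ\pi_{\mathfrak{B}}:\varphi\in\mathscr{S}_1(\mathfrak{D}|\omega)\}$. Its reach is the Hausdorff distance between $\{a\in\mathfrak{sa}(\mathfrak{A}):\mathsf{L}_{\mathfrak{A}}(a)\leq1\}$ and $\{b\in\mathfrak{sa}(\mathfrak{B}):\mathsf{L}_{\mathfrak{B}}(b)\leq1\}$, where the distance from $a$ to $b$ is $\|\pi_{\mathfrak{A}}(a)\omega-\omega\pi_{\mathfrak{B}}(b)\|_{\mathfrak{D}}$. Its length is the maximum of height and reach. The quantum propinquity $\mathsf{\Lambda}_{C,D}$ is the largest $[0,\infty)$-valued function on pairs of $(C,D)$-quasi-Leibniz quantum compact metric spaces that is symmetric, satisfies the triangle inequality, and is at most the length of $\gamma$ for every bridge $\gamma$ between the two spaces (equivalently, the infimum, over finite chains of such spaces joined by bridges, of the sum of the lengths of the bridges). It is zero exactly when there is a *-isomorphism $\pi:\mathfrak{A}\to\mathfrak{B}$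 with $\mathsf{L}_{\mathfrak{B}}\circ\pi=\mathsf{L}_{\mathfrak{A}}$. *)

theory Defs
  imports "HOL-Analysis.Analysis" "HOL-Algebra.Ring"
begin

section \<open>The ambient unital C*-algebra\<close>

text \<open>Unital C*-algebras as a type class; \<^class>\<open>real_normed_algebra_1\<close> contains \<open>norm 1 = 1\<close>, so the zero
  algebra is excluded.\<close>

class cstar_algebra = real_normed_algebra_1 + banach +
  fixes scaleC :: "complex \<Rightarrow> 'a \<Rightarrow> 'a" (infixr \<open>*\<^sub>C\<close> 75)
    and star :: "'a \<Rightarrow> 'a"
  assumes scaleC_add_right: "c *\<^sub>C (x + y) = c *\<^sub>C x + c *\<^sub>C y"
    and scaleC_add_left: "(c + d) *\<^sub>C x = c *\<^sub>C x + d *\<^sub>C x"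
    and scaleC_scaleC: "c *\<^sub>C d *\<^sub>C x = (c * d) *\<^sub>C x"
    and scaleR_scaleC: "r *\<^sub>R x = complex_of_real r *\<^sub>C x"
    and mult_scaleC_left: "(c *\<^sub>C x) * y = c *\<^sub>C (x * y)"
    and mult_scaleC_right: "x * (c *\<^sub>C y) = c *\<^sub>C (x * y)"
    and norm_scaleC: "norm (c *\<^sub>C x) = cmod c * norm x"
    and star_star: "star (star x) = x"
    and star_add: "star (x + y) = star x + star y"
    and star_scaleC: "star (c *\<^sub>C x) = cnj c *\<^sub>C star x"
    and star_mult: "star (x * y) = star y * star x"
    and norm_star_mult: "norm (star x * x) = (norm x)\<^sup>2"

interpretation cvector: vector_space "scaleC :: complex \<Rightarrow> 'a \<Rightarrow> 'a::cstar_algebra"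
proof
  fix x :: 'a
  have "1 *\<^sub>C x = 1 *\<^sub>R x" by (simp only: scaleR_scaleC of_real_1)
  then show "1 *\<^sub>C x = x" by simp
qed (rule scaleC_add_right scaleC_add_left scaleC_scaleC)+

definition unital_cstar_subalgebra :: "'a::cstar_algebra set \<Rightarrow> bool" where
  "unital_cstar_subalgebra S \<longleftrightarrow> cvector.subspace S \<and> closed S \<and> 1 \<in> S \<and>
     (\<forall>x\<in>S. \<forall>y\<in>S. x * y \<in> S) \<and> (\<forall>x\<in>S. star x \<in> S)"

definition finite_dimensional :: "'a::cstar_algebra set \<Rightarrow> bool" where
  "finite_dimensional S \<longleftrightarrow> (\<exists>B. finite B \<and> S = cvector.span B)"


section \<open>Unital C*-algebras as structures\<close>

text \<open>The propinquity quantifies over C*-algebras, so they are also needed as values: carriers with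
  operations, based on the ring records of the algebra library.\<close>

record 'a cstar = "'a ring" +
  smul :: "complex \<Rightarrow> 'a \<Rightarrow> 'a"
  adj :: "'a \<Rightarrow> 'a"
  nrm :: "'a \<Rightarrow> real"

definition as_cstar :: "'a::cstar_algebra set \<Rightarrow> 'a cstar" where
  "as_cstar S = \<lparr>carrier = S, mult = (*), one = 1, zero = 0, add = (+),
     smul = scaleC, adj = star, nrm = norm\<rparr>"

text \<open>\<^locale>\<open>Metric_space\<close> requires a function that is symmetric and nonnegative everywhere, hence the
  value 0 outside the carrier.\<close>

definition cdist :: "'a cstar \<Rightarrow> 'a \<Rightarrow> 'a \<Rightarrow> real" where
  "cdist A x y = (if x \<in> carrier A \<and> y \<in> carrier A then nrm A (x \<ominus>\<^bsub>A\<^esub> y) else 0)"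

definition norm_topology :: "'a cstar \<Rightarrow> 'a topology" where
  "norm_topology A = Metric_space.mtopology (carrier A) (cdist A)"

locale unital_cstar = ring A for A :: "'a cstar" (structure) +
  assumes one_not_zero: "\<one> \<noteq> \<zero>"
    and smul_closed: "x \<in> carrier A \<Longrightarrow> smul A c x \<in> carrier A"
    and smul_add_right: "\<lbrakk>x \<in> carrier A; y \<in> carrier A\<rbrakk> \<Longrightarrow> smul A c (x \<oplus> y) = smul A c x \<oplus> smul A c y"
    and smul_add_left: "x \<in> carrier A \<Longrightarrow> smul A (c + d) x = smul A c x \<oplus> smul A d x"
    and smul_smul: "x \<in> carrier A \<Longrightarrow> smul A c (smul A d x) = smul A (c * d) x"
    and smul_one: "x \<in> carrier A \<Longrightarrow> smul A 1 x = x"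
    and mult_smul_left: "\<lbrakk>x \<in> carrier A; y \<in> carrier A\<rbrakk> \<Longrightarrow> smul A c x \<otimes> y = smul A c (x \<otimes> y)"
    and mult_smul_right: "\<lbrakk>x \<in> carrier A; y \<in> carrier A\<rbrakk> \<Longrightarrow> x \<otimes> smul A c y = smul A c (x \<otimes> y)"
    and adj_closed: "x \<in> carrier A \<Longrightarrow> adj A x \<in> carrier A"
    and adj_adj: "x \<in> carrier A \<Longrightarrow> adj A (adj A x) = x"
    and adj_add: "\<lbrakk>x \<in> carrier A; y \<in> carrier A\<rbrakk> \<Longrightarrow> adj A (x \<oplus> y) = adj A x \<oplus> adj A y"
    and adj_smul: "x \<in> carrier A \<Longrightarrow> adj A (smul A c x) = smul A (cnj c) (adj A x)"
    and adj_mult: "\<lbrakk>x \<in> carrier A; y \<in> carrier A\<rbrakk> \<Longrightarrow> adj A (x \<otimes> y) = adj A y \<otimes> adj A x"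
    and nrm_nonneg: "x \<in> carrier A \<Longrightarrow> 0 \<le> nrm A x"
    and nrm_eq_zero: "x \<in> carrier A \<Longrightarrow> nrm A x = 0 \<longleftrightarrow> x = \<zero>"
    and nrm_add: "\<lbrakk>x \<in> carrier A; y \<in> carrier A\<rbrakk> \<Longrightarrow> nrm A (x \<oplus> y) \<le> nrm A x + nrm A y"
    and nrm_smul: "x \<in> carrier A \<Longrightarrow> nrm A (smul A c x) = cmod c * nrm A x"
    and nrm_mult: "\<lbrakk>x \<in> carrier A; y \<in> carrier A\<rbrakk> \<Longrightarrow> nrm A (x \<otimes> y) \<le> nrm A x * nrm A y"
    and nrm_adj_mult: "x \<in> carrier A \<Longrightarrow> nrm A (adj A x \<otimes> x) = (nrm A x)\<^sup>2"
    and complete: "Metric_space.mcomplete (carrier A) (cdist A)"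

lemma unital_cstar_as_cstar:
  fixes S :: "'a::cstar_algebra set"
  assumes "unital_cstar_subalgebra S"
  shows "unital_cstar (as_cstar S)"
proof -
  have sub: "cvector.subspace S" and cl: "closed S" and one: "1 \<in> S"
    and m: "\<And>x y. x \<in> S \<Longrightarrow> y \<in> S \<Longrightarrow> x * y \<in> S" and st: "\<And>x. x \<in> S \<Longrightarrow> star x \<in> S"
    using assms by (auto simp: unital_cstar_subalgebra_def)
  note sp = cvector.subspace_add[OF sub] cvector.subspace_0[OF sub] cvector.subspace_scale[OF sub]
  have neg: "- x \<in> S" if "x \<in> S" for x using cvector.subspace_neg[OF sub that] .
  interpret ring "as_cstar S"
    by (intro ringI abelian_groupI monoidI)
      (auto simp: as_cstar_def sp one m algebra_simps intro!: bexI[where x="- _"] neg)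
  have inv: "\<ominus>\<^bsub>as_cstar S\<^esub> x = - x" if "x \<in> S" for x
    by (rule minus_equality) (use that neg in \<open>auto simp: as_cstar_def\<close>)
  have d: "cdist (as_cstar S) x y = dist x y" if "x \<in> S" "y \<in> S" for x y
    using that inv[of y] by (simp add: cdist_def a_minus_def dist_norm) (simp add: as_cstar_def)
  interpret M: Metric_space S "cdist (as_cstar S)"
  proof
    show "0 \<le> cdist (as_cstar S) x y" for x y
      by (cases "x \<in> S \<and> y \<in> S") (auto simp: d, auto simp: cdist_def as_cstar_def)
    show "cdist (as_cstar S) x y = cdist (as_cstar S) y x" for x y
      by (cases "x \<in> S \<and> y \<in> S") (auto simp: d dist_commute, auto simp: cdist_def as_cstar_def)
  qed (auto simp: d dist_triangle)
  have "M.mcomplete" unfolding M.mcomplete_def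
  proof (intro allI impI)
    fix \<sigma> assume C: "M.MCauchy \<sigma>"
    then have r: "\<And>n. \<sigma> n \<in> S" by (auto simp: M.MCauchy_def)
    have "Cauchy \<sigma>" using C r by (simp add: M.MCauchy_def Cauchy_def d)
    then obtain l where l: "\<sigma> \<longlonglongrightarrow> l" using Cauchy_convergent_iff convergent_def by blast
    then have "l \<in> S" using cl r closed_sequentially by blast
    then have "limitin M.mtopology \<sigma> l sequentially"
      using l r by (simp add: M.limitin_metric d tendsto_iff)
    then show "\<exists>x. limitin M.mtopology \<sigma> x sequentially" by blast
  qed
  then show ?thesis
    by unfold_locales (auto simp: as_cstar_def sp m st scaleC_add_right scaleC_add_left scaleC_scaleC
       mult_scaleC_left mult_scaleC_right norm_scaleC star_star star_add star_scaleC star_mult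
       norm_star_mult norm_triangle_ineq norm_mult_ineq)
qed

definition self_adjoint :: "'a cstar \<Rightarrow> 'a set" where
  "self_adjoint A = {a \<in> carrier A. adj A a = a}"

text \<open>States are extensional, so that equality of states is equality on the algebra.\<close>

definition states :: "'a cstar \<Rightarrow> ('a \<Rightarrow> complex) set" where
  "states A = {\<phi> \<in> extensional (carrier A).
     (\<forall>x\<in>carrier A. \<forall>y\<in>carrier A. \<phi> (x \<oplus>\<^bsub>A\<^esub> y) = \<phi> x + \<phi> y) \<and>
     (\<forall>c. \<forall>x\<in>carrier A. \<phi> (smul A c x) = c * \<phi> x) \<and>
     (\<forall>x\<in>carrier A. \<phi> (adj A x \<otimes>\<^bsub>A\<^esub> x) \<in> \<real>\<^sub>\<ge>\<^sub>0) \<and>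
     \<phi> \<one>\<^bsub>A\<^esub> = 1}"

definition weak_star_states :: "'a cstar \<Rightarrow> ('a \<Rightarrow> complex) topology" where
  "weak_star_states A = subtopology (product_topology (\<lambda>_. euclidean) (carrier A)) (states A)"


section \<open>Quasi-Leibniz quantum compact metric spaces\<close>

text \<open>In the pair \<open>(A, L)\<close> only the restriction of \<open>L\<close> to the self-adjoint part of \<open>A\<close> matters.\<close>

type_synonym 'a qspace = "'a cstar \<times> ('a \<Rightarrow> ennreal)"

definition lip_dom :: "'a qspace \<Rightarrow> 'a set" where
  "lip_dom = (\<lambda>(A, L). {a \<in> self_adjoint A. L a < \<infinity>})"

definition lip_ball :: "'a qspace \<Rightarrow> 'a set" where
  "lip_ball = (\<lambda>(A, L). {a \<in> self_adjoint A. L a \<le> 1})"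

definition mk :: "'a qspace \<Rightarrow> ('a \<Rightarrow> complex) \<Rightarrow> ('a \<Rightarrow> complex) \<Rightarrow> ennreal" where
  "mk X \<phi> \<psi> = (SUP a\<in>lip_ball X. ennreal (cmod (\<phi> a - \<psi> a)))"

definition jordan :: "'a cstar \<Rightarrow> 'a \<Rightarrow> 'a \<Rightarrow> 'a" where
  "jordan A a b = smul A (1 / 2) (a \<otimes>\<^bsub>A\<^esub> b \<oplus>\<^bsub>A\<^esub> b \<otimes>\<^bsub>A\<^esub> a)"

definition lie :: "'a cstar \<Rightarrow> 'a \<Rightarrow> 'a \<Rightarrow> 'a" where
  "lie A a b = smul A (1 / (2 * \<i>)) (a \<otimes>\<^bsub>A\<^esub> b \<ominus>\<^bsub>A\<^esub> b \<otimes>\<^bsub>A\<^esub> a)"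

definition unital_jordan_lie_subalgebra :: "'a cstar \<Rightarrow> 'a set \<Rightarrow> bool" where
  "unital_jordan_lie_subalgebra A J \<longleftrightarrow> J \<subseteq> self_adjoint A \<and> \<one>\<^bsub>A\<^esub> \<in> J \<and>
     (\<forall>a\<in>J. \<forall>b\<in>J. a \<oplus>\<^bsub>A\<^esub> b \<in> J) \<and>
     (\<forall>t. \<forall>a\<in>J. smul A (complex_of_real t) a \<in> J) \<and>
     (\<forall>a\<in>J. \<forall>b\<in>J. jordan A a b \<in> J \<and> lie A a b \<in> J)"

definition seminorm_on_sa :: "'a qspace \<Rightarrow> bool" where
  "seminorm_on_sa = (\<lambda>(A, L).
     (\<forall>a\<in>self_adjoint A. \<forall>b\<in>self_adjoint A. L (a \<oplus>\<^bsub>A\<^esub> b) \<le> L a + L b) \<and>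
     (\<forall>t. \<forall>a\<in>self_adjoint A. L (smul A (complex_of_real t) a) = ennreal \<bar>t\<bar> * L a))"

definition quasi_leibniz :: "real \<Rightarrow> real \<Rightarrow> 'a qspace \<Rightarrow> bool" where
  "quasi_leibniz C D = (\<lambda>(A, L). \<forall>a\<in>lip_dom (A, L). \<forall>b\<in>lip_dom (A, L).
     max (L (jordan A a b)) (L (lie A a b))
       \<le> ennreal C * (ennreal (nrm A a) * L b + ennreal (nrm A b) * L a) + ennreal D * L a * L b)"

definition metrizes_weak_star :: "'a qspace \<Rightarrow> bool" where
  "metrizes_weak_star = (\<lambda>(A, L).
     (\<forall>\<phi>\<in>states A. \<forall>\<psi>\<in>states A. mk (A, L) \<phi> \<psi> < \<infinity>) \<and>
     Metric_space (states A) (\<lambda>\<phi> \<psi>. enn2real (mk (A, L) \<phi> \<psi>)) \<and>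
     Metric_space.mtopology (states A) (\<lambda>\<phi> \<psi>. enn2real (mk (A, L) \<phi> \<psi>)) = weak_star_states A)"

definition lower_semicontinuous_on_sa :: "'a qspace \<Rightarrow> bool" where
  "lower_semicontinuous_on_sa = (\<lambda>(A, L). \<forall>r.
     openin (subtopology (norm_topology A) (self_adjoint A)) {a \<in> self_adjoint A. r < L a})"

definition quasi_leibniz_qcms :: "real \<Rightarrow> real \<Rightarrow> 'a qspace \<Rightarrow> bool" where
  "quasi_leibniz_qcms C D = (\<lambda>(A, L). 1 \<le> C \<and> 0 \<le> D \<and>
     unital_cstar A \<and>
     seminorm_on_sa (A, L) \<and>
     unital_jordan_lie_subalgebra A (lip_dom (A, L)) \<and>
     self_adjoint A \<subseteq> norm_topology A closure_of lip_dom (A, L) \<and>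
     {a \<in> self_adjoint A. L a = 0} = range (\<lambda>t. smul A (complex_of_real t) \<one>\<^bsub>A\<^esub>) \<and>
     quasi_leibniz C D (A, L) \<and>
     metrizes_weak_star (A, L) \<and>
     lower_semicontinuous_on_sa (A, L))"

abbreviation leibniz_qcms :: "'a qspace \<Rightarrow> bool" where
  "leibniz_qcms \<equiv> quasi_leibniz_qcms 1 0"


section \<open>The quantum propinquity\<close>

definition unital_star_monomorphism :: "'a cstar \<Rightarrow> 'b cstar \<Rightarrow> ('a \<Rightarrow> 'b) \<Rightarrow> bool" where
  "unital_star_monomorphism A D \<pi> \<longleftrightarrow> \<pi> \<in> ring_hom A D \<and>
     (\<forall>c. \<forall>x\<in>carrier A. \<pi> (smul A c x) = smul D c (\<pi> x)) \<and>
     (\<forall>x\<in>carrier A. \<pi> (adj A x) = adj D (\<pi> x)) \<and>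
     inj_on \<pi> (carrier A)"

definition level_states :: "'a cstar \<Rightarrow> 'a \<Rightarrow> ('a \<Rightarrow> complex) set" where
  "level_states D \<omega> = {\<phi> \<in> states D.
     \<phi> (\<one>\<^bsub>D\<^esub> \<ominus>\<^bsub>D\<^esub> adj D \<omega> \<otimes>\<^bsub>D\<^esub> \<omega>) = 0 \<and> \<phi> (\<one>\<^bsub>D\<^esub> \<ominus>\<^bsub>D\<^esub> \<omega> \<otimes>\<^bsub>D\<^esub> adj D \<omega>) = 0}"

record 'a bridge =
  br_alg :: "'a cstar"
  br_left :: "'a \<Rightarrow> 'a"
  br_right :: "'a \<Rightarrow> 'a"
  br_pivot :: 'a

definition is_bridge :: "'a cstar \<Rightarrow> 'a cstar \<Rightarrow> 'a bridge \<Rightarrow> bool" where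
  "is_bridge A B \<gamma> \<longleftrightarrow> unital_cstar (br_alg \<gamma>) \<and>
     unital_star_monomorphism A (br_alg \<gamma>) (br_left \<gamma>) \<and>
     unital_star_monomorphism B (br_alg \<gamma>) (br_right \<gamma>) \<and>
     br_pivot \<gamma> \<in> carrier (br_alg \<gamma>) \<and>
     level_states (br_alg \<gamma>) (br_pivot \<gamma>) \<noteq> {}"

definition hausdorff_distance :: "('a \<Rightarrow> 'b \<Rightarrow> ennreal) \<Rightarrow> 'a set \<Rightarrow> 'b set \<Rightarrow> ennreal" where
  "hausdorff_distance d X Y = max (SUP x\<in>X. INF y\<in>Y. d x y) (SUP y\<in>Y. INF x\<in>X. d x y)"

definition pullback_states :: "'a cstar \<Rightarrow> ('a \<Rightarrow> 'a) \<Rightarrow> 'a bridge \<Rightarrow> ('a \<Rightarrow> complex) set" where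
  "pullback_states A \<pi> \<gamma> = (\<lambda>\<phi>. compose (carrier A) \<phi> \<pi>) ` level_states (br_alg \<gamma>) (br_pivot \<gamma>)"

definition bridge_height :: "'a qspace \<Rightarrow> 'a qspace \<Rightarrow> 'a bridge \<Rightarrow> ennreal" where
  "bridge_height X Y \<gamma> = max
     (hausdorff_distance (mk X) (states (fst X)) (pullback_states (fst X) (br_left \<gamma>) \<gamma>))
     (hausdorff_distance (mk Y) (states (fst Y)) (pullback_states (fst Y) (br_right \<gamma>) \<gamma>))"

definition bridge_reach :: "'a qspace \<Rightarrow> 'a qspace \<Rightarrow> 'a bridge \<Rightarrow> ennreal" where
  "bridge_reach X Y \<gamma> = (let D = br_alg \<gamma>; \<omega> = br_pivot \<gamma> in
     hausdorff_distance
       (\<lambda>a b. ennreal (nrm D (br_left \<gamma> a \<otimes>\<^bsub>D\<^esub> \<omega> \<ominus>\<^bsub>D\<^esub> \<omega> \<otimes>\<^bsub>D\<^esub> br_right \<gamma> b)))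
       (lip_ball X) (lip_ball Y))"

definition bridge_length :: "'a qspace \<Rightarrow> 'a qspace \<Rightarrow> 'a bridge \<Rightarrow> ennreal" where
  "bridge_length X Y \<gamma> = max (bridge_height X Y \<gamma>) (bridge_reach X Y \<gamma>)"

text \<open>The propinquity, as an infimum over finite chains of bridges. All algebras in a chain, and those
  of its bridges, have carriers in the type \<open>'a\<close> of the end points. This is no restriction: the
  carrier of a nonzero C*-algebra has at least the cardinality of the continuum, so \<open>'a\<close> has room
  for an isomorphic copy of every separable C*-algebra. Quantum compact metric spaces are separable,
  their state space being metrizable, and the algebra of a bridge can be replaced by the separable
  C*-subalgebra generated by the images of the two spaces and the pivot, since states extend from
  C*-subalgebras.\<close>

definition propinquity :: "real \<Rightarrow> real \<Rightarrow> 'a qspace \<Rightarrow> 'a qspace \<Rightarrow> ennreal" where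
  "propinquity C D X Y = Inf {(\<Sum>i<n. bridge_length (S i) (S (Suc i)) (\<gamma> i)) | n S \<gamma>.
     0 < n \<and> S 0 = X \<and> S n = Y \<and> (\<forall>i\<le>n. quasi_leibniz_qcms C D (S i)) \<and>
     (\<forall>i<n. is_bridge (fst (S i)) (fst (S (Suc i))) (\<gamma> i))}"


section \<open>Lip-norms from best approximation\<close>

definition quotient_norm :: "'a::cstar_algebra set \<Rightarrow> 'a \<Rightarrow> real" where
  "quotient_norm N a = (INF b\<in>N. norm (a - b))"

definition lip_beta :: "(nat \<Rightarrow> 'a::cstar_algebra set) \<Rightarrow> (nat \<Rightarrow> real) \<Rightarrow> 'a \<Rightarrow> ennreal" where
  "lip_beta U \<beta> a = (SUP n. ennreal (quotient_norm (U n) a / \<beta> n))"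

definition lip_closure :: "(nat \<Rightarrow> 'a::cstar_algebra set) \<Rightarrow> ('a \<Rightarrow> ennreal) \<Rightarrow> 'a \<Rightarrow> ennreal" where
  "lip_closure U L a = Inf (ennreal ` {r. 0 < r \<and>
     (1 / r) *\<^sub>R a \<in> closure {b \<in> (\<Union>n. U n). star b = b \<and> L b \<le> 1}})"

end

theory Submission
  imports Defs
begin

text \<open>
  The quotient norm of a C*-subalgebra \<open>N\<close> is Leibniz: let \<open>f\<close> be a norming functional for \<open>ab\<close> modulo \<open>N\<close>.
  A Hahn--Banach argument yields a positive \<open>\<phi>\<close> of norm at most 1 with \<open>(f x)\<^sup>2 \<le> \<phi> (x\<^sup>*x)\<close>. If \<open>c\<close>, \<open>d\<close> in \<open>N\<close>
  are close to \<open>b\<close>, \<open>a\<close> and \<open>l c\<close> is the real multiple of \<open>c\<close> closest to \<open>b\<close> in the seminorm of \<open>\<phi>\<close>, then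
  \<open>f (ab) = f (a (b - l c)) + f ((a - d) l c)\<close>, since \<open>f\<close> vanishes on \<open>N\<close>, and both terms are bounded by
  Cauchy--Schwarz.

  Modulo scalars, the unit ball of the Lip-norm lies within \<open>\<beta> n\<close> of the finite dimensional \<open>U n\<close>,
  so it is compact; hence the Monge--Kantorovich metric induces the weak* topology.

  On the self-adjoint part of \<open>U n\<close> the Lip-norm agrees with its closure, and by compactness the unit ball
  of the closure is, uniformly and up to scalars, approximated by the unit balls of the \<open>U n\<close>. The bridge
  in the whole algebra with pivot 1 has height 0, because states extend, and its reach is the
  Hausdorff distance of these unit balls.
\<close>

section \<open>Positivity in C*-algebras\<close>

text \<open>The difficulty is the constant 1 in the Leibniz inequality. A near-best approximant
  \<open>c\<close> of \<open>b\<close> in \<open>N\<close> satisfies, up to an error, only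
  \<open>norm c\<close> \<le> 2 \<open>norm b\<close>, so estimating
  \<open>a (b - c) + (a - d) c\<close> directly costs a factor 2. In the Hilbert seminorm of \<phi>,
  however, the nearest multiple of \<open>c\<close> is an orthogonal projection of \<open>b\<close>:
  it is no longer than \<open>b\<close> and no further from \<open>b\<close> than \<open>c\<close>
  is. Only the right factors are measured in this seminorm and the left ones in norm, which is why
  the one-sided domination of \<open>f\<close> by \<phi> suffices.

  Positivity is derived from the norm: a self-adjoint \<open>k\<close> is positive iff it lies
  within \<open>t\<close> of the scalar \<open>t\<close> for some \<open>t\<close>. Sums are then
  immediate, and a root is the limit of an iteration that never leaves a closed subalgebra.

  The closure dominates the Lip-norm, so its unit ball inherits compactness modulo scalars. Scalars
  change neither a difference of two states nor either seminorm and lie in every \<open>U n\<close>,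
  so they can be removed to reach a compact set and restored afterwards.\<close>

lemma norm_star: "norm (star x) = norm (x::'a::cstar_algebra)"
proof -
  have le: "norm y \<le> norm (star y)" for y :: 'a
  proof (cases "norm y = 0")
    case False
    have "norm y * norm y \<le> norm (star y) * norm y"
      using norm_mult_ineq[of "star y" y] by (simp add: norm_star_mult power2_eq_square)
    with False show ?thesis by (simp add: mult_le_cancel_right)
  qed simp
  show ?thesis using le[of x] le[of "star x"] by (simp add: star_star)
qed

lemma norm_mult_star: "norm (x * star x) = (norm (x::'a::cstar_algebra))\<^sup>2"
  using norm_star_mult[of "star x"] by (simp add: star_star norm_star)

lemma star_scaleR: "star (r *\<^sub>R x) = r *\<^sub>R star (x::'a::cstar_algebra)"
  by (simp add: scaleR_scaleC star_scaleC)

lemma bounded_linear_star: "bounded_linear (star :: 'a::cstar_algebra \<Rightarrow> 'a)"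
  by (rule bounded_linear_intro[where K=1]) (simp_all add: star_add star_scaleR norm_star)

lemmas linear_star = bounded_linear.linear[OF bounded_linear_star]
lemmas star_0 [simp] = linear_0[OF linear_star]
  and star_minus = linear_neg[OF linear_star]
  and star_diff = linear_diff[OF linear_star]
  and continuous_on_star [continuous_intros] = bounded_linear.continuous_on[OF bounded_linear_star]

lemma star_1 [simp]: "star 1 = (1::'a::cstar_algebra)"
proof -
  have "star (star 1 * 1) = star 1 * star (star (1::'a))" by (rule star_mult)
  then show ?thesis by (simp add: star_star)
qed

declare star_star [simp]

lemmas star_simps = star_add star_diff star_minus star_mult star_scaleR star_scaleC

lemma bounded_linear_scaleC: "bounded_linear (scaleC c :: 'a::cstar_algebra \<Rightarrow> 'a)"
  by (rule bounded_linear_intro[where K="cmod c"])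
    (simp_all add: scaleC_add_right scaleR_scaleC scaleC_scaleC mult.commute norm_scaleC)

lemma scaleC_of_real: "complex_of_real r *\<^sub>C x = r *\<^sub>R (x::'a::cstar_algebra)"
  by (simp add: scaleR_scaleC)

lemma scaleC_decompose: "c *\<^sub>C x = Re c *\<^sub>R x + Im c *\<^sub>R (\<i> *\<^sub>C (x::'a::cstar_algebra))"
proof -
  have "c *\<^sub>C x = (complex_of_real (Re c) + complex_of_real (Im c) * \<i>) *\<^sub>C x"
    by (simp add: complex_eq mult.commute)
  also have "\<dots> = Re c *\<^sub>R x + Im c *\<^sub>R (\<i> *\<^sub>C x)"
    by (simp only: scaleC_add_left scaleC_scaleC[symmetric] scaleC_of_real)
  finally show ?thesis .
qed

lemma i_scaleC_i: "\<i> *\<^sub>C \<i> *\<^sub>C x = - (x::'a::cstar_algebra)"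
  by (simp add: scaleC_scaleC cvector.scale_minus_left)

lemma norm_sa_square: "star h = h \<Longrightarrow> norm (h * h) = (norm (h::'a::cstar_algebra))\<^sup>2"
  using norm_star_mult[of h] by simp

lemma norm_real_part_le: "norm ((1/2) *\<^sub>R (x + star x)) \<le> norm (x::'a::cstar_algebra)"
  using norm_triangle_ineq[of x "star x"] by (simp add: norm_star)

text \<open>The iteration \<open>z \<mapsto> (a + z\<^sup>2) / 2\<close> is dominated by the scalar one started with \<open>a = 1\<close>, and so
  converges even when \<open>norm a = 1\<close>. The last clause transfers closed properties to the limit.\<close>

lemma sqrt_iteration:
  fixes a :: "'a::{real_normed_algebra_1,banach}"
  assumes "norm a \<le> 1"
  obtains y where "y = (1/2) *\<^sub>R (a + y * y)" "norm y \<le> 1"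
    "\<And>T. \<lbrakk>closed T; 0 \<in> T; \<And>z. z \<in> T \<Longrightarrow> (1/2) *\<^sub>R (a + z * z) \<in> T\<rbrakk> \<Longrightarrow> y \<in> T"
proof -
  define F where "F z = (1/2) *\<^sub>R (a + z * z)" for z
  define y where "y n = (F ^^ n) 0" for n
  define c where "c n = ((\<lambda>t. (1 + t * t) / 2 :: real) ^^ n) 0" for n
  have y0: "y 0 = 0" and ys: "y (Suc n) = F (y n)" for n by (simp_all add: y_def)
  have c0: "c 0 = 0" and cs: "c (Suc n) = (1 + c n * c n) / 2" for n by (simp_all add: c_def)
  have c01: "0 \<le> c n \<and> c n \<le> 1" for n
  proof (induction n)
    case (Suc n)
    have "c n * c n \<le> 1" using Suc mult_le_one[of "c n" "c n"] by simp
    then show ?case by (simp add: cs)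
  qed (simp add: c0)
  have cmono: "c n \<le> c (Suc n)" for n
  proof -
    have "0 \<le> (1 - c n) * (1 - c n)" by simp
    then show ?thesis by (simp add: cs algebra_simps)
  qed
  have yb: "norm (y n) \<le> c n" for n
  proof (induction n)
    case (Suc n)
    have "norm (y n * y n) \<le> c n * c n"
      by (rule order_trans[OF norm_mult_ineq]) (intro mult_mono Suc c01[THEN conjunct1] norm_ge_zero)
    then have "norm (a + y n * y n) \<le> 1 + c n * c n"
      using norm_triangle_ineq[of a "y n * y n"] assms by linarith
    then show ?case by (simp add: ys F_def cs)
  qed (simp add: y0 c0)
  have step: "norm (y (Suc n) - y n) \<le> c (Suc n) - c n" for n
  proof (induction n)
    case 0
    show ?case using yb[of "Suc 0"] by (simp add: y0 c0)
  next
    case (Suc n)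
    let ?u = "y (Suc n)" and ?v = "y n"
    \<comment> \<open>A splitting of the difference of squares that respects noncommutativity. With
      norms replaced by values of \<open>c\<close> it becomes the scalar difference exactly, so the
      bound propagates.\<close>
    have "?u * ?u - ?v * ?v = ?u * (?u - ?v) + (?u - ?v) * ?v" by (simp add: algebra_simps)
    then have "norm (?u * ?u - ?v * ?v) \<le> norm ?u * norm (?u - ?v) + norm (?u - ?v) * norm ?v"
      using norm_triangle_ineq[of "?u * (?u - ?v)" "(?u - ?v) * ?v"]
        norm_mult_ineq[of ?u "?u - ?v"] norm_mult_ineq[of "?u - ?v" ?v] by simp
    also have "\<dots> \<le> c (Suc n) * (c (Suc n) - c n) + (c (Suc n) - c n) * c n"
      using Suc yb c01 cmono[of n] by (intro add_mono mult_mono) auto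
    also have "\<dots> = 2 * (c (Suc (Suc n)) - c (Suc n))" by (simp add: cs[of "Suc n"] cs[of n] field_simps)
    finally have "norm (?u * ?u - ?v * ?v) \<le> 2 * (c (Suc (Suc n)) - c (Suc n))" .
    moreover have "y (Suc (Suc n)) - y (Suc n) = (1/2) *\<^sub>R (?u * ?u - ?v * ?v)"
      by (simp add: ys[of "Suc n"] ys[of n] F_def scaleR_right_diff_distrib[symmetric])
    ultimately show ?case by simp
  qed
  have dist: "norm (y (n + k) - y n) \<le> c (n + k) - c n" for n k
  proof (induction k)
    case (Suc k)
    then show ?case
      using step[of "n + k"] norm_triangle_ineq[of "y (Suc (n + k)) - y (n + k)" "y (n + k) - y n"] by simp
  qed simp
  have "incseq c" using cmono by (simp add: incseq_SucI)
  then have "convergent c"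
    using c01 by (intro Bseq_mono_convergent BseqI'[of _ 1]) (auto simp: incseq_def)
  then have "Cauchy c" by (rule convergent_Cauchy)
  have "Cauchy y"
  proof (rule CauchyI)
    fix e :: real assume "0 < e"
    then obtain M where M: "\<And>m n. m \<ge> M \<Longrightarrow> n \<ge> M \<Longrightarrow> norm (c m - c n) < e"
      using CauchyD[OF \<open>Cauchy c\<close>] by blast
    have *: "norm (y m - y n) < e" if "n \<ge> M" "m \<ge> n" for m n
      using dist[of n "m - n"] M[of m n] that by (simp add: abs_real_def split: if_splits)
    show "\<exists>M. \<forall>m\<ge>M. \<forall>n\<ge>M. norm (y m - y n) < e"
      using * by (intro exI[of _ M]) (metis nle_le norm_minus_commute)
  qed
  then obtain l where l: "y \<longlonglongrightarrow> l" using Cauchy_convergent_iff convergent_def by blast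
  have "(\<lambda>n. y (Suc n)) \<longlonglongrightarrow> F l" unfolding ys F_def by (intro tendsto_intros l)
  then have "l = F l" using LIMSEQ_Suc[OF l] LIMSEQ_unique by blast
  moreover have "norm l \<le> 1"
    using tendsto_norm[OF l] yb c01 by (intro LIMSEQ_le_const2) (auto intro: order_trans)
  moreover have "l \<in> T" if "closed T" "0 \<in> T" and T: "\<And>z. z \<in> T \<Longrightarrow> (1/2) *\<^sub>R (a + z * z) \<in> T" for T
  proof -
    have "y n \<in> T" for n by (induction n) (auto simp: y0 ys F_def that)
    then show ?thesis using \<open>closed T\<close> l closed_sequentially by blast
  qed
  ultimately show ?thesis using that[of l] by (simp add: F_def)
qed

lemma subalgebra_props:
  fixes S :: "'a::cstar_algebra set"
  assumes "unital_cstar_subalgebra S"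
  shows subalgebra_0: "0 \<in> S" and subalgebra_1: "1 \<in> S"
    and subalgebra_add: "\<And>x y. x \<in> S \<Longrightarrow> y \<in> S \<Longrightarrow> x + y \<in> S"
    and subalgebra_diff: "\<And>x y. x \<in> S \<Longrightarrow> y \<in> S \<Longrightarrow> x - y \<in> S"
    and subalgebra_minus: "\<And>x. x \<in> S \<Longrightarrow> - x \<in> S"
    and subalgebra_mult: "\<And>x y. x \<in> S \<Longrightarrow> y \<in> S \<Longrightarrow> x * y \<in> S"
    and subalgebra_star: "\<And>x. x \<in> S \<Longrightarrow> star x \<in> S"
    and subalgebra_scaleC: "\<And>x c. x \<in> S \<Longrightarrow> c *\<^sub>C x \<in> S"
    and subalgebra_scaleR: "\<And>x r. x \<in> S \<Longrightarrow> r *\<^sub>R x \<in> S"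
    and subalgebra_closed: "closed S"
  using assms
  by (auto simp: unital_cstar_subalgebra_def scaleR_scaleC cvector.subspace_0 cvector.subspace_add
      cvector.subspace_diff cvector.subspace_neg cvector.subspace_scale)

lemma subalgebra_UNIV: "unital_cstar_subalgebra UNIV"
  by (simp add: unital_cstar_subalgebra_def)

text \<open>A fixed point \<open>y\<close> of the iteration satisfies
  \<open>y + y = a + y * y\<close>, that is, \<open>(1 - y) * (1 - y) = 1 - a\<close>. The iterates
  are polynomials in \<open>a\<close>; membership in \<open>S\<close>, self-adjointness and
  commutation are closed conditions, so \<open>y\<close> inherits them. The bound on
  \<open>1 - s\<close> makes \<open>s\<close> itself positive and allows a second root.\<close>

lemma sqrt_one_minus:
  fixes a :: "'a::cstar_algebra"
  assumes S: "unital_cstar_subalgebra S" and a: "a \<in> S" "star a = a" "norm a \<le> 1"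
  obtains s where "s \<in> S" "star s = s" "s * s = 1 - a" "norm (1 - s) \<le> 1"
    "\<And>x. x * a = a * x \<Longrightarrow> x * s = s * x"
proof -
  obtain y where y: "y = (1/2) *\<^sub>R (a + y * y)" "norm y \<le> 1"
    and T: "\<And>T. \<lbrakk>closed T; 0 \<in> T; \<And>z. z \<in> T \<Longrightarrow> (1/2) *\<^sub>R (a + z * z) \<in> T\<rbrakk> \<Longrightarrow> y \<in> T"
    using sqrt_iteration[OF a(3)] by metis
  have yS: "y \<in> S"
    by (rule T) (simp_all add: subalgebra_closed[OF S] subalgebra_0[OF S] subalgebra_scaleR[OF S]
        subalgebra_add[OF S] subalgebra_mult[OF S] a)
  have "y \<in> {z. star z = z}"
    by (rule T) (auto intro!: closed_Collect_eq continuous_intros simp: star_simps a)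
  then have ys: "star y = y" by simp
  have yc: "x * y = y * x" if x: "x * a = a * x" for x
  proof -
    have "y \<in> {z. x * z = z * x}"
    proof (rule T)
      fix z assume "z \<in> {z. x * z = z * x}"
      then have "x * z = z * x" by simp
      then have "x * (z * z) = (z * z) * x" by (metis mult.assoc)
      then show "(1/2) *\<^sub>R (a + z * z) \<in> {z. x * z = z * x}" by (simp add: algebra_simps x)
    qed (auto intro!: closed_Collect_eq continuous_intros)
    then show ?thesis by simp
  qed
  have "2 *\<^sub>R y = 2 *\<^sub>R ((1/2) *\<^sub>R (a + y * y))" using y(1) by (rule arg_cong)
  then have "y + y = a + y * y" by (simp add: scaleR_2)
  then have sq: "(1 - y) * (1 - y) = 1 - a" by (simp add: algebra_simps)
  have comm: "x * (1 - y) = (1 - y) * x" if "x * a = a * x" for x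
    using yc[OF that] by (simp add: algebra_simps)
  show ?thesis
    by (rule that[OF _ _ sq _ comm])
      (simp_all add: subalgebra_diff[OF S] subalgebra_1[OF S] yS star_diff ys y(2))
qed

text \<open>Squares of self-adjoint elements: the usual positive cone, in the form that exhibits a
  root. That sums and the elements \<open>star y * y\<close> belong to it has to be proved.\<close>

definition cpos :: "'a::cstar_algebra \<Rightarrow> bool" where
  "cpos k \<longleftrightarrow> (\<exists>q. star q = q \<and> k = q * q)"

lemma cposI: "star q = q \<Longrightarrow> cpos (q * q)"
  by (auto simp: cpos_def)

lemma cpos_sa: "cpos k \<Longrightarrow> star k = k"
  by (auto simp: cpos_def star_simps)

lemma cpos_scaleR: "cpos k \<Longrightarrow> 0 \<le> t \<Longrightarrow> cpos (t *\<^sub>R k)"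
proof -
  assume "cpos k" "0 \<le> t"
  then obtain q where "star q = q" "k = q * q" by (auto simp: cpos_def)
  then show ?thesis using \<open>0 \<le> t\<close> cposI[of "sqrt t *\<^sub>R q"] by (simp add: star_simps)
qed

lemma cpos_of_real: "0 \<le> t \<Longrightarrow> cpos (of_real t)"
  using cpos_scaleR[OF cposI[of 1], of t] by (simp add: of_real_def)

text \<open>With \<open>s\<^sup>2 = 1 - h\<^sup>2\<close> the element \<open>u = h + i s\<close> is unitary, and \<open>2 h\<^sup>2 - 1\<close> is the real part of \<open>u\<^sup>2\<close>.\<close>

lemma norm_one_minus_two_square:
  fixes h :: "'a::cstar_algebra"
  assumes h: "star h = h" "norm h \<le> 1"
  shows "norm (1 - 2 *\<^sub>R (h * h)) \<le> 1"
proof -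
  have "norm (h * h) \<le> 1" using h by (simp add: norm_sa_square abs_square_le_1)
  then obtain s where s: "star s = s" "s * s = 1 - h * h"
    and c: "\<And>x. x * (h * h) = (h * h) * x \<Longrightarrow> x * s = s * x"
    using sqrt_one_minus[OF subalgebra_UNIV UNIV_I, of "h * h"] h(1) by (metis star_mult)
  have hs: "h * s = s * h" by (rule c) (simp add: mult.assoc)
  define u where "u = h + \<i> *\<^sub>C s"
  have su: "star u = h - \<i> *\<^sub>C s"
    by (simp add: u_def star_simps h s cvector.scale_minus_left)
  have "(h - \<i> *\<^sub>C s) * (h + \<i> *\<^sub>C s) = 1"
    by (simp add: ring_distribs mult_scaleC_left mult_scaleC_right i_scaleC_i hs s
        cvector.scale_right_diff_distrib scaleC_add_right)
  then have "star u * u = 1" by (simp only: su) (simp only: u_def)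
  then have nu: "norm u = 1" using norm_star_mult[of u] by (simp add: power2_eq_1_iff) (metis norm_ge_zero neg_0_le_iff_le not_one_le_zero)
  have "(h + \<i> *\<^sub>C s) * (h + \<i> *\<^sub>C s) + (h - \<i> *\<^sub>C s) * (h - \<i> *\<^sub>C s) = 2 *\<^sub>R (h * h - s * s)"
    by (simp add: ring_distribs mult_scaleC_left mult_scaleC_right i_scaleC_i scaleR_2
        cvector.scale_right_diff_distrib scaleC_add_right)
  then have "u * u + star (u * u) = 2 *\<^sub>R (h * h - s * s)"
    by (simp only: star_mult su) (simp only: u_def)
  then have "(1/2) *\<^sub>R (u * u + star (u * u)) = h * h - s * s" by simp
  then have "norm (h * h - s * s) \<le> norm (u * u)" using norm_real_part_le[of "u * u"] by simp
  also have "\<dots> \<le> 1" using norm_mult_ineq[of u u] nu by simp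
  also have "h * h - s * s = - (1 - 2 *\<^sub>R (h * h))" by (simp add: s scaleR_2)
  finally show ?thesis by (simp only: norm_minus_cancel)
qed

text \<open>The rescaled bound for \<open>1 - 2 *\<^sub>R (h * h)\<close> with \<open>h\<close> the
  normalised root \<open>q\<close>. Spectrally: the spectrum of \<open>k\<close> lies between 0 and
  \<open>norm k\<close>, hence within half that length of the midpoint.\<close>

lemma cpos_norm_half:
  fixes k :: "'a::cstar_algebra"
  assumes "cpos k"
  shows "norm (of_real (norm k / 2) - k) \<le> norm k / 2"
proof (cases "k = 0")
  case False
  obtain q where q: "star q = q" "k = q * q" using assms by (auto simp: cpos_def)
  with False have q0: "norm q > 0" by auto
  have nk: "norm k = (norm q)\<^sup>2" using q norm_sa_square by simp
  have "norm (1 - 2 *\<^sub>R ((inverse (norm q) *\<^sub>R q) * (inverse (norm q) *\<^sub>R q))) \<le> 1"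
    by (rule norm_one_minus_two_square) (use q0 in \<open>simp_all add: star_simps q\<close>)
  then have *: "norm (1 - (2 / norm k) *\<^sub>R k) \<le> 1"
    by (simp add: nk q(2)[symmetric] power2_eq_square field_simps)
  have "of_real (norm k / 2) - k = (norm k / 2) *\<^sub>R (1 - (2 / norm k) *\<^sub>R k)"
    using False by (simp add: of_real_def algebra_simps)
  then have "norm (of_real (norm k / 2) - k) = norm k / 2 * norm (1 - (2 / norm k) *\<^sub>R k)" by simp
  then show ?thesis using * mult_left_mono[OF *, of "norm k / 2"] by simp
qed simp

lemma cpos_norm_diff:
  fixes k :: "'a::cstar_algebra"
  assumes "cpos k" "norm k \<le> t"
  shows "norm (of_real t - k) \<le> t"
proof -
  have *: "of_real t - k = (of_real (norm k / 2) - k) + of_real (t - norm k / 2)" by simp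
  have "norm (of_real t - k) \<le> norm (of_real (norm k / 2) - k) + norm (of_real (t - norm k / 2) :: 'a)"
    unfolding * by (rule norm_triangle_ineq)
  then have "norm (of_real t - k) \<le> norm k / 2 + \<bar>t - norm k / 2\<bar>"
    unfolding norm_of_real using cpos_norm_half[OF assms(1)] by linarith
  moreover have "t \<ge> norm k / 2" using assms(2) norm_ge_zero[of k] by linarith
  ultimately show ?thesis by simp
qed

text \<open>The converse of the norm bound: \<open>k = t (1 - a)\<close> with \<open>norm a\<close>
  \<le> 1, and \<open>1 - a\<close> has a root. The root stays in \<open>S\<close> and meets the
  same criterion, so that it can be evaluated by states of \<open>S\<close> and has a root in
  turn.\<close>

lemma subalgebra_sqrt:
  fixes k :: "'a::cstar_algebra"
  assumes S: "unital_cstar_subalgebra S" and k: "k \<in> S" "star k = k" "norm (of_real t - k) \<le> t"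
  obtains q r where "q \<in> S" "star q = q" "k = q * q" "norm (of_real r - q) \<le> r"
    "\<And>x. x * k = k * x \<Longrightarrow> x * q = q * x"
proof (cases "t = 0")
  case True
  then show ?thesis using k that[of 0 0] by simp
next
  case False
  with k(3) have t: "t > 0" by (metis norm_ge_zero order_trans order_less_le)
  define a where "a = 1 - inverse t *\<^sub>R k"
  have "of_real t - k = t *\<^sub>R a" using t by (simp add: a_def of_real_def algebra_simps)
  with k(3) t have "norm a \<le> 1" by simp
  moreover have "a \<in> S" by (simp add: a_def subalgebra_diff[OF S] subalgebra_1[OF S] subalgebra_scaleR[OF S] k)
  moreover have "star a = a" by (simp add: a_def star_simps k)
  ultimately obtain s where s: "s \<in> S" "star s = s" "s * s = 1 - a" "norm (1 - s) \<le> 1"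
    "\<And>x. x * a = a * x \<Longrightarrow> x * s = s * x"
    using sqrt_one_minus[OF S, of a] by metis
  show ?thesis
  proof (rule that[of "sqrt t *\<^sub>R s" "sqrt t"])
    have "(sqrt t *\<^sub>R s) * (sqrt t *\<^sub>R s) = (sqrt t * sqrt t) *\<^sub>R (s * s)" by simp
    then show "k = (sqrt t *\<^sub>R s) * (sqrt t *\<^sub>R s)" using t by (simp add: s(3) a_def)
    have "of_real (sqrt t) - sqrt t *\<^sub>R s = sqrt t *\<^sub>R (1 - s)" by (simp add: of_real_def algebra_simps)
    then show "norm (of_real (sqrt t) - sqrt t *\<^sub>R s) \<le> sqrt t"
      using t mult_left_mono[OF s(4), of "sqrt t"] by simp
    fix x assume "x * k = k * x"
    then have "x * a = a * x" by (simp add: a_def algebra_simps)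
    from s(5)[OF this] show "x * (sqrt t *\<^sub>R s) = sqrt t *\<^sub>R s * x" by simp
  qed (simp_all add: s subalgebra_scaleR[OF S] star_simps)
qed

lemma cpos_if_norm_diff:
  fixes k :: "'a::cstar_algebra"
  assumes "star k = k" "norm (of_real t - k) \<le> t"
  shows "cpos k"
  using subalgebra_sqrt[OF subalgebra_UNIV UNIV_I assms] cposI by metis

text \<open>A sum of squares is not visibly a square, but the norm criterion is additive by the
  triangle inequality.\<close>

lemma cpos_add:
  fixes a b :: "'a::cstar_algebra"
  assumes "cpos a" "cpos b"
  shows "cpos (a + b)"
proof (rule cpos_if_norm_diff[of _ "norm a + norm b"])
  show "star (a + b) = a + b" using assms by (simp add: star_simps cpos_sa)
  have *: "of_real (norm a + norm b) - (a + b) = (of_real (norm a) - a) + (of_real (norm b) - b)" by simp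
  show "norm (of_real (norm a + norm b) - (a + b)) \<le> norm a + norm b"
    unfolding * by (intro norm_triangle_mono cpos_norm_diff assms order_refl)
qed

lemma cpos_norm_shift:
  fixes k :: "'a::cstar_algebra"
  assumes k: "cpos k" and s: "0 \<le> s"
  shows "norm (k + of_real s) = norm k + s"
proof (cases "k = 0")
  case False
  define m where "m = norm k"
  \<comment> \<open>The weight with \<open>l s = (1 - l) m / 2\<close>. It makes the scalars cancel,
    so that \<open>k = l (k + s) - (1 - l) (m / 2 - k)\<close>, where the last bracket has norm at
    most \<open>m / 2\<close>.\<close>
  define l where "l = (m / 2) / (s + m / 2)"
  have m: "m > 0" using False by (simp add: m_def)
  have l: "0 < l" "l \<le> 1" and ls: "l * s = (1 - l) * (m / 2)" and lm: "l * (2 * s + m) = m"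
  proof -
    have "s + m / 2 > 0" using m s by linarith
    then show "0 < l" "l \<le> 1" "l * s = (1 - l) * (m / 2)" "l * (2 * s + m) = m"
      unfolding l_def using m s by (simp_all add: divide_simps)
  qed
  have "l *\<^sub>R (k + of_real s) - (1 - l) *\<^sub>R (of_real (m / 2) - k) = k + of_real (l * s - (1 - l) * (m / 2))"
    by (simp add: of_real_def algebra_simps)
  then have e: "l *\<^sub>R (k + of_real s) - (1 - l) *\<^sub>R (of_real (m / 2) - k) = k" by (simp add: ls)
  have "m \<le> norm (l *\<^sub>R (k + of_real s)) + norm ((1 - l) *\<^sub>R (of_real (m / 2) - k))"
    using norm_triangle_ineq4[of "l *\<^sub>R (k + of_real s)" "(1 - l) *\<^sub>R (of_real (m / 2) - k)"]
    unfolding e by (simp only: m_def)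
  also have "\<dots> \<le> l * norm (k + of_real s) + (1 - l) * (m / 2)"
    using l mult_left_mono[OF cpos_norm_half[OF k], of "1 - l"] by (simp add: m_def)
  finally have "l * (2 * s + m) \<le> l * norm (k + of_real s) + l * s" using ls lm by simp
  then have "l * (2 * s + m) \<le> l * (norm (k + of_real s) + s)" by (simp add: algebra_simps)
  then have "2 * s + m \<le> norm (k + of_real s) + s" using l(1) by simp
  then show ?thesis using norm_triangle_ineq[of k "of_real s"] s by (simp add: m_def)
qed (use s in simp)

lemma cpos_norm_le:
  fixes k :: "'a::cstar_algebra"
  assumes k: "cpos k" and c: "cpos (of_real t - k)"
  shows "norm k \<le> t"
proof -
  \<comment> \<open>Large enough for the norm bound on \<open>of_real t - k\<close>; the shift by
    \<open>T - t\<close> \<ge> 0 is then removed exactly, since it adds to the norm of a positive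
    element.\<close>
  define T where "T = max t (norm (of_real t - k))"
  have *: "k + of_real (T - t) = of_real T - (of_real t - k)" by simp
  have "norm (k + of_real (T - t)) \<le> T" unfolding * by (rule cpos_norm_diff[OF c]) (simp add: T_def)
  moreover have "norm (k + of_real (T - t)) = norm k + (T - t)" by (rule cpos_norm_shift[OF k]) (simp add: T_def)
  ultimately show ?thesis by linarith
qed

text \<open>If \<open>z\<^sup>*z = -w\<^sup>2\<close> then \<open>zz\<^sup>*\<close> is positive, so for \<open>norm z = 1\<close> the element
  \<open>z\<^sup>*(1 - zz\<^sup>*)z = -(w\<^sup>2 + w\<^sup>4)\<close> has norm at most 1, whereas \<open>w\<^sup>2 + w\<^sup>4\<close> has norm 2.\<close>

lemma star_mult_self_negative:
  fixes z :: "'a::cstar_algebra"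
  assumes z: "star z * z = - (w * w)" and w: "star w = w"
  shows "z = 0"
proof -
  have contradiction: False
    if z: "star z * z = - (w * w)" and w: "star w = w" and nz: "norm z = 1" for z w :: 'a
  proof -
    \<comment> \<open>The Cartesian decomposition of \<open>z\<close>. It gives
      \<open>z * star z + star z * z = 2 (u * u + v * v)\<close>, so \<open>z * star z\<close> is a
      sum of squares.\<close>
    define u v where "u = (1/2) *\<^sub>R (z + star z)" and "v = (1/2) *\<^sub>R (\<i> *\<^sub>C (star z - z))"
    have us: "star u = u" unfolding u_def star_scaleR star_add star_star by (simp only: add.commute)
    have vs: "star v = v" unfolding v_def star_scaleR star_scaleC star_diff star_star
      by (simp add: cvector.scale_minus_left cvector.scale_right_diff_distrib)
    have "4 *\<^sub>R (u * u + v * v) = (z + star z) * (z + star z) + (\<i> *\<^sub>C (star z - z)) * (\<i> *\<^sub>C (star z - z))"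
    proof -
      have "4 *\<^sub>R (((1/2) *\<^sub>R x) * ((1/2) *\<^sub>R x) + ((1/2) *\<^sub>R y) * ((1/2) *\<^sub>R y)) = x * x + y * y" for x y :: 'a
        by (simp add: scaleR_add_right)
      then show ?thesis unfolding u_def v_def .
    qed
    also have "\<dots> = 2 *\<^sub>R (z * star z + star z * z)"
      by (simp add: mult_scaleC_left mult_scaleC_right i_scaleC_i algebra_simps scaleR_2)
    finally have "2 *\<^sub>R (2 *\<^sub>R (u * u + v * v)) = 2 *\<^sub>R (z * star z + star z * z)" by simp
    then have "2 *\<^sub>R (u * u + v * v) = z * star z + star z * z" by (simp only: scaleR_cancel_left) simp
    then have "z * star z = 2 *\<^sub>R (u * u + v * v) + w * w" by (simp add: z)
    moreover have "cpos \<dots>" by (intro cpos_add cpos_scaleR cposI us vs w) simp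
    ultimately have "cpos (z * star z)" by simp
    then have "norm (1 - z * star z) \<le> 1"
      using cpos_norm_diff[of "z * star z" 1] by (simp add: norm_mult_star nz)
    then have "norm (star z) * norm (1 - z * star z) * norm z \<le> 1" by (simp add: norm_star nz)
    moreover have "norm (star z * (1 - z * star z) * z) \<le> norm (star z) * norm (1 - z * star z) * norm z"
      by (meson mult_right_mono norm_ge_zero norm_mult_ineq order_trans)
    moreover have "star z * (1 - z * star z) * z = star z * z - (star z * z) * (star z * z)"
      by (simp add: algebra_simps)
    moreover have "\<dots> = - (w * w + (w * w) * (w * w))" by (simp add: z)
    ultimately have n1: "norm (w * w + (w * w) * (w * w)) \<le> 1" by (metis norm_minus_cancel order_trans)
    define p where "p = w * w"
    have p: "cpos p" unfolding p_def by (rule cposI[OF w])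
    have "norm (star z * z) = 1" by (simp add: norm_star_mult nz)
    then have np: "norm p = 1" by (simp add: p_def z)
    \<comment> \<open>Completing the square: \<open>p + p * p + 1/4\<close> is the square of
      \<open>p + 1/2\<close>, whose norm is known exactly to be 3/2.\<close>
    have sh: "norm (p + of_real (1/2)) = 3/2" using cpos_norm_shift[OF p, of "1/2"] np by simp
    have "norm ((p + of_real (1/2)) * (p + of_real (1/2))) = 9/4"
      by (subst norm_sa_square) (simp_all only: sh star_simps cpos_sa[OF p] cpos_sa[OF cpos_of_real], simp_all add: power2_eq_square)
    moreover have "(p + of_real (1/2)) * (p + of_real (1/2)) = (p + p * p) + of_real (1/4)"
      using scaleR_half_double[of p] by (simp add: of_real_def algebra_simps del: of_real_divide)
    ultimately have "9/4 \<le> norm (p + p * p) + norm (of_real (1/4) :: 'a)" by (metis norm_triangle_ineq)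
    then have "9/4 \<le> norm (p + p * p) + 1/4" unfolding norm_of_real by simp
    then show False using n1 by (simp add: p_def)
  qed
  show ?thesis
  proof (rule ccontr)
    assume "z \<noteq> 0"
    define r where "r = inverse (norm z)"
    have "star (r *\<^sub>R z) * (r *\<^sub>R z) = - ((r *\<^sub>R w) * (r *\<^sub>R w))" by (simp add: star_simps z)
    from contradiction[OF this] show False using \<open>z \<noteq> 0\<close> w by (simp add: star_simps r_def)
  qed
qed

text \<open>Let \<open>m\<close> be the root of \<open>k * k\<close>, the absolute value of
  \<open>k\<close>; then \<open>r = m - k\<close> is twice the negative part. With
  \<open>p * p = m\<close>, the element
  \<open>star (y * r) * (y * r) = r * k * r = - m * r * r\<close> is the negative of the square of
  \<open>p * r\<close>. This forces \<open>y * r = 0\<close>, hence \<open>m * r * r = 0\<close>,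
  hence the fourth power of \<open>r\<close> vanishes and \<open>k = m\<close>.\<close>

lemma cpos_star_mult_self: "cpos (star y * (y :: 'a::cstar_algebra))"
proof -
  define k where "k = star y * y"
  have ks: "star k = k" by (simp add: k_def star_simps)
  have "norm (of_real (norm (k * k)) - k * k) \<le> norm (k * k)"
    by (rule cpos_norm_diff[OF cposI[OF ks] order_refl])
  moreover have "star (k * k) = k * k" by (simp add: star_simps ks)
  ultimately obtain m t where m: "star m = m" "k * k = m * m" "norm (of_real t - m) \<le> t"
    and mc: "\<And>x. x * (k * k) = (k * k) * x \<Longrightarrow> x * m = m * x"
    by (metis subalgebra_sqrt[OF subalgebra_UNIV UNIV_I])
  obtain p where p: "star p = p" "m = p * p" and pc: "\<And>x. x * m = m * x \<Longrightarrow> x * p = p * x"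
    by (metis subalgebra_sqrt[OF subalgebra_UNIV UNIV_I m(1) m(3)])
  have km: "k * m = m * k" by (rule mc) (simp add: mult.assoc)
  define r where "r = m - k"
  have rs: "star r = r" by (simp add: r_def star_simps ks m)
  have rp: "r * p = p * r" by (rule pc) (simp add: r_def algebra_simps km)
  have rk: "r * k = - (m * r)" by (simp add: r_def algebra_simps km m)
  have rr: "r * r = 2 *\<^sub>R (m * r)" by (simp add: r_def algebra_simps km m scaleR_2)
  have ww: "(p * r) * (p * r) = m * r * r" by (metis rp p(2) mult.assoc)
  have sw: "star (p * r) = p * r" by (simp add: star_simps rs p rp)
  have "star (y * r) * (y * r) = r * k * r" by (simp add: star_simps rs k_def mult.assoc)
  also have "\<dots> = - ((p * r) * (p * r))" by (simp add: rk ww)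
  finally have zz: "star (y * r) * (y * r) = - ((p * r) * (p * r))" .
  have "y * r = 0" by (rule star_mult_self_negative[OF zz sw])
  with zz have "m * r * r = 0" by (simp add: ww)
  moreover have "(r * r) * (r * r) = 2 *\<^sub>R (m * r * r * r)" by (subst rr) (simp add: mult.assoc)
  ultimately have "norm ((r * r) * (r * r)) = 0" by simp
  then have "norm r = 0" by (simp add: norm_sa_square star_simps rs)
  then have "k = p * p" by (simp add: r_def p)
  with p(1) show ?thesis by (auto simp: cpos_def k_def)
qed

section \<open>The Hahn--Banach theorem\<close>

text \<open>Values of either sign are allowed, and homogeneity is an inequality for positive
  \<open>t\<close>, the form that infima inherit directly; equality follows by scaling back.\<close>

definition sublinear :: "('a::real_vector \<Rightarrow> real) \<Rightarrow> bool" where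
  "sublinear p \<longleftrightarrow> (\<forall>x y. p (x + y) \<le> p x + p y) \<and> (\<forall>t>0. \<forall>x. p (t *\<^sub>R x) \<le> t * p x)"

lemma sublinear_add: "sublinear p \<Longrightarrow> p (x + y) \<le> p x + p y"
  by (simp add: sublinear_def)

lemma sublinear_scale:
  assumes "sublinear p" "0 < t"
  shows "p (t *\<^sub>R x) = t * p x"
proof (rule antisym)
  show "p (t *\<^sub>R x) \<le> t * p x" using assms by (simp add: sublinear_def)
  have "p (inverse t *\<^sub>R (t *\<^sub>R x)) \<le> inverse t * p (t *\<^sub>R x)"
    using assms by (metis sublinear_def positive_imp_inverse_positive)
  then show "t * p x \<le> p (t *\<^sub>R x)" using assms(2) by (simp add: field_simps)
qed

lemma sublinear_0: "sublinear p \<Longrightarrow> p 0 = 0"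
  using sublinear_scale[of p 2 0] by simp

lemma sublinear_lower: "sublinear p \<Longrightarrow> - p (- x) \<le> p x"
  using sublinear_add[of p x "- x"] sublinear_0[of p] by simp

text \<open>Stated for sets depending on \<open>x\<close>, because in the functional built from
  positivity the admissible values themselves vary with the argument.\<close>

lemma sublinear_Inf:
  fixes R :: "'a::real_vector \<Rightarrow> real set"
  assumes ne: "\<And>x. R x \<noteq> {}" and bdd: "\<And>x. bdd_below (R x)"
    and add: "\<And>x y r s. r \<in> R x \<Longrightarrow> s \<in> R y \<Longrightarrow> \<exists>u\<in>R (x + y). u \<le> r + s"
    and scale: "\<And>t x r. r \<in> R x \<Longrightarrow> 0 < t \<Longrightarrow> \<exists>u\<in>R (t *\<^sub>R x). u \<le> t * r"
  shows "sublinear (\<lambda>x. Inf (R x))"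
  unfolding sublinear_def
proof (intro conjI allI impI)
  fix x y :: 'a
  have *: "Inf (R (x + y)) \<le> r + s" if rs: "r \<in> R x" "s \<in> R y" for r s
  proof -
    obtain u where u: "u \<in> R (x + y)" "u \<le> r + s" using add[OF rs] by blast
    show ?thesis using cInf_lower[OF u(1) bdd] u(2) by linarith
  qed
  have "Inf (R (x + y)) - r \<le> Inf (R y)" if "r \<in> R x" for r
    by (rule cInf_greatest[OF ne]) (use *[OF that] in \<open>simp add: algebra_simps\<close>)
  then have "Inf (R (x + y)) - Inf (R y) \<le> Inf (R x)"
    by (intro cInf_greatest[OF ne]) (simp add: algebra_simps)
  then show "Inf (R (x + y)) \<le> Inf (R x) + Inf (R y)" by simp
next
  fix t :: real and x :: 'a assume t: "0 < t"
  have "Inf (R (t *\<^sub>R x)) / t \<le> Inf (R x)"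
  proof (rule cInf_greatest[OF ne])
    fix r assume "r \<in> R x"
    then obtain u where u: "u \<in> R (t *\<^sub>R x)" "u \<le> t * r" using scale t by blast
    then have "Inf (R (t *\<^sub>R x)) \<le> t * r" using cInf_lower[OF u(1) bdd] by linarith
    with t show "Inf (R (t *\<^sub>R x)) / t \<le> r" by (simp add: field_simps)
  qed
  with t show "Inf (R (t *\<^sub>R x)) \<le> t * Inf (R x)" by (simp add: field_simps)
qed

lemma sublinear_INF:
  fixes F :: "'i \<Rightarrow> 'a::real_vector \<Rightarrow> real"
  assumes "I \<noteq> {}" and "\<And>x. bdd_below ((\<lambda>i. F i x) ` I)"
    and "\<And>i j x y. i \<in> I \<Longrightarrow> j \<in> I \<Longrightarrow> \<exists>k\<in>I. F k (x + y) \<le> F i x + F j y"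
    and "\<And>i t x. i \<in> I \<Longrightarrow> 0 < t \<Longrightarrow> \<exists>k\<in>I. F k (t *\<^sub>R x) \<le> t * F i x"
  shows "sublinear (\<lambda>x. INF i\<in>I. F i x)"
proof (rule sublinear_Inf)
  fix x show "(\<lambda>i. F i x) ` I \<noteq> {}" using assms(1) by blast
next
  fix x show "bdd_below ((\<lambda>i. F i x) ` I)" by (rule assms(2))
next
  fix x y r s assume "r \<in> (\<lambda>i. F i x) ` I" "s \<in> (\<lambda>i. F i y) ` I"
  then show "\<exists>u\<in>(\<lambda>i. F i (x + y)) ` I. u \<le> r + s" using assms(3)[of _ _ x y] by auto
next
  fix t x r assume "r \<in> (\<lambda>i. F i x) ` I" "0 < (t::real)"
  then show "\<exists>u\<in>(\<lambda>i. F i (t *\<^sub>R x)) ` I. u \<le> t * r" using assms(4)[of _ t x] by auto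
qed

text \<open>Allowing moves along the ray of \<open>z\<close>, credited with \<open>p z\<close> per
  unit, lowers \<open>p\<close>. The unit move from \<open>- z\<close> ends at 0 and gives the last
  bound; subadditivity keeps the infimum above \<open>- p (- x)\<close>.\<close>

lemma sublinear_improve:
  assumes p: "sublinear p"
  obtains q where "sublinear q" "\<And>x. q x \<le> p x" "q (- z) \<le> - p z"
proof
  let ?F = "\<lambda>t x. p (x + t *\<^sub>R z) - t * p z"
  let ?q = "\<lambda>x. INF t\<in>{0..}. ?F t x"
  have bdd: "bdd_below ((\<lambda>t. ?F t x) ` {0..})" for x
  proof (rule bdd_belowI2)
    fix t :: real assume "t \<in> {0..}"
    then have "p (t *\<^sub>R z) = t * p z"
      by (cases "t = 0") (simp_all add: sublinear_0[OF p] sublinear_scale[OF p])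
    then show "- p (- x) \<le> ?F t x" using sublinear_add[OF p, of "x + t *\<^sub>R z" "- x"] by simp
  qed
  show "sublinear ?q"
  proof (rule sublinear_INF[OF _ bdd])
    fix i j :: real and x y :: 'a assume "i \<in> {0..}" "j \<in> {0..}"
    then show "\<exists>k\<in>{0..}. ?F k (x + y) \<le> ?F i x + ?F j y"
      using sublinear_add[OF p, of "x + i *\<^sub>R z" "y + j *\<^sub>R z"]
      by (intro bexI[of _ "i + j"]) (simp_all add: algebra_simps)
  next
    fix i t :: real and x :: 'a assume it: "i \<in> {0..}" "0 < t"
    show "\<exists>k\<in>{0..}. ?F k (t *\<^sub>R x) \<le> t * ?F i x"
      using sublinear_scale[OF p it(2), of "x + i *\<^sub>R z"] it
      by (intro bexI[of _ "t * i"]) (simp_all add: algebra_simps)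
  qed simp
  show "?q x \<le> p x" for x
    using cINF_lower[OF bdd, of 0 x] by simp
  show "?q (- z) \<le> - p z"
    using cINF_lower[OF bdd, of 1 "- z"] sublinear_0[OF p] by simp
qed

lemma sublinear_minimal:
  assumes p: "sublinear p"
  obtains m where "sublinear m" "\<And>x. m x \<le> p x"
    "\<And>q. sublinear q \<Longrightarrow> (\<And>x. q x \<le> m x) \<Longrightarrow> q = m"
proof -
  define A where "A = {q. sublinear q \<and> q \<le> p}"
  \<comment> \<open>The order is reversed: Zorn's lemma delivers a maximal element, and a minimal
    functional is wanted.\<close>
  define P where "P a b \<longleftrightarrow> b \<le> a" for a b :: "'a \<Rightarrow> real"
  have "\<exists>m\<in>A. \<forall>a\<in>A. P m a \<longrightarrow> a = m"
  proof (rule predicate_Zorn)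
    show "partial_order_on A (relation_of P A)"
      by (rule partial_order_on_relation_ofI) (auto simp: P_def)
    fix C assume C: "C \<in> Chains (relation_of P A)"
    have CA: "q \<in> A" if "q \<in> C" for q using C that by (auto simp: Chains_def relation_of_def)
    have Cl: "q \<le> r \<or> r \<le> q" if "q \<in> C" "r \<in> C" for q r
      using C that by (auto simp: Chains_def relation_of_def P_def)
    show "\<exists>u\<in>A. \<forall>a\<in>C. P a u"
    proof (cases "C = {}")
      case True
      then show ?thesis using p by (intro bexI[of _ p]) (auto simp: A_def)
    next
      case False
      let ?u = "\<lambda>x. INF q\<in>C. q x"
      \<comment> \<open>Every sublinear functional below \<open>p\<close> stays above
        \<open>- p (- x)\<close>, so infima along chains are finite.\<close>
      have bdd: "bdd_below ((\<lambda>q. q x) ` C)" for x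
      proof (rule bdd_belowI2)
        fix q assume "q \<in> C"
        then have "sublinear q" "q \<le> p" using CA by (auto simp: A_def)
        then show "- p (- x) \<le> q x" using sublinear_lower[of q x] le_funD[of q p "- x"] by linarith
      qed
      have "sublinear ?u"
      proof (rule sublinear_INF[OF False bdd])
        fix i j :: "'a \<Rightarrow> real" and x y assume ij: "i \<in> C" "j \<in> C"
        then obtain k where k: "k \<in> C" "k \<le> i" "k \<le> j" using Cl by blast
        then have "k (x + y) \<le> k x + k y" using CA by (auto simp: A_def sublinear_add)
        then show "\<exists>k\<in>C. k (x + y) \<le> i x + j y"
          using k le_funD[of k i x] le_funD[of k j y] by (intro bexI[of _ k]) auto
      next
        fix i :: "'a \<Rightarrow> real" and t :: real and x assume "i \<in> C" "0 < t"
        then show "\<exists>k\<in>C. k (t *\<^sub>R x) \<le> t * i x"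
          using CA by (intro bexI[of _ i]) (auto simp: A_def sublinear_def)
      qed
      moreover have "?u \<le> q" if "q \<in> C" for q
        using cINF_lower[OF bdd that] by (simp add: le_fun_def)
      moreover obtain q where "q \<in> C" "q \<le> p" using False CA by (auto simp: A_def)
      ultimately have "sublinear ?u" "?u \<le> p" "\<And>q. q \<in> C \<Longrightarrow> ?u \<le> q" by (blast intro: order_trans)+
      then show ?thesis by (intro bexI[of _ ?u]) (auto simp: A_def P_def)
    qed
  qed
  then obtain m where m: "m \<in> A" "\<And>a. a \<in> A \<Longrightarrow> a \<le> m \<Longrightarrow> a = m" unfolding P_def by blast
  show ?thesis
  proof (rule that[of m])
    show "sublinear m" "m x \<le> p x" for x using m(1) by (auto simp: A_def le_funD)
    fix q assume q: "sublinear q" "\<And>x. q x \<le> m x"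
    then have "q \<le> m" by (simp add: le_funI)
    then show "q = m" using m q(1) by (auto simp: A_def intro: order_trans)
  qed
qed

text \<open>A minimal sublinear functional is linear: improving it at any \<open>z\<close> cannot
  change it, so \<open>m (- z) = - m z\<close>, and an odd subadditive functional is
  additive.\<close>

theorem hahn_banach:
  assumes p: "sublinear p"
  obtains f where "linear f" "\<And>x. f x \<le> p x"
proof -
  obtain m where m: "sublinear m" "\<And>x. m x \<le> p x"
    and min: "\<And>q. sublinear q \<Longrightarrow> (\<And>x. q x \<le> m x) \<Longrightarrow> q = m"
    using sublinear_minimal[OF p] by blast
  have neg: "m (- z) = - m z" for z
  proof -
    obtain q where "sublinear q" "\<And>x. q x \<le> m x" "q (- z) \<le> - m z"
      using sublinear_improve[OF m(1)] by blast
    with min[of q] have "m (- z) \<le> - m z" by simp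
    then show ?thesis using sublinear_lower[OF m(1), of "- z"] by simp
  qed
  have "linear m"
  proof (rule linearI)
    fix x y
    show "m (x + y) = m x + m y"
      using sublinear_add[OF m(1), of x y] sublinear_add[OF m(1), of "x + y" "- y"] by (simp add: neg)
  next
    fix t :: real and x
    consider "t > 0" | "t = 0" | "- t > 0" by linarith
    then show "m (t *\<^sub>R x) = t *\<^sub>R m x"
    proof cases
      case 3
      then have "m (- ((- t) *\<^sub>R x)) = - ((- t) * m x)" by (simp only: neg sublinear_scale[OF m(1)])
      then show ?thesis by simp
    qed (simp_all add: sublinear_scale[OF m(1)] sublinear_0[OF m(1)])
  qed
  with m(2) that show thesis by blast
qed

text \<open>After improving \<open>p\<close> at \<open>z\<close>, every linear functional below
  takes at most \<open>- p z\<close> at \<open>- z\<close>, hence at least \<open>p z\<close> at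
  \<open>z\<close>.\<close>

theorem hahn_banach_norming:
  assumes p: "sublinear p"
  obtains f where "linear f" "\<And>x. f x \<le> p x" "f z = p z"
proof -
  obtain q where q: "sublinear q" "\<And>x. q x \<le> p x" "q (- z) \<le> - p z"
    using sublinear_improve[OF p] by blast
  obtain f where f: "linear f" "\<And>x. f x \<le> q x" using hahn_banach[OF q(1)] by blast
  have "- f z \<le> - p z" using f(2)[of "- z"] q(3) linear_neg[OF f(1), of z] by simp
  moreover have le: "f x \<le> p x" for x using f(2)[of x] q(2)[of x] by linarith
  ultimately have "f z = p z" using le[of z] by linarith
  with f(1) le that show thesis by blast
qed

text \<open>The infimum over \<open>s\<close> in \<open>S\<close> of \<open>p (x - s) + g s\<close>
  is sublinear, lies below \<open>p\<close>, and below \<open>g\<close> on \<open>S\<close>. A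
  linear functional under it equals \<open>g\<close> on \<open>S\<close> because \<open>S\<close> is
  symmetric.\<close>

theorem hahn_banach_extension:
  assumes p: "sublinear p" and S: "subspace S"
    and add: "\<And>x y. x \<in> S \<Longrightarrow> y \<in> S \<Longrightarrow> g (x + y) = g x + g y"
    and scale: "\<And>t x. x \<in> S \<Longrightarrow> g (t *\<^sub>R x) = t * g x"
    and le: "\<And>x. x \<in> S \<Longrightarrow> g x \<le> p x"
  obtains f where "linear f" "\<And>x. f x \<le> p x" "\<And>x. x \<in> S \<Longrightarrow> f x = g x"
proof -
  let ?F = "\<lambda>s x. p (x - s) + g s"
  let ?q = "\<lambda>x. INF s\<in>S. ?F s x"
  have neg: "g (- x) = - g x" if "x \<in> S" for x using scale[OF that, of "- 1"] by simp
  have "g 0 = 0" using scale[of 0 0] subspace_0[OF S] by simp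
  have bdd: "bdd_below ((\<lambda>s. ?F s x) ` S)" for x
  proof (rule bdd_belowI2)
    fix s assume "s \<in> S"
    then show "- p (- x) \<le> ?F s x"
      using le[of "- s"] neg[of s] subspace_neg[OF S, of s] sublinear_add[OF p, of "x - s" "- x"] by simp
  qed
  have "sublinear ?q"
  proof (rule sublinear_INF[OF _ bdd])
    show "S \<noteq> {}" using subspace_0[OF S] by blast
  next
    fix i j x y assume "i \<in> S" "j \<in> S"
    then show "\<exists>k\<in>S. ?F k (x + y) \<le> ?F i x + ?F j y"
      using sublinear_add[OF p, of "x - i" "y - j"] add[of i j]
      by (intro bexI[of _ "i + j"]) (simp_all add: subspace_add[OF S] algebra_simps)
  next
    fix i and t :: real and x assume it: "i \<in> S" "0 < t"
    show "\<exists>k\<in>S. ?F k (t *\<^sub>R x) \<le> t * ?F i x"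
      using sublinear_scale[OF p it(2), of "x - i"] scale[OF it(1), of t] it
      by (intro bexI[of _ "t *\<^sub>R i"]) (simp_all add: subspace_scale[OF S] algebra_simps)
  qed
  from hahn_banach[OF this] obtain f where f: "linear f" "\<And>x. f x \<le> ?q x" by blast
  have qF: "f x \<le> ?F s x" if "s \<in> S" for s x using f(2)[of x] cINF_lower[OF bdd that, of x] by linarith
  have fg: "f s \<le> g s" if "s \<in> S" for s using qF[OF that, of s] sublinear_0[OF p] by simp
  show thesis
  proof (rule that[OF f(1)])
    show "f x \<le> p x" for x using qF[OF subspace_0[OF S], of x] \<open>g 0 = 0\<close> by simp
    show "f x = g x" if "x \<in> S" for x
      using fg[OF that] fg[OF subspace_neg[OF S that]] neg[OF that] linear_neg[OF f(1), of x] by simp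
  qed
qed

section \<open>The quotient norm of a C*-subalgebra is Leibniz\<close>

lemma quotient_norm_le: "b \<in> N \<Longrightarrow> quotient_norm N a \<le> norm (a - b)"
  unfolding quotient_norm_def by (rule cINF_lower[OF bdd_belowI2[where m=0]]) auto

lemma quotient_norm_lessD:
  assumes "N \<noteq> {}" "quotient_norm N a < e"
  obtains b where "b \<in> N" "norm (a - b) < e"
  using assms cINF_less_iff[OF assms(1) bdd_belowI2[where m=0], of "\<lambda>b. norm (a - b)" e]
  unfolding quotient_norm_def by auto

context
  fixes N :: "'a::cstar_algebra set"
  assumes N: "unital_cstar_subalgebra N"
begin

lemma quotient_norm_nonneg: "0 \<le> quotient_norm N a"
  unfolding quotient_norm_def by (rule cINF_greatest) (use subalgebra_1[OF N] in auto)

lemma quotient_norm_approx: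
  assumes "0 < e"
  obtains b where "b \<in> N" "norm (a - b) < quotient_norm N a + e"
  by (rule quotient_norm_lessD[of N a "quotient_norm N a + e"]) (use subalgebra_1[OF N] assms in auto)

lemma quotient_norm_le_norm: "quotient_norm N a \<le> norm a"
  using quotient_norm_le[OF subalgebra_0[OF N], of a] by simp

lemma quotient_norm_eq_0_iff: "quotient_norm N a = 0 \<longleftrightarrow> a \<in> N"
proof
  assume "a \<in> N"
  then show "quotient_norm N a = 0" using quotient_norm_le[of a N a] quotient_norm_nonneg[of a] by simp
next
  assume 0: "quotient_norm N a = 0"
  have "a \<in> closure N"
    unfolding closure_approachable using quotient_norm_approx[of _ a] 0
    by (metis add_0 dist_commute dist_norm)
  then show "a \<in> N" using subalgebra_closed[OF N] by simp
qed

lemma quotient_norm_add: "quotient_norm N (x + y) \<le> quotient_norm N x + quotient_norm N y"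
proof (rule field_le_epsilon)
  fix e :: real assume "0 < e"
  then have e: "0 < e / 2" by simp
  obtain b c where "b \<in> N" "norm (x - b) < quotient_norm N x + e / 2"
    "c \<in> N" "norm (y - c) < quotient_norm N y + e / 2"
    by (meson quotient_norm_approx[OF e])
  moreover have "norm (x + y - (b + c)) \<le> norm (x - b) + norm (y - c)"
    using norm_triangle_ineq[of "x - b" "y - c"] by (simp add: algebra_simps)
  ultimately show "quotient_norm N (x + y) \<le> quotient_norm N x + quotient_norm N y + e"
    using quotient_norm_le[OF subalgebra_add[OF N, of b c], of "x + y"] by linarith
qed

lemma quotient_norm_scaleC: "quotient_norm N (c *\<^sub>C x) = cmod c * quotient_norm N x"
proof (cases "c = 0")
  case True
  then show ?thesis using quotient_norm_eq_0_iff[of 0] subalgebra_0[OF N] by simp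
next
  case False
  have le: "quotient_norm N (c *\<^sub>C x) \<le> cmod c * quotient_norm N x" if "c \<noteq> 0" for c x
  proof -
    have "quotient_norm N (c *\<^sub>C x) / cmod c \<le> quotient_norm N x"
      unfolding quotient_norm_def[of N x]
    proof (rule cINF_greatest)
      fix b assume "b \<in> N"
      then have "quotient_norm N (c *\<^sub>C x) \<le> norm (c *\<^sub>C x - c *\<^sub>C b)"
        by (intro quotient_norm_le subalgebra_scaleC[OF N])
      also have "\<dots> = cmod c * norm (x - b)" by (simp flip: cvector.scale_right_diff_distrib norm_scaleC)
      finally show "quotient_norm N (c *\<^sub>C x) / cmod c \<le> norm (x - b)" using that by (simp add: field_simps)
    qed (use subalgebra_1[OF N] in auto)
    then show ?thesis using that by (simp add: field_simps)
  qed
  have "quotient_norm N (inverse c *\<^sub>C c *\<^sub>C x) \<le> cmod (inverse c) * quotient_norm N (c *\<^sub>C x)"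
    using False by (intro le) simp
  then have "cmod c * quotient_norm N x \<le> quotient_norm N (c *\<^sub>C x)"
    using False by (simp add: scaleC_scaleC norm_divide field_simps)
  with le[OF False] show ?thesis by (rule antisym)
qed

lemma quotient_norm_scaleR: "quotient_norm N (t *\<^sub>R x) = \<bar>t\<bar> * quotient_norm N x"
  by (simp add: scaleR_scaleC quotient_norm_scaleC)

lemma sublinear_quotient_norm: "sublinear (quotient_norm N)"
  by (simp add: sublinear_def quotient_norm_add quotient_norm_scaleR)

lemma quotient_norm_lipschitz: "\<bar>quotient_norm N x - quotient_norm N y\<bar> \<le> norm (x - y)"
proof -
  have "quotient_norm N u \<le> quotient_norm N v + norm (u - v)" for u v
    using quotient_norm_add[of "u - v" v] quotient_norm_le_norm[of "u - v"] by simp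
  from this[of x y] this[of y x] show ?thesis by (simp add: norm_minus_commute abs_le_iff)
qed

lemma continuous_on_quotient_norm: "continuous_on A (quotient_norm N)"
  unfolding continuous_on_iff
proof (intro ballI allI impI)
  fix x and e :: real assume "0 < e"
  then show "\<exists>d>0. \<forall>x'\<in>A. dist x' x < d \<longrightarrow> dist (quotient_norm N x') (quotient_norm N x) < e"
    using quotient_norm_lipschitz unfolding dist_norm real_norm_def by (meson order_le_less_trans)
qed

end

lemma cpos_of_real_minus:
  fixes k :: "'a::cstar_algebra"
  assumes "star k = k" "norm k \<le> t"
  shows "cpos (of_real t - k)"
proof (rule cpos_if_norm_diff[of _ t])
  show "star (of_real t - k) = of_real t - k"
    using assms by (simp add: star_diff star_scaleR of_real_def)
qed (use assms in simp)

text \<open>The infimum defining \<open>p\<close> forces \<open>p (- a\<^sup>*a) \<le> - (f a)\<^sup>2\<close>, and the rotation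
  \<open>(a, b) \<mapsto> (c, d)\<close> below, which preserves \<open>a\<^sup>*a + b\<^sup>*b\<close>, makes \<open>p\<close> subadditive.\<close>

lemma functional_square_dominated:
  fixes f :: "'a::cstar_algebra \<Rightarrow> real"
  assumes f: "linear f" and le: "\<And>x. f x \<le> norm x"
  obtains \<phi> where "linear \<phi>" "\<And>k. cpos k \<Longrightarrow> 0 \<le> \<phi> k" "\<And>h. \<phi> h \<le> norm h"
    "\<And>a. (f a)\<^sup>2 \<le> \<phi> (star a * a)"
proof -
  define \<rho> where "\<rho> h = (1/2) *\<^sub>R (h + star h)" for h :: 'a
  have \<rho>: "\<rho> (x + y) = \<rho> x + \<rho> y" "\<rho> (t *\<^sub>R x) = t *\<^sub>R \<rho> x" "\<rho> (- x) = - \<rho> x"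
    "norm (\<rho> x) \<le> norm x" "star (\<rho> x) = \<rho> x" for x y t
    using norm_real_part_le[of x] by (simp_all add: \<rho>_def star_simps algebra_simps)
  have \<rho>_sa: "\<rho> x = x" if "star x = x" for x
    using that by (simp add: \<rho>_def flip: scaleR_2)
  have sq: "(f a)\<^sup>2 \<le> (norm a)\<^sup>2" for a
    using le[of a] le[of "- a"] linear_neg[OF f, of a] by (intro power2_le_iff_abs_le[THEN iffD2]) auto
  \<comment> \<open>In the order of the algebra: all \<open>t - (f a)\<^sup>2\<close> with
    \<open>\<rho> h + star a * a\<close> below the scalar \<open>t\<close>. Passing to the
    self-adjoint part \<open>\<rho> h\<close> covers every \<open>h\<close>; the choice
    \<open>a = 0\<close> bounds the infimum by \<open>norm h\<close>.\<close>
  define R where "R h = {t - (f a)\<^sup>2 |t a. cpos (of_real t - \<rho> h - star a * a)}" for h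
  have RI: "t - (f a)\<^sup>2 \<in> R h" if "cpos (of_real t - \<rho> h - star a * a)" for t a h
    using that by (auto simp: R_def)
  have bdd: "bdd_below (R h)" for h
  proof (rule bdd_belowI)
    fix r assume "r \<in> R h"
    then obtain t a where r: "r = t - (f a)\<^sup>2" and p: "cpos (of_real t - \<rho> h - star a * a)"
      by (auto simp: R_def)
    \<comment> \<open>Added to the constraint, this puts \<open>star a * a\<close> below
      \<open>t + norm h\<close>, so the square of \<open>norm a\<close>, and with it that of
      \<open>f a\<close>, is at most \<open>t + norm h\<close>.\<close>
    have "cpos (of_real (norm h) - \<rho> (- h))"
      using \<rho>(4)[of "- h"] by (intro cpos_of_real_minus \<rho>(5)) simp
    from cpos_add[OF p this] have "cpos (of_real (t + norm h) - star a * a)"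
      by (simp add: \<rho>(3) algebra_simps)
    from cpos_norm_le[OF cpos_star_mult_self this] sq[of a] show "- norm h \<le> r"
      by (simp add: r norm_star_mult)
  qed
  have "sublinear (\<lambda>h. Inf (R h))"
  proof (rule sublinear_Inf)
    fix h
    show "R h \<noteq> {}" using RI[of "norm h" h 0] cpos_of_real_minus[OF \<rho>(5,4), of h] by auto
    show "bdd_below (R h)" by (rule bdd)
  next
    fix x y r s assume "r \<in> R x" "s \<in> R y"
    then obtain t a t' b where r: "r = t - (f a)\<^sup>2" "s = t' - (f b)\<^sup>2"
      and p: "cpos (of_real t - \<rho> x - star a * a)" "cpos (of_real t' - \<rho> y - star b * b)"
      by (auto simp: R_def)
    \<comment> \<open>The unit vector along \<open>(f a, f b)\<close>, so that \<open>f c\<close>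
      alone accounts for \<open>(f a)\<^sup>2 + (f b)\<^sup>2\<close>; the remaining
      \<open>star d * d\<close> is positive and may be added to the constraint.\<close>
    obtain u v where uv: "u\<^sup>2 + v\<^sup>2 = 1" and fuv: "(u * f a + v * f b)\<^sup>2 = (f a)\<^sup>2 + (f b)\<^sup>2"
    proof (cases "(f a)\<^sup>2 + (f b)\<^sup>2 = 0")
      case True
      then show thesis using that[of 1 0] by (simp add: sum_power2_eq_zero_iff)
    next
      case False
      define m where "m = sqrt ((f a)\<^sup>2 + (f b)\<^sup>2)"
      have m: "m\<^sup>2 = (f a)\<^sup>2 + (f b)\<^sup>2" "m \<noteq> 0" using False by (simp_all add: m_def)
      then have "f a / m * f a + f b / m * f b = m"
        by (simp add: power2_eq_square flip: add_divide_distrib) (metis nonzero_mult_div_cancel_right)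
      moreover have "(f a / m)\<^sup>2 + (f b / m)\<^sup>2 = 1"
        unfolding power_divide add_divide_distrib[symmetric] m(1)[symmetric] using m(2) by simp
      ultimately show thesis using that m by metis
    qed
    define c d where "c = u *\<^sub>R a + v *\<^sub>R b" and "d = v *\<^sub>R a - u *\<^sub>R b"
    have "star c * c + star d * d = (u\<^sup>2 + v\<^sup>2) *\<^sub>R (star a * a + star b * b)"
      by (simp add: c_def d_def star_simps algebra_simps power2_eq_square)
    then have cd: "star d * d = star a * a + star b * b - star c * c" by (simp add: uv algebra_simps)
    have "cpos ((of_real t - \<rho> x - star a * a) + (of_real t' - \<rho> y - star b * b) + star d * d)"
      by (intro cpos_add p cpos_star_mult_self)
    then have "cpos (of_real (t + t') - \<rho> (x + y) - star c * c)" by (simp add: cd \<rho>(1) algebra_simps)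
    from RI[OF this] show "\<exists>w\<in>R (x + y). w \<le> r + s"
      using fuv by (intro bexI) (simp_all add: r c_def linear_add[OF f] linear_scale[OF f])
  next
    fix t :: real and x r assume "r \<in> R x" and t: "0 < t"
    then obtain m a where r: "r = m - (f a)\<^sup>2" and p: "cpos (of_real m - \<rho> x - star a * a)"
      by (auto simp: R_def)
    have "cpos (t *\<^sub>R (of_real m - \<rho> x - star a * a))" using t by (intro cpos_scaleR p) simp
    moreover have "t *\<^sub>R (of_real m - \<rho> x - star a * a)
        = of_real (t * m) - \<rho> (t *\<^sub>R x) - star (sqrt t *\<^sub>R a) * (sqrt t *\<^sub>R a)"
      using t by (simp add: \<rho>(2) star_scaleR of_real_def algebra_simps)
    ultimately have "cpos \<dots>" by simp
    from RI[OF this] show "\<exists>w\<in>R (t *\<^sub>R x). w \<le> t * r"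
      using t by (intro bexI) (simp_all add: r linear_scale[OF f] power_mult_distrib algebra_simps)
  qed
  have R_le: "Inf (R h) \<le> t - (f a)\<^sup>2" if "cpos (of_real t - \<rho> h - star a * a)" for t a h
    by (rule cInf_lower[OF RI[OF that] bdd])
  from hahn_banach[OF \<open>sublinear (\<lambda>h. Inf (R h))\<close>] obtain \<phi> where \<phi>: "linear \<phi>" "\<And>h. \<phi> h \<le> Inf (R h)"
    by blast
  show thesis
  proof (rule that[OF \<phi>(1)])
    fix k :: 'a assume "cpos k"
    then have "Inf (R (- k)) \<le> 0 - (f 0)\<^sup>2" by (intro R_le) (simp add: \<rho>(3) \<rho>_sa cpos_sa)
    with \<phi>(2)[of "- k"] show "0 \<le> \<phi> k" by (simp add: linear_neg[OF \<phi>(1)] linear_0[OF f])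
  next
    fix h :: 'a
    have "Inf (R h) \<le> norm h - (f 0)\<^sup>2" using cpos_of_real_minus[OF \<rho>(5,4)] by (intro R_le) simp
    with \<phi>(2)[of h] show "\<phi> h \<le> norm h" by (simp add: linear_0[OF f])
  next
    fix a :: 'a
    have "Inf (R (- (star a * a))) \<le> 0 - (f a)\<^sup>2"
      by (intro R_le) (simp add: \<rho>(3) \<rho>_sa cpos_sa[OF cpos_star_mult_self] cposI[of 0, simplified])
    with \<phi>(2)[of "- (star a * a)"] show "(f a)\<^sup>2 \<le> \<phi> (star a * a)" by (simp add: linear_neg[OF \<phi>(1)])
  qed
qed

text \<open>The quadratic is the squared seminorm of \<open>b - s c\<close>. Its minimiser
  \<open>T / (2 * C)\<close> is the coefficient of the orthogonal projection of \<open>b\<close>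
  onto \<open>c\<close>: projecting does not lengthen \<open>b\<close>, and the minimum is at most
  the value at \<open>s = 1\<close>. For \<open>C = 0\<close>, nonnegativity for all
  \<open>s\<close> forces \<open>T = 0\<close>.\<close>

lemma quadratic_best_multiple:
  fixes A T C :: real
  assumes nonneg: "\<And>s. 0 \<le> A - s * T + s\<^sup>2 * C" and C: "0 \<le> C"
  obtains l where "l\<^sup>2 * C \<le> A" "A - l * T + l\<^sup>2 * C \<le> A - T + C"
proof (cases "C = 0")
  case True
  have "T = 0"
  proof (rule ccontr)
    assume "T \<noteq> 0"
    then show False using nonneg[of "(A + 1) / T"] True by simp
  qed
  then show thesis using that[of 0] nonneg[of 0] True by simp
next
  case False
  with C have C: "C > 0" by simp
  define l where "l = T / (2 * C)"
  have T: "T = 2 * C * l" using C by (simp add: l_def)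
  show thesis
  proof (rule that[of l])
    show "l\<^sup>2 * C \<le> A" using nonneg[of l] by (simp add: T power2_eq_square algebra_simps)
    have "0 \<le> C * (l - 1)\<^sup>2" using C by simp
    then show "A - l * T + l\<^sup>2 * C \<le> A - T + C" by (simp add: T power2_eq_square algebra_simps)
  qed
qed

theorem quotient_norm_mult:
  fixes a b :: "'a::cstar_algebra"
  assumes N: "unital_cstar_subalgebra N"
  shows "quotient_norm N (a * b) \<le> norm a * quotient_norm N b + norm b * quotient_norm N a"
proof -
  from hahn_banach_norming[OF sublinear_quotient_norm[OF N], of "a * b"]
  obtain f where f: "linear f" "\<And>x. f x \<le> quotient_norm N x" "f (a * b) = quotient_norm N (a * b)"
    by blast
  have fle: "f x \<le> norm x" for x using f(2)[of x] quotient_norm_le_norm[OF N, of x] by linarith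
  have f0: "f x = 0" if "x \<in> N" for x
    using f(2)[of x] f(2)[of "- x"] subalgebra_minus[OF N that] that
    by (simp add: linear_neg[OF f(1)] quotient_norm_eq_0_iff[OF N, THEN iffD2])
  from functional_square_dominated[OF f(1) fle]
  obtain \<phi> where \<phi>: "linear \<phi>" "\<And>k. cpos k \<Longrightarrow> 0 \<le> \<phi> k" "\<And>h. \<phi> h \<le> norm h"
    "\<And>a. (f a)\<^sup>2 \<le> \<phi> (star a * a)" by blast
  define Q where "Q x = \<phi> (star x * x)" for x
  have Q0: "0 \<le> Q x" for x unfolding Q_def by (intro \<phi>(2) cpos_star_mult_self)
  have Qn: "sqrt (Q x) \<le> norm x" for x
    using \<phi>(3)[of "star x * x"] by (intro real_le_lsqrt) (simp_all add: Q_def norm_star_mult)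
  \<comment> \<open>The scalar \<open>(norm x)\<^sup>2\<close> minus \<open>star x * x\<close> is a
    square \<open>q * q\<close>; sandwiching it between \<open>star y\<close> and \<open>y\<close>
    gives a positive element. Hence the left factor can be measured in norm and the right one in the
    seminorm of \<phi>.\<close>
  have fQ: "f (x * y) \<le> norm x * sqrt (Q y)" for x y
  proof -
    obtain q where q: "star q = q" "of_real ((norm x)\<^sup>2) - star x * x = q * q"
      using cpos_of_real_minus[OF cpos_sa[OF cpos_star_mult_self], of x "(norm x)\<^sup>2"]
      by (auto simp: norm_star_mult cpos_def)
    have "star (q * y) * (q * y) = star y * (q * q) * y" by (simp add: star_mult q(1) mult.assoc)
    also have "\<dots> = (norm x)\<^sup>2 *\<^sub>R (star y * y) - star (x * y) * (x * y)"
      by (simp add: q(2)[symmetric] star_mult of_real_def algebra_simps)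
    finally have "0 \<le> \<phi> ((norm x)\<^sup>2 *\<^sub>R (star y * y) - star (x * y) * (x * y))"
      using \<phi>(2)[OF cpos_star_mult_self] by metis
    then have "(f (x * y))\<^sup>2 \<le> (norm x)\<^sup>2 * Q y"
      using \<phi>(4)[of "x * y"] by (simp add: Q_def linear_diff[OF \<phi>(1)] linear_scale[OF \<phi>(1)])
    then have "f (x * y) \<le> sqrt ((norm x)\<^sup>2 * Q y)" by (rule real_le_rsqrt)
    then show ?thesis by (simp add: real_sqrt_mult)
  qed
  have approx: "quotient_norm N (a * b) \<le> norm a * norm (b - c) + norm (a - d) * norm b"
    if c: "c \<in> N" and d: "d \<in> N" for c d
  proof -
    define T where "T = \<phi> (star b * c + star c * b)"
    have exp: "Q (b - s *\<^sub>R c) = Q b - s * T + s\<^sup>2 * Q c" for s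
    proof -
      have "star (b - s *\<^sub>R c) * (b - s *\<^sub>R c)
          = star b * b - s *\<^sub>R (star b * c + star c * b) + s\<^sup>2 *\<^sub>R (star c * c)"
        by (simp add: star_simps algebra_simps power2_eq_square)
      then show ?thesis
        by (simp add: Q_def T_def linear_diff[OF \<phi>(1)] linear_add[OF \<phi>(1)] linear_scale[OF \<phi>(1)])
    qed
    obtain l where l: "l\<^sup>2 * Q c \<le> Q b" "Q b - l * T + l\<^sup>2 * Q c \<le> Q b - T + Q c"
      using quadratic_best_multiple[of "Q b" T "Q c"] Q0 exp by metis
    have "Q (l *\<^sub>R c) = l\<^sup>2 * Q c"
      by (simp add: Q_def star_scaleR linear_scale[OF \<phi>(1)] power2_eq_square)
    with l(1) have "sqrt (Q (l *\<^sub>R c)) \<le> sqrt (Q b)" by simp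
    with Qn[of b] have 1: "sqrt (Q (l *\<^sub>R c)) \<le> norm b" by linarith
    have "Q (b - l *\<^sub>R c) \<le> Q (b - c)" using l(2) exp[of l] exp[of 1] by simp
    then have "sqrt (Q (b - l *\<^sub>R c)) \<le> sqrt (Q (b - c))" by simp
    with Qn[of "b - c"] have 2: "sqrt (Q (b - l *\<^sub>R c)) \<le> norm (b - c)" by linarith
    \<comment> \<open>The last summand lies in \<open>N\<close> and is invisible to
      \<open>f\<close>. With \<open>l c\<close> in place of \<open>c\<close> the middle one is
      controlled by \<open>norm b\<close> and not by \<open>norm c\<close>.\<close>
    have "a * b = a * (b - l *\<^sub>R c) + (a - d) * (l *\<^sub>R c) + d * (l *\<^sub>R c)" by (simp add: algebra_simps)
    then have "f (a * b) = f (a * (b - l *\<^sub>R c)) + f ((a - d) * (l *\<^sub>R c))"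
      using f0[of "d * (l *\<^sub>R c)"] c d
      by (simp only: linear_add[OF f(1)]) (simp add: subalgebra_mult[OF N] subalgebra_scaleR[OF N])
    also have "\<dots> \<le> norm a * sqrt (Q (b - l *\<^sub>R c)) + norm (a - d) * sqrt (Q (l *\<^sub>R c))"
      by (intro add_mono fQ)
    also have "\<dots> \<le> norm a * norm (b - c) + norm (a - d) * norm b"
      by (intro add_mono mult_left_mono 1 2 norm_ge_zero)
    finally show ?thesis by (simp add: f(3))
  qed
  show ?thesis
  proof (rule field_le_epsilon)
    fix e :: real assume "0 < e"
    define \<delta> where "\<delta> = e / (norm a + norm b + 1)"
    have D: "norm a + norm b + 1 > 0" using norm_ge_zero[of a] norm_ge_zero[of b] by linarith
    have \<delta>: "0 < \<delta>" using \<open>0 < e\<close> D by (simp add: \<delta>_def)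
    obtain c d where c: "c \<in> N" "norm (b - c) < quotient_norm N b + \<delta>"
      and d: "d \<in> N" "norm (a - d) < quotient_norm N a + \<delta>"
      by (meson quotient_norm_approx[OF N \<delta>])
    have "quotient_norm N (a * b) \<le> norm a * norm (b - c) + norm (a - d) * norm b" by (rule approx[OF c(1) d(1)])
    also have "\<dots> \<le> norm a * (quotient_norm N b + \<delta>) + (quotient_norm N a + \<delta>) * norm b"
      using c(2) d(2) by (intro add_mono mult_left_mono mult_right_mono norm_ge_zero) auto
    also have "\<dots> = norm a * quotient_norm N b + norm b * quotient_norm N a + \<delta> * (norm a + norm b)"
      by (simp add: algebra_simps)
    also have "\<delta> * (norm a + norm b) \<le> \<delta> * (norm a + norm b + 1)" using \<delta> by (intro mult_left_mono) auto
    also have "\<dots> = e" using D by (simp add: \<delta>_def)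
    finally show "quotient_norm N (a * b) \<le> norm a * quotient_norm N b + norm b * quotient_norm N a + e" by simp
  qed
qed

section \<open>States\<close>

lemma as_cstar_simps [simp]:
  "carrier (as_cstar S) = S" "x \<otimes>\<^bsub>as_cstar S\<^esub> y = x * y" "\<one>\<^bsub>as_cstar S\<^esub> = 1" "\<zero>\<^bsub>as_cstar S\<^esub> = 0"
  "x \<oplus>\<^bsub>as_cstar S\<^esub> y = x + y" "smul (as_cstar S) = scaleC" "adj (as_cstar S) = star" "nrm (as_cstar S) = norm"
  by (simp_all add: as_cstar_def)

lemma as_cstar_minus:
  assumes "unital_cstar_subalgebra S" "x \<in> S" "y \<in> S"
  shows "x \<ominus>\<^bsub>as_cstar S\<^esub> y = x - y"
proof -
  interpret unital_cstar "as_cstar S" by (rule unital_cstar_as_cstar[OF assms(1)])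
  have "\<ominus>\<^bsub>as_cstar S\<^esub> y = - y" by (rule minus_equality) (use assms subalgebra_minus in auto)
  then show ?thesis by (simp add: a_minus_def)
qed

lemma self_adjoint_as_cstar: "self_adjoint (as_cstar S) = {a \<in> S. star a = a}"
  by (simp add: self_adjoint_def)

lemma cdist_as_cstar:
  assumes "unital_cstar_subalgebra S" "x \<in> S" "y \<in> S"
  shows "cdist (as_cstar S) x y = dist x y"
  using assms by (simp add: cdist_def as_cstar_minus dist_norm)

lemma norm_topology_as_cstar:
  assumes S: "unital_cstar_subalgebra S"
  shows "norm_topology (as_cstar S) = subtopology euclidean S"
proof -
  interpret M: Metric_space S "cdist (as_cstar S)"
  proof
    show "0 \<le> cdist (as_cstar S) x y" for x y
      by (cases "x \<in> S \<and> y \<in> S") (auto simp: cdist_as_cstar[OF S], auto simp: cdist_def)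
    show "cdist (as_cstar S) x y = cdist (as_cstar S) y x" for x y
      by (cases "x \<in> S \<and> y \<in> S") (auto simp: cdist_as_cstar[OF S] dist_commute, auto simp: cdist_def)
  qed (auto simp: cdist_as_cstar[OF S] dist_triangle)
  have "openin M.mtopology V \<longleftrightarrow> openin (subtopology euclidean S) V" for V
  proof -
    have "M.mball x r \<subseteq> V \<longleftrightarrow> (\<forall>x'\<in>S. dist x' x < r \<longrightarrow> x' \<in> V)" if "x \<in> S" for x r
      using that by (auto simp: M.mball_def cdist_as_cstar[OF S] dist_commute)
    then show ?thesis unfolding M.openin_mtopology openin_euclidean_subtopology_iff by blast
  qed
  then show ?thesis by (simp add: norm_topology_def topology_eq)
qed

lemma states_as_cstar:
  "\<phi> \<in> states (as_cstar S) \<longleftrightarrow> \<phi> \<in> extensional S \<and> (\<forall>x\<in>S. \<forall>y\<in>S. \<phi> (x + y) = \<phi> x + \<phi> y) \<and>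
     (\<forall>c. \<forall>x\<in>S. \<phi> (c *\<^sub>C x) = c * \<phi> x) \<and> (\<forall>x\<in>S. \<phi> (star x * x) \<in> \<real>\<^sub>\<ge>\<^sub>0) \<and> \<phi> 1 = 1"
  by (simp add: states_def)

section \<open>Bounds for states and their extension\<close>

lemma sa_decomposition:
  fixes x :: "'a::cstar_algebra"
  assumes S: "unital_cstar_subalgebra S" and x: "x \<in> S"
  obtains u v where "u \<in> S" "v \<in> S" "star u = u" "star v = v" "x = u + \<i> *\<^sub>C v"
    "norm u \<le> norm x" "norm v \<le> norm x" "u = (1/2) *\<^sub>R (x + star x)"
proof -
  define u where "u = (1/2) *\<^sub>R (x + star x)"
  \<comment> \<open>The real part of \<open>- (\<i> *\<^sub>C x)\<close> is the imaginary part of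
    \<open>x\<close>, so one norm estimate serves both parts.\<close>
  define y where "y = - (\<i> *\<^sub>C x)"
  define v where "v = (1/2) *\<^sub>R (y + star y)"
  have sy: "star y = \<i> *\<^sub>C star x" by (simp add: y_def star_simps cvector.scale_minus_left)
  have "\<i> *\<^sub>C v = (1/2) *\<^sub>R (\<i> *\<^sub>C y + \<i> *\<^sub>C star y)"
    by (simp add: v_def linear_scale[OF bounded_linear.linear[OF bounded_linear_scaleC]] scaleC_add_right)
  also have "\<dots> = (1/2) *\<^sub>R (x - star x)"
    by (simp add: sy i_scaleC_i) (simp add: y_def cvector.scale_minus_right i_scaleC_i)
  finally have "u + \<i> *\<^sub>C v = (1/2) *\<^sub>R x + (1/2) *\<^sub>R x" by (simp add: u_def algebra_simps)
  then have x_eq: "x = u + \<i> *\<^sub>C v" by (simp flip: scaleR_add_left)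
  have "y \<in> S" by (simp add: y_def subalgebra_minus[OF S] subalgebra_scaleC[OF S] x)
  then have "v \<in> S" by (simp add: v_def subalgebra_scaleR[OF S] subalgebra_add[OF S] subalgebra_star[OF S])
  moreover have "u \<in> S" by (simp add: u_def x subalgebra_scaleR[OF S] subalgebra_add[OF S] subalgebra_star[OF S])
  moreover have "star u = u" "star v = v" by (simp_all add: u_def v_def star_scaleR star_add add.commute)
  moreover have "norm u \<le> norm x" unfolding u_def by (rule norm_real_part_le)
  moreover have "norm v \<le> norm x" using norm_real_part_le[of y] by (simp add: v_def y_def norm_scaleC)
  ultimately show thesis using that x_eq u_def by blast
qed

context
  fixes S :: "'a::cstar_algebra set" and \<phi>
  assumes S: "unital_cstar_subalgebra S" and \<phi>: "\<phi> \<in> states (as_cstar S)"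
begin

lemma state_add: "x \<in> S \<Longrightarrow> y \<in> S \<Longrightarrow> \<phi> (x + y) = \<phi> x + \<phi> y"
  and state_scaleC: "x \<in> S \<Longrightarrow> \<phi> (c *\<^sub>C x) = c * \<phi> x"
  and state_pos: "x \<in> S \<Longrightarrow> \<phi> (star x * x) \<in> \<real>\<^sub>\<ge>\<^sub>0"
  and state_1: "\<phi> 1 = 1"
  using \<phi> by (auto simp: states_as_cstar)

lemma state_scaleR: "x \<in> S \<Longrightarrow> \<phi> (t *\<^sub>R x) = of_real t * \<phi> x"
  by (simp add: scaleR_scaleC state_scaleC)

lemma state_diff: "x \<in> S \<Longrightarrow> y \<in> S \<Longrightarrow> \<phi> (x - y) = \<phi> x - \<phi> y"
  using state_add[of x "(- 1) *\<^sub>R y"] state_scaleR[of y "- 1"] subalgebra_minus[OF S, of y] by simp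

lemma state_of_real: "\<phi> (of_real t) = of_real t"
  using state_scaleR[of 1 t] subalgebra_1[OF S] by (simp add: of_real_def state_1)

text \<open>\<open>norm h - h\<close> lies within \<open>norm h\<close> of the scalar
  \<open>norm h\<close>, hence is a square. The root has to be found in \<open>S\<close>, as
  positivity of a state of \<open>S\<close> says nothing about elements outside.\<close>

lemma state_sa_upper:
  assumes h: "h \<in> S" "star h = h"
  shows "of_real (norm h) - \<phi> h \<in> \<real>\<^sub>\<ge>\<^sub>0"
proof -
  define k where "k = of_real (norm h) - h"
  have rS: "of_real (norm h) \<in> S" using subalgebra_scaleR[OF S subalgebra_1[OF S]] by (simp add: of_real_def)
  have "k \<in> S" using rS by (simp add: k_def subalgebra_diff[OF S] h)
  moreover have "star k = k" by (simp add: k_def star_diff star_scaleR of_real_def h)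
  moreover have "norm (of_real (norm h) - k) \<le> norm h" by (simp add: k_def)
  ultimately obtain q where q: "q \<in> S" "star q = q" "k = q * q" by (metis subalgebra_sqrt[OF S])
  then have "\<phi> k \<in> \<real>\<^sub>\<ge>\<^sub>0" using state_pos[OF q(1)] by simp
  then show ?thesis using rS h by (simp add: k_def state_diff state_of_real)
qed

lemma state_sa:
  assumes h: "h \<in> S" "star h = h"
  shows "Im (\<phi> h) = 0" "\<bar>Re (\<phi> h)\<bar> \<le> norm h"
proof -
  have 1: "of_real (norm h) - \<phi> h \<in> \<real>\<^sub>\<ge>\<^sub>0" by (rule state_sa_upper[OF h])
  have "of_real (norm (- h)) - \<phi> (- h) \<in> \<real>\<^sub>\<ge>\<^sub>0"
    by (rule state_sa_upper) (simp_all add: h subalgebra_minus[OF S] star_minus)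
  moreover have "\<phi> (- h) = - \<phi> h" using state_scaleR[OF h(1), of "- 1"] by simp
  ultimately show "Im (\<phi> h) = 0" "\<bar>Re (\<phi> h)\<bar> \<le> norm h" using 1 by (auto simp: complex_nonneg_Reals_iff)
qed

lemma cmod_state_sa: "h \<in> S \<Longrightarrow> star h = h \<Longrightarrow> cmod (\<phi> h) \<le> norm h"
  using state_sa[of h] by (simp add: cmod_def)

text \<open>The constant 2 comes from estimating the two Cartesian parts separately.\<close>

lemma cmod_state:
  assumes "x \<in> S"
  shows "cmod (\<phi> x) \<le> 2 * norm x"
proof -
  obtain u v where uv: "u \<in> S" "v \<in> S" "star u = u" "star v = v" "x = u + \<i> *\<^sub>C v" "norm u \<le> norm x" "norm v \<le> norm x"
    using sa_decomposition[OF S assms] by metis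
  have "\<phi> x = \<phi> u + \<i> * \<phi> v" using uv by (simp add: state_add state_scaleC subalgebra_scaleC[OF S])
  then have "cmod (\<phi> x) \<le> cmod (\<phi> u) + cmod (\<phi> v)" by (metis norm_triangle_ineq norm_mult norm_ii mult_1)
  then show ?thesis using cmod_state_sa[of u] cmod_state_sa[of v] uv by linarith
qed

lemma Re_state_le:
  assumes "x \<in> S"
  shows "Re (\<phi> x) \<le> norm ((1/2) *\<^sub>R (x + star x))"
proof -
  obtain u v where uv: "u \<in> S" "v \<in> S" "star u = u" "star v = v" "x = u + \<i> *\<^sub>C v" "u = (1/2) *\<^sub>R (x + star x)"
    using sa_decomposition[OF S assms] by metis
  have "\<phi> x = \<phi> u + \<i> * \<phi> v" unfolding uv(5)
    using uv(1,2) by (simp add: state_add state_scaleC subalgebra_scaleC[OF S])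
  then have "Re (\<phi> x) = Re (\<phi> u)" using state_sa[OF uv(2,4)] by simp
  then show ?thesis using state_sa[OF uv(1,3)] uv(6) by simp
qed

text \<open>The dominating gauge is the norm of the self-adjoint part. It vanishes on skew-adjoint
  elements, so the extended functional does too, and its complexification is real on self-adjoint
  elements. Positivity then follows from \<open>f 1 = 1\<close> together with the bound
  \<open>norm k\<close> for the distance of a positive \<open>k\<close> from the scalar
  \<open>norm k\<close>.\<close>

theorem state_extension:
  obtains \<psi> where "\<psi> \<in> states (as_cstar UNIV)" "\<And>x. x \<in> S \<Longrightarrow> \<psi> x = \<phi> x"
proof -
  let ?p = "\<lambda>x::'a. norm ((1/2) *\<^sub>R (x + star x))"
  have p: "sublinear ?p"
    unfolding sublinear_def
  proof (intro conjI allI impI)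
    fix x y :: 'a
    have "(1/2) *\<^sub>R ((x + y) + star (x + y)) = (1/2) *\<^sub>R (x + star x) + (1/2) *\<^sub>R (y + star y)"
      by (simp add: star_add algebra_simps)
    then show "?p (x + y) \<le> ?p x + ?p y" by (metis norm_triangle_ineq)
  next
    fix t :: real and x :: 'a assume "0 < t"
    then show "?p (t *\<^sub>R x) \<le> t * ?p x" by (simp add: star_scaleR flip: scaleR_add_right)
  qed
  have sub: "subspace S" by (simp add: subspace_def subalgebra_0[OF S] subalgebra_add[OF S] subalgebra_scaleR[OF S])
  obtain f where f: "linear f" and fp: "\<And>x. f x \<le> ?p x" and fS: "\<And>x. x \<in> S \<Longrightarrow> f x = Re (\<phi> x)"
    by (rule hahn_banach_extension[OF p sub, of "\<lambda>x. Re (\<phi> x)"])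
      (auto simp: state_add state_scaleR dest: Re_state_le)
  have fi: "f (\<i> *\<^sub>C h) = 0" if "star h = h" for h
    using fp[of "\<i> *\<^sub>C h"] fp[of "- (\<i> *\<^sub>C h)"] that
    by (simp add: star_simps cvector.scale_minus_left linear_neg[OF f])
  \<comment> \<open>The only complex-linear functional with real part \<open>f\<close>.\<close>
  define \<psi> where "\<psi> x = Complex (f x) (- f (\<i> *\<^sub>C x))" for x
  have f1: "f (of_real t) = t" for t
    using fS[OF subalgebra_1[OF S]] by (simp add: of_real_def linear_scale[OF f] state_1)
  have scale: "\<psi> (c *\<^sub>C x) = c * \<psi> x" for c x
  proof -
    have "f (c *\<^sub>C x) = Re c * f x + Im c * f (\<i> *\<^sub>C x)"
      by (subst scaleC_decompose) (simp add: linear_add[OF f] linear_scale[OF f])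
    moreover have "\<i> *\<^sub>C c *\<^sub>C x = c *\<^sub>C \<i> *\<^sub>C x" by (simp add: scaleC_scaleC mult.commute)
    then have "f (\<i> *\<^sub>C c *\<^sub>C x) = Re c * f (\<i> *\<^sub>C x) - Im c * f x"
      by (simp only:) (subst scaleC_decompose, simp add: i_scaleC_i linear_add[OF f] linear_scale[OF f] linear_diff[OF f] linear_neg[OF f])
    ultimately show ?thesis by (simp add: \<psi>_def complex_eq_iff algebra_simps)
  qed
  show thesis
  proof (rule that[of \<psi>])
    have "\<psi> (star x * x) \<in> \<real>\<^sub>\<ge>\<^sub>0" for x
    proof -
      let ?k = "star x * x"
      have "f (of_real (norm ?k) - ?k) \<le> norm (of_real (norm ?k) - ?k)"
        using fp norm_real_part_le order_trans by blast
      also have "\<dots> \<le> norm ?k" by (rule cpos_norm_diff[OF cpos_star_mult_self order_refl])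
      finally have "0 \<le> f ?k" by (simp add: linear_diff[OF f] f1)
      moreover have "f (\<i> *\<^sub>C ?k) = 0" by (rule fi) (rule cpos_sa[OF cpos_star_mult_self])
      ultimately show ?thesis by (simp add: \<psi>_def complex_nonneg_Reals_iff)
    qed
    moreover have "\<psi> (x + y) = \<psi> x + \<psi> y" for x y
      by (simp add: \<psi>_def complex_eq_iff linear_add[OF f] scaleC_add_right)
    moreover have "\<psi> 1 = 1" using f1[of 1] fi[of 1] by (simp add: \<psi>_def complex_eq_iff)
    ultimately show "\<psi> \<in> states (as_cstar UNIV)" by (simp add: states_as_cstar scale)
    show "\<psi> x = \<phi> x" if "x \<in> S" for x
      using that by (simp add: \<psi>_def complex_eq_iff fS subalgebra_scaleC[OF S] state_scaleC)
  qed
qed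

end

text \<open>Extending the tautological functional on scalars yields a state of the whole algebra, so
  that the bridges used later have a nonempty level set.\<close>

lemma states_scalars_nonempty:
  "states (as_cstar (range (\<lambda>c. c *\<^sub>C (1::'a::cstar_algebra)))) \<noteq> {}"
proof -
  define S where "S = range (\<lambda>c. c *\<^sub>C (1::'a))"
  define \<phi> where "\<phi> = restrict (\<lambda>x. SOME c. x = c *\<^sub>C (1::'a)) S"
  have v: "\<phi> (c *\<^sub>C 1) = c" for c
  proof -
    have "(SOME d. c *\<^sub>C (1::'a) = d *\<^sub>C 1) = c" by (rule some_equality) auto
    then show ?thesis by (simp add: \<phi>_def S_def)
  qed
  have "star (c *\<^sub>C 1) * c *\<^sub>C 1 = complex_of_real ((cmod c)\<^sup>2) *\<^sub>C (1::'a)" for c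
    by (simp add: star_simps mult_scaleC_left mult_scaleC_right scaleC_scaleC complex_norm_square[unfolded of_real_power] mult.commute)
  then have "\<phi> (star x * x) \<in> \<real>\<^sub>\<ge>\<^sub>0" if "x \<in> S" for x using that v by (auto simp: S_def)
  moreover have "\<phi> (x + y) = \<phi> x + \<phi> y" if "x \<in> S" "y \<in> S" for x y
  proof -
    from that obtain c d where "x = c *\<^sub>C 1" "y = d *\<^sub>C 1" by (auto simp: S_def)
    then show ?thesis using v[of "c + d"] by (simp add: v scaleC_add_left)
  qed
  moreover have "\<phi> (c *\<^sub>C x) = c * \<phi> x" if "x \<in> S" for c x
    using that by (auto simp: S_def scaleC_scaleC v)
  moreover have "\<phi> 1 = 1" using v[of 1] by simp
  moreover have "\<phi> \<in> extensional S" by (simp add: \<phi>_def)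
  ultimately have "\<phi> \<in> states (as_cstar S)" by (simp add: states_as_cstar)
  then show ?thesis by (auto simp: S_def)
qed

lemma restrict_states:
  assumes "unital_cstar_subalgebra S" "\<psi> \<in> states (as_cstar UNIV)"
  shows "restrict \<psi> S \<in> states (as_cstar S)"
  using assms(2) subalgebra_props[OF assms(1)] by (simp add: states_as_cstar)

section \<open>Compactness and the Monge--Kantorovich metric\<close>

text \<open>Induction over a spanning set. If \<open>b\<close> is outside the span of
  \<open>B\<close>, that span is closed by the induction hypothesis, hence at positive distance
  \<delta> from \<open>b\<close>. So the coefficient of \<open>b\<close> in a vector of norm at most
  \<open>R\<close> is at most \<open>R / \<delta>\<close>, and the ball is covered by the image of a
  compact product.\<close>

lemma compact_span_cball:
  fixes B :: "'a::cstar_algebra set"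
  assumes "finite B"
  shows "compact (cvector.span B \<inter> cball 0 R)"
  using assms
proof (induction B arbitrary: R)
  case empty
  have "{0::'a} \<inter> cball 0 R = (if R \<ge> 0 then {0} else {})" by auto
  then show ?case by simp
next
  case (insert b B)
  show ?case
  proof (cases "b \<in> cvector.span B")
    case True
    then show ?thesis using insert.IH by (simp add: cvector.span_redundant)
  next
    case False
    have "closed (cvector.span B)"
      unfolding closed_sequential_limits
    proof (intro allI impI, elim conjE)
      fix x l assume x: "\<forall>n. x n \<in> cvector.span B" and l: "x \<longlonglongrightarrow> l"
      obtain M where "\<And>n. norm (x n) \<le> M"
        using convergent_imp_bounded[OF l] by (auto simp: bounded_iff)
      then have "\<forall>n. x n \<in> cvector.span B \<inter> cball 0 M" using x by simp
      with l have "l \<in> cvector.span B \<inter> cball 0 M"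
        using compact_imp_closed[OF insert.IH[of M]] closed_sequentially by blast
      then show "l \<in> cvector.span B" by simp
    qed
    then have "open (- cvector.span B)" by (simp add: open_Compl)
    then obtain \<delta> where \<delta>: "\<delta> > 0" "ball b \<delta> \<subseteq> - cvector.span B"
      using False open_contains_ball_eq by blast
    have far: "cmod t * \<delta> \<le> norm (t *\<^sub>C b + y)" if y: "y \<in> cvector.span B" for t y
    proof (cases "t = 0")
      case False
      have "- (inverse t *\<^sub>C y) \<in> cvector.span B" using y by (intro cvector.span_neg cvector.span_scale)
      then have "- (inverse t *\<^sub>C y) \<notin> ball b \<delta>" using \<delta>(2) by blast
      then have "\<delta> \<le> norm (b + inverse t *\<^sub>C y)" by (simp add: dist_norm)
      then have "cmod t * \<delta> \<le> norm (t *\<^sub>C (b + inverse t *\<^sub>C y))" by (simp add: norm_scaleC mult_left_mono)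
      then show ?thesis using False by (simp add: scaleC_add_right scaleC_scaleC)
    qed simp
    \<comment> \<open>The second radius bounds the remainder after subtracting the multiple of
      \<open>b\<close>. The image of \<open>K\<close> may reach beyond the ball of radius
      \<open>R\<close>, so it is intersected with that ball again.\<close>
    define K where "K = cball (0::complex) (R / \<delta>) \<times> (cvector.span B \<inter> cball 0 (R + R / \<delta> * norm b))"
    have "compact ((\<lambda>p. fst p *\<^sub>C b + snd p) ` K)"
    proof (rule compact_continuous_image)
      show "continuous_on K (\<lambda>p. fst p *\<^sub>C b + snd p)"
        by (subst scaleC_decompose) (intro continuous_intros)
      show "compact K" unfolding K_def by (intro compact_Times compact_cball insert.IH)
    qed
    moreover have "cvector.span (insert b B) \<inter> cball 0 R = (\<lambda>p. fst p *\<^sub>C b + snd p) ` K \<inter> cball 0 R"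
    proof (intro equalityI subsetI)
      fix x assume x: "x \<in> cvector.span (insert b B) \<inter> cball 0 R"
      then obtain t where y: "x - t *\<^sub>C b \<in> cvector.span B" by (auto simp: cvector.span_breakdown_eq)
      have nx: "norm x \<le> R" using x by simp
      have "cmod t * \<delta> \<le> R" using far[OF y, of t] nx by simp
      then have t: "cmod t \<le> R / \<delta>" using \<delta>(1) by (simp add: field_simps)
      then have "cmod t * norm b \<le> R / \<delta> * norm b" by (intro mult_right_mono) simp_all
      then have "norm (x - t *\<^sub>C b) \<le> R + R / \<delta> * norm b"
        using norm_triangle_ineq4[of x "t *\<^sub>C b"] nx unfolding norm_scaleC by linarith
      with t y have "(t, x - t *\<^sub>C b) \<in> K" by (simp add: K_def)
      then have "fst (t, x - t *\<^sub>C b) *\<^sub>C b + snd (t, x - t *\<^sub>C b) \<in> (\<lambda>p. fst p *\<^sub>C b + snd p) ` K" by (rule imageI)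
      with x show "x \<in> (\<lambda>p. fst p *\<^sub>C b + snd p) ` K \<inter> cball 0 R" by simp
    next
      fix x assume x: "x \<in> (\<lambda>p. fst p *\<^sub>C b + snd p) ` K \<inter> cball 0 R"
      then obtain t y where "x = t *\<^sub>C b + y" "y \<in> cvector.span B" by (auto simp: K_def)
      then have "x \<in> cvector.span (insert b B)" by (auto simp: cvector.span_breakdown_eq intro: exI[of _ t])
      with x show "x \<in> cvector.span (insert b B) \<inter> cball 0 R" by simp
    qed
    ultimately show ?thesis by (simp add: compact_Int_closed)
  qed
qed

text \<open>Scalar summands cancel in \<open>\<phi> a - \<psi> a\<close>, so the supremum over
  \<open>B\<close> is governed by the compact \<open>K\<close> and is finite. Density of the
  multiples of \<open>B\<close> shows that a small \<open>d\<close> controls every evaluation;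
  conversely a finite net of \<open>K\<close> shows that finitely many evaluations control
  \<open>d\<close>.\<close>

lemma metrizes_weak_starI:
  fixes S :: "'a::cstar_algebra set" and L :: "'a \<Rightarrow> ennreal"
  defines "B \<equiv> {a \<in> S. star a = a \<and> L a \<le> 1}"
  assumes S: "unital_cstar_subalgebra S" and K: "compact K" "K \<subseteq> S"
    and BK: "\<And>a. a \<in> B \<Longrightarrow> \<exists>k\<in>K. \<exists>t. star k = k \<and> a = k + of_real t"
    and dense: "\<And>a e. \<lbrakk>a \<in> S; star a = a; 0 < e\<rbrakk> \<Longrightarrow> \<exists>b\<in>B. \<exists>r\<ge>0. norm (a - r *\<^sub>R b) < e"
  shows "metrizes_weak_star (as_cstar S, L)"
proof -
  define \<Sigma> where "\<Sigma> = states (as_cstar S)"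
  define mkd where "mkd \<phi> \<psi> = mk (as_cstar S, L) \<phi> \<psi>" for \<phi> \<psi>
  define d where "d \<phi> \<psi> = enn2real (mkd \<phi> \<psi>)" for \<phi> \<psi>
  have mkB: "mkd \<phi> \<psi> = (SUP a\<in>B. ennreal (cmod (\<phi> a - \<psi> a)))" for \<phi> \<psi>
    by (simp add: mkd_def mk_def lip_ball_def self_adjoint_as_cstar B_def conj_assoc)
  have BS: "a \<in> S" "star a = a" if "a \<in> B" for a using that by (auto simp: B_def)
  have shift: "\<phi> a - \<psi> a = \<phi> k - \<psi> k"
    if "\<phi> \<in> \<Sigma>" "\<psi> \<in> \<Sigma>" "k \<in> K" "a = k + of_real t" for \<phi> \<psi> a k t
  proof -
    have "of_real t \<in> S" using subalgebra_scaleR[OF S subalgebra_1[OF S]] by (simp add: of_real_def)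
    then show ?thesis using that K(2)
      by (auto simp: \<Sigma>_def state_add[OF S] state_of_real[OF S] subset_iff)
  qed
  \<comment> \<open>Each of the two states contributes a factor 2.\<close>
  have diff_le: "cmod (\<phi> x - \<psi> x) \<le> 4 * norm x" if "\<phi> \<in> \<Sigma>" "\<psi> \<in> \<Sigma>" "x \<in> S" for \<phi> \<psi> x
    using cmod_state[OF S, of \<phi> x] cmod_state[OF S, of \<psi> x] norm_triangle_ineq4[of "\<phi> x" "\<psi> x"] that
    by (simp add: \<Sigma>_def)
  obtain M where M: "\<And>k. k \<in> K \<Longrightarrow> norm k \<le> M"
    using compact_imp_bounded[OF K(1)] by (auto simp: bounded_iff)
  have fin: "mkd \<phi> \<psi> < \<infinity>" if "\<phi> \<in> \<Sigma>" "\<psi> \<in> \<Sigma>" for \<phi> \<psi>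
  proof -
    have "mkd \<phi> \<psi> \<le> ennreal (4 * M)"
      unfolding mkB
    proof (rule SUP_least)
      fix a assume "a \<in> B"
      then obtain k t where k: "k \<in> K" "a = k + of_real t" using BK by blast
      have "cmod (\<phi> a - \<psi> a) \<le> 4 * M"
        using shift[OF that k] diff_le[OF that, of k] M[OF k(1)] k K(2) by auto
      then show "ennreal (cmod (\<phi> a - \<psi> a)) \<le> ennreal (4 * M)" by (rule ennreal_leI)
    qed
    also have "\<dots> < \<infinity>" by simp
    finally show ?thesis .
  qed
  have d_ge: "cmod (\<phi> a - \<psi> a) \<le> d \<phi> \<psi>" if "\<phi> \<in> \<Sigma>" "\<psi> \<in> \<Sigma>" "a \<in> B" for \<phi> \<psi> a
  proof -
    have "ennreal (cmod (\<phi> a - \<psi> a)) \<le> mkd \<phi> \<psi>" unfolding mkB by (rule SUP_upper[OF that(3)])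
    also have "\<dots> = ennreal (d \<phi> \<psi>)" using fin[OF that(1,2)] by (simp add: d_def less_top)
    finally show ?thesis by (simp add: d_def)
  qed
  have d_le: "d \<phi> \<psi> \<le> c" if "0 \<le> c" "\<And>a. a \<in> B \<Longrightarrow> cmod (\<phi> a - \<psi> a) \<le> c" for \<phi> \<psi> c
  proof -
    have "mkd \<phi> \<psi> \<le> ennreal c" unfolding mkB by (rule SUP_least) (use that in \<open>auto intro: ennreal_leI\<close>)
    then show ?thesis unfolding d_def using that(1) by (simp add: enn2real_leI)
  qed
  have control_sa: "\<exists>\<delta>>0. \<forall>\<phi>\<in>\<Sigma>. \<forall>\<psi>\<in>\<Sigma>. d \<phi> \<psi> < \<delta> \<longrightarrow> cmod (\<phi> x - \<psi> x) < e"
    if x: "x \<in> S" "star x = x" and e: "0 < e" for x e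
  proof -
    \<comment> \<open>The factor 4 of \<open>diff_le\<close> turns \<open>e / 8\<close> into one
      half of \<open>e\<close>; the other half is left for \<open>r\<close> times \<open>d\<close>.
      The radius below divides by \<open>r + 1\<close> since \<open>r\<close> may be 0.\<close>
    obtain b r where b: "b \<in> B" "0 \<le> r" "norm (x - r *\<^sub>R b) < e / 8" using dense[OF x, of "e / 8"] e by auto
    show ?thesis
    proof (intro exI[of _ "e / (2 * (r + 1))"] conjI ballI impI)
      show "0 < e / (2 * (r + 1))" using e b by simp
      fix \<phi> \<psi> assume \<phi>: "\<phi> \<in> \<Sigma>" and \<psi>: "\<psi> \<in> \<Sigma>" and "d \<phi> \<psi> < e / (2 * (r + 1))"
      with b(2) have "d \<phi> \<psi> * (r + 1) < e / 2" by (simp add: field_simps)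
      moreover have "r * cmod (\<phi> b - \<psi> b) \<le> d \<phi> \<psi> * (r + 1)"
        using mult_left_mono[OF d_ge[OF \<phi> \<psi> b(1)] b(2)] by (simp add: d_def algebra_simps add_increasing)
      moreover have "\<phi> x - \<psi> x = (\<phi> (x - r *\<^sub>R b) - \<psi> (x - r *\<^sub>R b)) + of_real r * (\<phi> b - \<psi> b)"
        using \<phi> \<psi> x BS[OF b(1)]
        by (simp add: \<Sigma>_def state_diff[OF S] state_scaleR[OF S] subalgebra_scaleR[OF S] algebra_simps)
      then have "cmod (\<phi> x - \<psi> x) \<le> cmod (\<phi> (x - r *\<^sub>R b) - \<psi> (x - r *\<^sub>R b)) + r * cmod (\<phi> b - \<psi> b)"
        using norm_triangle_ineq[of "\<phi> (x - r *\<^sub>R b) - \<psi> (x - r *\<^sub>R b)" "of_real r * (\<phi> b - \<psi> b)"] b(2)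
        by (simp add: norm_mult)
      moreover have "cmod (\<phi> (x - r *\<^sub>R b) - \<psi> (x - r *\<^sub>R b)) \<le> 4 * norm (x - r *\<^sub>R b)"
        by (rule diff_le[OF \<phi> \<psi>]) (simp add: x BS[OF b(1)] subalgebra_diff[OF S] subalgebra_scaleR[OF S])
      ultimately show "cmod (\<phi> x - \<psi> x) < e" using b(3) by linarith
    qed
  qed
  have control: "\<exists>\<delta>>0. \<forall>\<phi>\<in>\<Sigma>. \<forall>\<psi>\<in>\<Sigma>. d \<phi> \<psi> < \<delta> \<longrightarrow> cmod (\<phi> x - \<psi> x) < e"
    if x: "x \<in> S" and e: "0 < e" for x e
  proof -
    obtain u v where uv: "u \<in> S" "v \<in> S" "star u = u" "star v = v" "x = u + \<i> *\<^sub>C v"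
      using sa_decomposition[OF S x] by metis
    from e have e2: "0 < e / 2" by simp
    obtain \<delta> where \<delta>: "\<delta> > 0" "\<And>\<phi> \<psi>. \<phi> \<in> \<Sigma> \<Longrightarrow> \<psi> \<in> \<Sigma> \<Longrightarrow> d \<phi> \<psi> < \<delta> \<Longrightarrow> cmod (\<phi> u - \<psi> u) < e / 2"
      using control_sa[OF uv(1,3) e2] by blast
    obtain \<eta> where \<eta>: "\<eta> > 0" "\<And>\<phi> \<psi>. \<phi> \<in> \<Sigma> \<Longrightarrow> \<psi> \<in> \<Sigma> \<Longrightarrow> d \<phi> \<psi> < \<eta> \<Longrightarrow> cmod (\<phi> v - \<psi> v) < e / 2"
      using control_sa[OF uv(2,4) e2] by blast
    show ?thesis
    proof (intro exI[of _ "min \<delta> \<eta>"] conjI ballI impI)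
      fix \<phi> \<psi> assume \<phi>: "\<phi> \<in> \<Sigma>" and \<psi>: "\<psi> \<in> \<Sigma>" and less: "d \<phi> \<psi> < min \<delta> \<eta>"
      have "\<phi> x - \<psi> x = (\<phi> u - \<psi> u) + \<i> * (\<phi> v - \<psi> v)"
        using \<phi> \<psi> uv
        by (simp add: \<Sigma>_def state_add[OF S] state_scaleC[OF S] subalgebra_scaleC[OF S] algebra_simps)
      then have "cmod (\<phi> x - \<psi> x) \<le> cmod (\<phi> u - \<psi> u) + cmod (\<phi> v - \<psi> v)"
        using norm_triangle_ineq[of "\<phi> u - \<psi> u" "\<i> * (\<phi> v - \<psi> v)"] by (simp add: norm_mult)
      then show "cmod (\<phi> x - \<psi> x) < e" using \<delta>(2)[OF \<phi> \<psi>] \<eta>(2)[OF \<phi> \<psi>] less by linarith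
    qed (use \<delta> \<eta> in simp)
  qed
  have "Metric_space \<Sigma> d"
  proof
    show "0 \<le> d \<phi> \<psi>" for \<phi> \<psi> by (simp add: d_def)
    show "d \<phi> \<psi> = d \<psi> \<phi>" for \<phi> \<psi> by (simp add: d_def mkB norm_minus_commute)
    show "d \<phi> \<psi> = 0 \<longleftrightarrow> \<phi> = \<psi>" if \<phi>: "\<phi> \<in> \<Sigma>" and \<psi>: "\<psi> \<in> \<Sigma>" for \<phi> \<psi>
    proof
      assume 0: "d \<phi> \<psi> = 0"
      have "\<phi> x = \<psi> x" if "x \<in> S" for x
      proof (rule ccontr)
        assume "\<phi> x \<noteq> \<psi> x"
        then have "0 < cmod (\<phi> x - \<psi> x)" by simp
        from control[OF that this] obtain \<delta> where "\<delta> > 0" "d \<phi> \<psi> < \<delta> \<longrightarrow> cmod (\<phi> x - \<psi> x) < cmod (\<phi> x - \<psi> x)"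
          using \<phi> \<psi> by blast
        with 0 show False by simp
      qed
      then show "\<phi> = \<psi>" using \<phi> \<psi> by (intro extensionalityI[of _ S]) (auto simp: \<Sigma>_def states_as_cstar)
    next
      assume "\<phi> = \<psi>"
      then have "d \<phi> \<psi> \<le> 0" by (intro d_le) simp_all
      then show "d \<phi> \<psi> = 0" using enn2real_nonneg[of "mkd \<phi> \<psi>"] by (simp only: d_def)
    qed
    show "d \<phi> \<xi> \<le> d \<phi> \<psi> + d \<psi> \<xi>" if \<phi>: "\<phi> \<in> \<Sigma>" and \<psi>: "\<psi> \<in> \<Sigma>" and \<xi>: "\<xi> \<in> \<Sigma>" for \<phi> \<psi> \<xi>
    proof (rule d_le)
      show "0 \<le> d \<phi> \<psi> + d \<psi> \<xi>" by (simp add: d_def)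
      fix a assume "a \<in> B"
      then show "cmod (\<phi> a - \<xi> a) \<le> d \<phi> \<psi> + d \<psi> \<xi>"
        using d_ge[OF \<phi> \<psi>, of a] d_ge[OF \<psi> \<xi>, of a] norm_triangle_ineq[of "\<phi> a - \<psi> a" "\<psi> a - \<xi> a"] by simp
    qed
  qed
  then interpret M: Metric_space \<Sigma> d .
  define W where "W = weak_star_states (as_cstar S)"
  have states_ext: "\<Sigma> \<subseteq> extensional S" by (auto simp: \<Sigma>_def states_as_cstar)
  have topW: "topspace W = \<Sigma>"
    using states_ext by (auto simp: W_def weak_star_states_def \<Sigma>_def[symmetric] PiE_def)
  have evW: "continuous_map W euclidean (\<lambda>\<psi>. \<psi> x)" if "x \<in> S" for x
    unfolding W_def weak_star_states_def
    by (rule continuous_map_from_subtopology) (use continuous_map_product_projection[OF that, of "\<lambda>_. euclidean"] in simp)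
  have cont: "continuous_map M.mtopology W id"
    unfolding W_def weak_star_states_def continuous_map_in_subtopology
  proof (intro conjI)
    show "continuous_map M.mtopology (product_topology (\<lambda>_. euclidean) (carrier (as_cstar S))) id"
      unfolding continuous_map_componentwise
    proof (intro conjI ballI)
      show "id ` topspace M.mtopology \<subseteq> extensional (carrier (as_cstar S))"
        using states_ext by auto
      fix x assume "x \<in> carrier (as_cstar S)"
      then have x: "x \<in> S" by simp
      show "continuous_map M.mtopology euclidean (\<lambda>\<phi>. id \<phi> x)"
        unfolding continuous_map_def
      proof (intro conjI allI impI)
        fix V :: "complex set" assume "openin euclidean V"
        then have V: "open V" by simp
        show "openin M.mtopology {\<phi> \<in> topspace M.mtopology. id \<phi> x \<in> V}"
          unfolding M.openin_mtopology
        proof (intro conjI allI impI)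
          fix \<phi> assume "\<phi> \<in> {\<phi> \<in> topspace M.mtopology. id \<phi> x \<in> V}"
          then have \<phi>: "\<phi> \<in> \<Sigma>" "\<phi> x \<in> V" by auto
          obtain e where e: "e > 0" "ball (\<phi> x) e \<subseteq> V" using V \<phi>(2) open_contains_ball_eq by blast
          obtain \<delta> where \<delta>: "\<delta> > 0" "\<And>\<phi> \<psi>. \<phi> \<in> \<Sigma> \<Longrightarrow> \<psi> \<in> \<Sigma> \<Longrightarrow> d \<phi> \<psi> < \<delta> \<Longrightarrow> cmod (\<phi> x - \<psi> x) < e"
            using control[OF x e(1)] by blast
          have "M.mball \<phi> \<delta> \<subseteq> {\<phi> \<in> topspace M.mtopology. id \<phi> x \<in> V}"
            using \<delta>(2)[OF \<phi>(1)] e(2) by (auto simp: M.mball_def dist_norm subset_iff)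
          with \<delta>(1) show "\<exists>r>0. M.mball \<phi> r \<subseteq> {\<phi> \<in> topspace M.mtopology. id \<phi> x \<in> V}" by blast
        qed auto
      qed auto
    qed
  qed (simp flip: \<Sigma>_def)
  have "openin M.mtopology V" if "openin W V" for V
  proof -
    have "{\<phi> \<in> topspace M.mtopology. id \<phi> \<in> V} = V" using openin_subset[OF that] topW by auto
    then show ?thesis using openin_continuous_map_preimage[OF cont that] by simp
  qed
  moreover have "openin W V" if V: "openin M.mtopology V" for V
    unfolding openin_subopen[of W V]
  proof
    fix \<phi> assume "\<phi> \<in> V"
    with V obtain r where r: "r > 0" "M.mball \<phi> r \<subseteq> V" and \<phi>: "\<phi> \<in> \<Sigma>"
      unfolding M.openin_mtopology by blast
    obtain F where F: "finite F" "F \<subseteq> K" "K \<subseteq> (\<Union>x\<in>F. ball x (r / 16))"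
      using compact_imp_seq_compact[OF K(1), THEN seq_compact_imp_totally_bounded] r(1)
      by (metis divide_pos_pos zero_less_numeral)
    define T where "T = (\<Inter>f\<in>F. {\<psi> \<in> topspace W. \<psi> f \<in> ball (\<phi> f) (r / 4)}) \<inter> topspace W"
    have "openin W T"
      unfolding T_def
    proof (intro openin_INT F(1))
      fix f assume "f \<in> F"
      then have "f \<in> S" using F(2) K(2) by blast
      then show "openin W {\<psi> \<in> topspace W. \<psi> f \<in> ball (\<phi> f) (r / 4)}"
        by (intro openin_continuous_map_preimage[OF evW]) simp_all
    qed
    moreover have "\<phi> \<in> T" using \<phi> r(1) by (simp add: T_def topW)
    moreover have "T \<subseteq> V"
    proof
      fix \<psi> assume "\<psi> \<in> T"
      then have \<psi>: "\<psi> \<in> \<Sigma>" and near: "\<And>f. f \<in> F \<Longrightarrow> cmod (\<phi> f - \<psi> f) < r / 4"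
        by (auto simp: T_def topW dist_norm)
      \<comment> \<open>Net points contribute \<open>r / 4\<close> and the distance to the net
        \<open>4 * (r / 16)\<close>. A supremum yields only a weak inequality, so aiming at
        \<open>r / 2\<close> secures membership in the open ball.\<close>
      have "d \<phi> \<psi> \<le> r / 2"
      proof (rule d_le)
        fix a assume "a \<in> B"
        then obtain k t where k: "k \<in> K" "a = k + of_real t" using BK by blast
        obtain f where f: "f \<in> F" "dist f k < r / 16" using F(3) k(1) by auto
        have fk: "f \<in> S" "k \<in> S" using f k F(2) K(2) by auto
        have "\<phi> k - \<psi> k = (\<phi> (k - f) - \<psi> (k - f)) + (\<phi> f - \<psi> f)"
          using \<phi> \<psi> fk by (simp add: \<Sigma>_def state_diff[OF S])
        then have "cmod (\<phi> k - \<psi> k) \<le> cmod (\<phi> (k - f) - \<psi> (k - f)) + cmod (\<phi> f - \<psi> f)"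
          by (metis norm_triangle_ineq)
        moreover have "cmod (\<phi> (k - f) - \<psi> (k - f)) \<le> 4 * norm (k - f)"
          by (rule diff_le[OF \<phi> \<psi>]) (simp add: fk subalgebra_diff[OF S])
        moreover have "norm (k - f) < r / 16" using f(2) by (simp add: dist_norm norm_minus_commute)
        ultimately show "cmod (\<phi> a - \<psi> a) \<le> r / 2"
          using near[OF f(1)] shift[OF \<phi> \<psi> k] by simp
      qed (use r in simp)
      then have "\<psi> \<in> M.mball \<phi> r" using \<phi> \<psi> r(1) by (simp add: M.mball_def)
      then show "\<psi> \<in> V" using r(2) by blast
    qed
    ultimately show "\<exists>T. openin W T \<and> \<phi> \<in> T \<and> T \<subseteq> V" by blast
  qed
  ultimately have "M.mtopology = W" by (auto simp: topology_eq)
  moreover have "(\<lambda>\<phi> \<psi>. enn2real (mk (as_cstar S, L) \<phi> \<psi>)) = d" by (simp add: fun_eq_iff d_def mkd_def)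
  ultimately show ?thesis
    using fin M.Metric_space_axioms by (simp add: metrizes_weak_star_def W_def \<Sigma>_def mkd_def)
qed

section \<open>Leibniz quantum compact metric spaces inside a C*-algebra\<close>

lemma jordan_as_cstar: "jordan (as_cstar S) a b = (1 / 2) *\<^sub>C (a * b + b * a)"
  by (simp add: jordan_def)

lemma lie_as_cstar:
  assumes "unital_cstar_subalgebra S" "a \<in> S" "b \<in> S"
  shows "lie (as_cstar S) a b = (1 / (2 * \<i>)) *\<^sub>C (a * b - b * a)"
  using assms by (simp add: lie_def as_cstar_minus subalgebra_mult)

lemma star_jordan: "star a = a \<Longrightarrow> star b = b \<Longrightarrow> star ((1/2) *\<^sub>C (a * b + b * a)) = (1/2) *\<^sub>C (a * b + b * a)"
  by (simp add: star_simps add.commute)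

lemma star_lie:
  assumes "star a = a" "star b = b"
  shows "star ((1 / (2 * \<i>)) *\<^sub>C (a * b - b * a)) = (1 / (2 * \<i>)) *\<^sub>C (a * b - b * a)"
proof -
  have "cnj (1 / (2 * \<i>)) = - (1 / (2 * \<i>))" by (simp add: complex_eq_iff)
  then show ?thesis
    using assms by (simp only: star_scaleC star_diff star_mult cvector.scale_minus_left)
      (simp add: cvector.scale_right_diff_distrib)
qed

text \<open>All conditions are phrased in the operations of the ambient algebra. Stability of the
  domain under Jordan and Lie products comes from the Leibniz inequalities themselves, whose right
  sides are finite there; \<open>K\<close> represents the unit ball modulo scalars.\<close>

lemma leibniz_qcmsI:
  fixes S :: "'a::cstar_algebra set" and L :: "'a \<Rightarrow> ennreal"
  assumes S: "unital_cstar_subalgebra S"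
    and add: "\<And>a b. \<lbrakk>a \<in> S; star a = a; b \<in> S; star b = b\<rbrakk> \<Longrightarrow> L (a + b) \<le> L a + L b"
    and scale: "\<And>a t. \<lbrakk>a \<in> S; star a = a\<rbrakk> \<Longrightarrow> L (t *\<^sub>R a) = ennreal \<bar>t\<bar> * L a"
    and zero: "\<And>a. \<lbrakk>a \<in> S; star a = a\<rbrakk> \<Longrightarrow> L a = 0 \<longleftrightarrow> (\<exists>t. a = of_real t)"
    and jordan: "\<And>a b. \<lbrakk>a \<in> S; star a = a; L a < \<infinity>; b \<in> S; star b = b; L b < \<infinity>\<rbrakk> \<Longrightarrow>
      L ((1 / 2) *\<^sub>C (a * b + b * a)) \<le> ennreal (norm a) * L b + ennreal (norm b) * L a"
    and lie: "\<And>a b. \<lbrakk>a \<in> S; star a = a; L a < \<infinity>; b \<in> S; star b = b; L b < \<infinity>\<rbrakk> \<Longrightarrow>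
      L ((1 / (2 * \<i>)) *\<^sub>C (a * b - b * a)) \<le> ennreal (norm a) * L b + ennreal (norm b) * L a"
    and lsc: "\<And>r. closed {a \<in> S. star a = a \<and> L a \<le> r}"
    and dense: "\<And>a e. \<lbrakk>a \<in> S; star a = a; 0 < e\<rbrakk> \<Longrightarrow> \<exists>b\<in>S. star b = b \<and> L b < \<infinity> \<and> norm (a - b) < e"
    and K: "compact K" "K \<subseteq> S"
    and ball: "\<And>a. \<lbrakk>a \<in> S; star a = a; L a \<le> 1\<rbrakk> \<Longrightarrow> \<exists>k\<in>K. \<exists>t. star k = k \<and> a = k + of_real t"
  shows "leibniz_qcms (as_cstar S, L)"
proof -
  note sub = subalgebra_props[OF S]
  have sa: "self_adjoint (as_cstar S) = {a \<in> S. star a = a}" by (rule self_adjoint_as_cstar)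
  have dom: "lip_dom (as_cstar S, L) = {a \<in> S. star a = a \<and> L a < \<infinity>}"
    by (auto simp: lip_dom_def sa)
  have of_real_eq: "of_real t = complex_of_real t *\<^sub>C (1::'a)" for t by (simp add: of_real_def scaleR_scaleC)
  have "seminorm_on_sa (as_cstar S, L)"
    by (auto simp: seminorm_on_sa_def sa add scale scaleC_of_real)
  moreover have "unital_jordan_lie_subalgebra (as_cstar S) (lip_dom (as_cstar S, L))"
    unfolding unital_jordan_lie_subalgebra_def
  proof (intro conjI ballI allI)
    show "\<one>\<^bsub>as_cstar S\<^esub> \<in> lip_dom (as_cstar S, L)"
      using zero[of 1] sub(2) by (simp add: dom)
    fix a assume "a \<in> lip_dom (as_cstar S, L)"
    then have a: "a \<in> S" "star a = a" "L a < \<infinity>" by (auto simp: dom)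
    show "smul (as_cstar S) (complex_of_real t) a \<in> lip_dom (as_cstar S, L)" for t
      using a by (simp add: dom scaleC_of_real sub star_scaleR scale ennreal_mult_less_top)
    fix b assume "b \<in> lip_dom (as_cstar S, L)"
    then have b: "b \<in> S" "star b = b" "L b < \<infinity>" by (auto simp: dom)
    have fin: "ennreal (norm a) * L b + ennreal (norm b) * L a < \<infinity>"
      using a b by (simp add: ennreal_mult_less_top)
    show "a \<oplus>\<^bsub>as_cstar S\<^esub> b \<in> lip_dom (as_cstar S, L)"
      using a b le_less_trans[OF add[OF a(1,2) b(1,2)], of \<infinity>] by (simp add: dom sub star_add)
    show "jordan (as_cstar S) a b \<in> lip_dom (as_cstar S, L)"
      using le_less_trans[OF jordan[OF a b] fin] a b star_jordan[OF a(2) b(2)]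
      by (simp add: dom jordan_as_cstar sub)
    show "lie (as_cstar S) a b \<in> lip_dom (as_cstar S, L)"
      using le_less_trans[OF lie[OF a b] fin] a b star_lie[OF a(2) b(2)]
      by (simp add: dom lie_as_cstar[OF S] sub)
  qed (auto simp: dom sa)
  moreover have "self_adjoint (as_cstar S) \<subseteq> norm_topology (as_cstar S) closure_of lip_dom (as_cstar S, L)"
  proof
    fix a assume "a \<in> self_adjoint (as_cstar S)"
    then have a: "a \<in> S" "star a = a" by (auto simp: sa)
    have "a \<in> closure (lip_dom (as_cstar S, L))"
      unfolding closure_approachable
    proof (intro allI impI)
      fix e :: real assume "0 < e"
      from dense[OF a this] show "\<exists>y\<in>lip_dom (as_cstar S, L). dist y a < e"
        by (auto simp: dom dist_norm norm_minus_commute)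
    qed
    moreover have "lip_dom (as_cstar S, L) \<subseteq> S" by (auto simp: dom)
    ultimately show "a \<in> norm_topology (as_cstar S) closure_of lip_dom (as_cstar S, L)"
      using a by (simp add: norm_topology_as_cstar[OF S] closure_of_subtopology Int_absorb1)
  qed
  moreover have "{a \<in> self_adjoint (as_cstar S). L a = 0} = range (\<lambda>t. smul (as_cstar S) (complex_of_real t) \<one>\<^bsub>as_cstar S\<^esub>)"
  proof -
    have "of_real t \<in> S" "star (of_real t :: 'a) = of_real t" for t
      by (simp_all add: of_real_def sub star_scaleR)
    then show ?thesis using zero by (auto simp: sa image_iff simp flip: of_real_eq)
  qed
  moreover have "quasi_leibniz 1 0 (as_cstar S, L)"
    unfolding quasi_leibniz_def
  proof (simp only: prod.case, intro ballI)
    fix a b assume "a \<in> lip_dom (as_cstar S, L)" "b \<in> lip_dom (as_cstar S, L)"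
    then have ab: "a \<in> S" "star a = a" "L a < \<infinity>" "b \<in> S" "star b = b" "L b < \<infinity>" by (auto simp: dom)
    show "max (L (jordan (as_cstar S) a b)) (L (lie (as_cstar S) a b))
       \<le> ennreal 1 * (ennreal (nrm (as_cstar S) a) * L b + ennreal (nrm (as_cstar S) b) * L a) + ennreal 0 * L a * L b"
      using jordan[OF ab] lie[OF ab] by (simp add: jordan_as_cstar lie_as_cstar[OF S ab(1,4)])
  qed
  moreover have "metrizes_weak_star (as_cstar S, L)"
  proof (rule metrizes_weak_starI[OF S K])
    show "\<exists>k\<in>K. \<exists>t. star k = k \<and> a = k + of_real t" if "a \<in> {a \<in> S. star a = a \<and> L a \<le> 1}" for a
      using ball that by auto
    fix a :: 'a and e :: real assume "a \<in> S" "star a = a" "0 < e"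
    then obtain b where b: "b \<in> S" "star b = b" "L b < \<infinity>" "norm (a - b) < e" using dense by blast
    obtain l where l: "L b = ennreal l" "0 \<le> l" using b(3) by (cases "L b") auto
    \<comment> \<open>Scaling by \<open>l + 1\<close> brings \<open>b\<close> into the unit ball
      also when \<open>L b = 0\<close>.\<close>
    have "L ((1 / (l + 1)) *\<^sub>R b) = ennreal (1 / (l + 1) * l)"
      unfolding scale[OF b(1,2)] l(1) using l(2) by (subst ennreal_mult) auto
    also have "\<dots> \<le> 1" using l by (simp add: field_simps)
    finally have "L ((1 / (l + 1)) *\<^sub>R b) \<le> 1" .
    then show "\<exists>b\<in>{a \<in> S. star a = a \<and> L a \<le> 1}. \<exists>r\<ge>0. norm (a - r *\<^sub>R b) < e"
      using b l by (intro bexI[of _ "(1 / (l + 1)) *\<^sub>R b"] exI[of _ "l + 1"]) (auto simp: sub star_scaleR)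
  qed
  moreover have "lower_semicontinuous_on_sa (as_cstar S, L)"
    unfolding lower_semicontinuous_on_sa_def
  proof (simp only: prod.case, intro allI)
    fix r
    have "{a \<in> self_adjoint (as_cstar S). r < L a}
        = self_adjoint (as_cstar S) \<inter> - {a \<in> S. star a = a \<and> L a \<le> r}" by (auto simp: sa)
    moreover have "openin (subtopology euclidean (self_adjoint (as_cstar S))) \<dots>"
      using lsc[of r] by (intro openin_open_Int) (simp add: open_Compl)
    moreover have "self_adjoint (as_cstar S) \<subseteq> S" by (auto simp: sa)
    ultimately show "openin (subtopology (norm_topology (as_cstar S)) (self_adjoint (as_cstar S)))
        {a \<in> self_adjoint (as_cstar S). r < L a}"
      by (simp add: norm_topology_as_cstar[OF S] subtopology_subtopology Int_absorb1)
  qed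
  ultimately show ?thesis
    using unital_cstar_as_cstar[OF S] by (simp add: quasi_leibniz_qcms_def)
qed

section \<open>Bridges with trivial pivot\<close>

text \<open>Both embeddings are the identity of the ambient algebra, so one bridge serves all pairs
  of subalgebras.\<close>

definition inclusion_bridge :: "'a::cstar_algebra bridge" where
  "inclusion_bridge = \<lparr>br_alg = as_cstar UNIV, br_left = id, br_right = id, br_pivot = 1\<rparr>"

lemma level_states_one: "level_states (as_cstar UNIV) (1::'a::cstar_algebra) = states (as_cstar UNIV)"
proof -
  have "\<phi> 0 = 0" if "\<phi> \<in> states (as_cstar (UNIV::'a set))" for \<phi>
    using state_scaleR[OF subalgebra_UNIV that, of 0 0] by simp
  then show ?thesis by (auto simp: level_states_def as_cstar_minus[OF subalgebra_UNIV])
qed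

lemma is_bridge_inclusion:
  fixes S T :: "'a::cstar_algebra set"
  assumes "states (as_cstar (UNIV::'a set)) \<noteq> {}"
  shows "is_bridge (as_cstar S) (as_cstar T) inclusion_bridge"
  using assms unital_cstar_as_cstar[OF subalgebra_UNIV]
  by (simp add: is_bridge_def inclusion_bridge_def level_states_one unital_star_monomorphism_def ring_hom_def)

lemma pullback_states_inclusion:
  fixes S :: "'a::cstar_algebra set"
  assumes S: "unital_cstar_subalgebra S"
  shows "pullback_states (as_cstar S) id inclusion_bridge = states (as_cstar S)"
proof -
  have "compose S \<psi> id = restrict \<psi> S" for \<psi> :: "'a \<Rightarrow> complex" by (simp add: compose_def)
  moreover have "\<exists>\<psi>\<in>states (as_cstar UNIV). \<phi> = restrict \<psi> S" if \<phi>: "\<phi> \<in> states (as_cstar S)" for \<phi>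
  proof -
    obtain \<psi> where \<psi>: "\<psi> \<in> states (as_cstar UNIV)" "\<And>x. x \<in> S \<Longrightarrow> \<psi> x = \<phi> x"
      using state_extension[OF S \<phi>] by blast
    have "\<phi> = restrict \<psi> S"
      using \<phi> \<psi>(2) by (intro extensionalityI[of _ S]) (auto simp: states_as_cstar)
    with \<psi>(1) show ?thesis by blast
  qed
  ultimately show ?thesis
    using restrict_states[OF S]
    by (auto simp: pullback_states_def inclusion_bridge_def level_states_one)
qed

lemma hausdorff_distance_self:
  assumes "\<And>x. d x x = 0"
  shows "hausdorff_distance d X X = 0"
proof -
  have *: "(INF y\<in>X. d x y) = 0" "(INF y\<in>X. d y x) = 0" if "x \<in> X" for x
    using INF_lower[OF that, of "d x"] INF_lower[OF that, of "\<lambda>y. d y x"] by (simp_all add: assms)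
  have "(SUP x\<in>X. INF y\<in>X. d x y) \<le> 0" by (rule SUP_least) (simp add: *)
  moreover have "(SUP y\<in>X. INF x\<in>X. d x y) \<le> 0" by (rule SUP_least) (simp add: *)
  ultimately show ?thesis by (simp add: hausdorff_distance_def)
qed

lemma bridge_length_inclusion:
  fixes S T :: "'a::cstar_algebra set"
  assumes S: "unital_cstar_subalgebra S" and T: "unital_cstar_subalgebra T"
  shows "bridge_length (as_cstar S, L) (as_cstar T, M) inclusion_bridge
    = hausdorff_distance (\<lambda>a b. ennreal (norm (a - b))) (lip_ball (as_cstar S, L)) (lip_ball (as_cstar T, M))"
proof -
  have "mk X \<phi> \<phi> = 0" for X and \<phi> :: "'a \<Rightarrow> complex" by (simp add: mk_def flip: bot_ennreal)
  then have "bridge_height (as_cstar S, L) (as_cstar T, M) inclusion_bridge = 0"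
    using pullback_states_inclusion[OF S] pullback_states_inclusion[OF T]
    by (simp add: bridge_height_def hausdorff_distance_self) (simp add: inclusion_bridge_def hausdorff_distance_self)
  then show ?thesis
    by (simp add: bridge_length_def bridge_reach_def inclusion_bridge_def as_cstar_minus[OF subalgebra_UNIV])
qed

lemma propinquity_le_bridge_length:
  assumes "quasi_leibniz_qcms C D X" "quasi_leibniz_qcms C D Y" "is_bridge (fst X) (fst Y) \<gamma>"
  shows "propinquity C D X Y \<le> bridge_length X Y \<gamma>"
  unfolding propinquity_def
proof (rule Inf_lower, rule CollectI, intro exI conjI)
  let ?S = "\<lambda>i::nat. if i = 0 then X else Y"
  show "bridge_length X Y \<gamma> = (\<Sum>i<1. bridge_length (?S i) (?S (Suc i)) ((\<lambda>_. \<gamma>) i))" by simp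
qed (use assms in auto)

section \<open>Best approximation in an AF algebra\<close>

context
  fixes U :: "nat \<Rightarrow> 'a::cstar_algebra set" and \<beta> :: "nat \<Rightarrow> real"
  assumes U_mono: "incseq U"
    and U_sub: "\<And>n. unital_cstar_subalgebra (U n)"
    and U_fin: "\<And>n. finite_dimensional (U n)"
    and U_dense: "closure (\<Union>n. U n) = UNIV"
    and U_0: "U 0 = range (\<lambda>c. c *\<^sub>C 1)"
    and \<beta>_pos: "\<And>n. 0 < \<beta> n"
    and \<beta>_lim: "\<beta> \<longlonglongrightarrow> 0"
begin

private abbreviation (input) "L \<equiv> lip_beta U \<beta>"
private abbreviation (input) "L' \<equiv> lip_closure U L"

lemma U_subset: "m \<le> n \<Longrightarrow> U m \<subseteq> U n"
  using U_mono by (simp add: incseq_def)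

lemma of_real_in_U: "of_real t \<in> U n"
  using subalgebra_scaleR[OF U_sub subalgebra_1[OF U_sub]] by (simp add: of_real_def)

lemma star_of_real: "star (of_real t) = (of_real t :: 'a)"
  by (simp add: of_real_def star_scaleR)

lemma sa_U_0: "a \<in> U 0 \<Longrightarrow> star a = a \<Longrightarrow> \<exists>t. a = of_real t"
proof -
  assume "a \<in> U 0" and sa: "star a = a"
  then obtain c where c: "a = c *\<^sub>C 1" by (auto simp: U_0)
  with sa have "cnj c *\<^sub>C (1::'a) = c *\<^sub>C 1" by (simp add: star_scaleC)
  then have "cnj c = c" by simp
  then have "c = complex_of_real (Re c)" by (simp add: complex_eq_iff)
  with c have "a = of_real (Re c)" by (metis of_real_def scaleR_scaleC)
  then show "\<exists>t. a = of_real t" ..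
qed

section \<open>Algebraic properties of the Lip-norm\<close>

lemma L_upper: "ennreal (quotient_norm (U n) a / \<beta> n) \<le> L a"
  unfolding lip_beta_def by (rule SUP_upper) simp

lemma L_le_iff:
  assumes "0 \<le> r"
  shows "L a \<le> ennreal r \<longleftrightarrow> (\<forall>n. quotient_norm (U n) a \<le> r * \<beta> n)"
  using assms \<beta>_pos by (simp add: lip_beta_def SUP_le_iff ennreal_le_iff pos_divide_le_eq)

lemma L_add: "L (x + y) \<le> L x + L y"
  unfolding lip_beta_def[of U \<beta> "x + y"]
proof (rule SUP_least)
  fix n
  have "quotient_norm (U n) (x + y) / \<beta> n \<le> quotient_norm (U n) x / \<beta> n + quotient_norm (U n) y / \<beta> n"
    using quotient_norm_add[OF U_sub, of n x y] \<beta>_pos[of n] by (simp add: divide_right_mono flip: add_divide_distrib)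
  then have "ennreal (quotient_norm (U n) (x + y) / \<beta> n)
      \<le> ennreal (quotient_norm (U n) x / \<beta> n) + ennreal (quotient_norm (U n) y / \<beta> n)"
    using quotient_norm_nonneg[OF U_sub] \<beta>_pos[of n] by (simp add: ennreal_leI flip: ennreal_plus)
  also have "\<dots> \<le> L x + L y" by (intro add_mono L_upper)
  finally show "ennreal (quotient_norm (U n) (x + y) / \<beta> n) \<le> L x + L y" .
qed

lemma L_scaleC: "L (c *\<^sub>C x) = ennreal (cmod c) * L x"
proof -
  have "ennreal (quotient_norm (U n) (c *\<^sub>C x) / \<beta> n) = ennreal (cmod c) * ennreal (quotient_norm (U n) x / \<beta> n)" for n
    using quotient_norm_nonneg[OF U_sub] \<beta>_pos[of n] by (simp add: quotient_norm_scaleC[OF U_sub] flip: ennreal_mult)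
  then show ?thesis by (simp add: lip_beta_def SUP_mult_left_ennreal)
qed

lemma L_scaleR: "L (t *\<^sub>R x) = ennreal \<bar>t\<bar> * L x"
  by (simp add: scaleR_scaleC L_scaleC)

lemma L_mult: "L (a * b) \<le> ennreal (norm a) * L b + ennreal (norm b) * L a"
  unfolding lip_beta_def[of U \<beta> "a * b"]
proof (rule SUP_least)
  fix n
  let ?q = "quotient_norm (U n)"
  have "?q (a * b) / \<beta> n \<le> norm a * (?q b / \<beta> n) + norm b * (?q a / \<beta> n)"
    using quotient_norm_mult[OF U_sub, of n a b] \<beta>_pos[of n] by (simp add: divide_right_mono flip: add_divide_distrib)
  then have "ennreal (?q (a * b) / \<beta> n) \<le> ennreal (norm a) * ennreal (?q b / \<beta> n) + ennreal (norm b) * ennreal (?q a / \<beta> n)"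
    using quotient_norm_nonneg[OF U_sub] \<beta>_pos[of n] by (simp add: ennreal_leI flip: ennreal_plus ennreal_mult)
  also have "\<dots> \<le> ennreal (norm a) * L b + ennreal (norm b) * L a"
    by (intro add_mono mult_left_mono L_upper) simp_all
  finally show "ennreal (?q (a * b) / \<beta> n) \<le> ennreal (norm a) * L b + ennreal (norm b) * L a" .
qed

text \<open>Jordan and Lie products are multiples of \<open>a * b + b * a\<close> and
  \<open>a * b - b * a\<close> by a scalar of modulus 1/2. Both orders of the product obey the same
  symmetric bound, so the factor 1/2 absorbs the two summands and the constant stays 1.\<close>

lemma L_half_sum:
  assumes c: "cmod c = 1 / 2" and x: "L x \<le> X" and y: "L y \<le> X"
  shows "L (c *\<^sub>C (x + y)) \<le> X"
proof -
  have "L (c *\<^sub>C (x + y)) \<le> ennreal (1 / 2) * (X + X)"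
    unfolding L_scaleC c by (intro mult_left_mono order_trans[OF L_add] add_mono x y) simp
  also have "X + X = ennreal 2 * X" by (simp flip: mult_2)
  also have "ennreal (1 / 2) * (ennreal 2 * X) = X"
    by (subst mult.assoc[symmetric], subst ennreal_mult[symmetric]) simp_all
  finally show ?thesis .
qed

lemma L_jordan: "L ((1 / 2) *\<^sub>C (a * b + b * a)) \<le> ennreal (norm a) * L b + ennreal (norm b) * L a"
  by (rule L_half_sum[OF _ L_mult]) (use L_mult[of b a] in \<open>simp_all add: add.commute\<close>)

lemma L_lie: "L ((1 / (2 * \<i>)) *\<^sub>C (a * b - b * a)) \<le> ennreal (norm a) * L b + ennreal (norm b) * L a"
proof -
  have "L (- (b * a)) = L (b * a)" using L_scaleR[of "- 1" "b * a"] by simp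
  then have "L ((1 / (2 * \<i>)) *\<^sub>C (a * b + - (b * a))) \<le> ennreal (norm a) * L b + ennreal (norm b) * L a"
    by (intro L_half_sum[OF _ L_mult]) (use L_mult[of b a] in \<open>simp_all add: add.commute norm_divide norm_mult\<close>)
  then show ?thesis by simp
qed

lemma L_eq_0_iff: "L a = 0 \<longleftrightarrow> a \<in> U 0"
proof
  assume "L a = 0"
  with L_le_iff[of 0 a] have "quotient_norm (U 0) a \<le> 0" by simp
  then have "quotient_norm (U 0) a = 0" using quotient_norm_nonneg[OF U_sub, of 0 a] by (rule antisym)
  then show "a \<in> U 0" by (simp add: quotient_norm_eq_0_iff[OF U_sub])
next
  assume "a \<in> U 0"
  then have "quotient_norm (U n) a = 0" for n
    using U_subset[of 0 n] by (auto simp: quotient_norm_eq_0_iff[OF U_sub])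
  then show "L a = 0" using L_le_iff[of 0 a] by simp
qed

lemma L_of_real: "L (of_real t) = 0"
  by (simp add: L_eq_0_iff of_real_in_U)

lemma L_shift: "L (a + of_real t) = L a"
proof (rule antisym)
  show "L (a + of_real t) \<le> L a" using L_add[of a "of_real t"] by (simp add: L_of_real)
  show "L a \<le> L (a + of_real t)" using L_add[of "a + of_real t" "of_real (- t)"] L_of_real[of "- t"] by simp
qed

lemma L_finite: "a \<in> U n \<Longrightarrow> L a < \<infinity>"
proof -
  assume a: "a \<in> U n"
  \<comment> \<open>Quotient norms vanish from index \<open>n\<close> on. A sum dominates each of
    its nonnegative terms and covers \<open>n = 0\<close> as well.\<close>
  define C where "C = (\<Sum>m<n. quotient_norm (U m) a / \<beta> m)"
  have nn: "0 \<le> quotient_norm (U m) a / \<beta> m" for m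
    using quotient_norm_nonneg[OF U_sub] \<beta>_pos[of m] by simp
  have "quotient_norm (U m) a / \<beta> m \<le> C" for m
  proof (cases "m < n")
    case True
    then show ?thesis unfolding C_def by (intro member_le_sum) (auto simp: nn)
  next
    case False
    then have "quotient_norm (U m) a = 0"
      using U_subset[of n m] a by (auto simp: quotient_norm_eq_0_iff[OF U_sub])
    then show ?thesis unfolding C_def by (simp add: nn sum_nonneg)
  qed
  then have "L a \<le> ennreal C" unfolding lip_beta_def by (intro SUP_least ennreal_leI)
  also have "\<dots> < \<infinity>" by simp
  finally show ?thesis .
qed

section \<open>Lower semicontinuity and compactness modulo scalars\<close>

lemma closed_L_le: "closed {a. L a \<le> r}"
proof -
  have "{a. L a \<le> r} = (\<Inter>n. {a. ennreal (quotient_norm (U n) a / \<beta> n) \<le> r})"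
    by (auto simp: lip_beta_def SUP_le_iff)
  moreover have "closed {a. ennreal (quotient_norm (U n) a / \<beta> n) \<le> r}" for n
    using \<beta>_pos[of n]
    by (intro closed_Collect_le continuous_on_ennreal continuous_on_divide continuous_on_const
        continuous_on_quotient_norm[OF U_sub]) auto
  ultimately show ?thesis by auto
qed

lemma closed_sa: "closed {a :: 'a. star a = a}"
  by (intro closed_Collect_eq continuous_intros)

text \<open>Up to scalars, the unit ball of \<open>L\<close> is approximated within \<open>\<beta> n\<close> by bounded parts of the
  finite dimensional algebra \<open>U n\<close>.\<close>

lemma compact_L_ball: "compact {a. star a = a \<and> L a \<le> 1 \<and> norm a \<le> R}"
  unfolding compact_eq_totally_bounded
proof (intro conjI allI impI)
  let ?T = "{a. star a = a \<and> L a \<le> 1 \<and> norm a \<le> R}"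
  have "closed ({a. star a = a} \<inter> {a. L a \<le> 1} \<inter> cball 0 R)"
    by (intro closed_Int closed_sa closed_L_le closed_cball)
  moreover have "?T = {a. star a = a} \<inter> {a. L a \<le> 1} \<inter> cball 0 R" by auto
  ultimately show "complete ?T" by (simp add: complete_eq_closed)
  fix e :: real assume e: "0 < e"
  then have "\<forall>\<^sub>F n in sequentially. \<beta> n < e / 2" using \<beta>_lim by (intro order_tendstoD) auto
  then obtain n where n: "\<beta> n < e / 2" by (metis eventually_happens trivial_limit_sequentially)
  obtain B where "finite B" "U n = cvector.span B" using U_fin[of n] by (auto simp: finite_dimensional_def)
  \<comment> \<open>The enlarged radius makes room for approximants within \<open>e / 2\<close> of
    elements of norm at most \<open>R\<close>.\<close>
  then have "compact (U n \<inter> cball 0 (R + e))" using compact_span_cball by metis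
  then obtain F where F: "finite F" "U n \<inter> cball 0 (R + e) \<subseteq> (\<Union>x\<in>F. ball x (e / 2))"
    unfolding compact_eq_totally_bounded using e by (meson half_gt_zero)
  have "?T \<subseteq> (\<Union>x\<in>F. ball x e)"
  proof
    fix a assume "a \<in> ?T"
    then have a: "L a \<le> 1" "norm a \<le> R" by auto
    have "quotient_norm (U n) a < e / 2" using L_le_iff[of 1 a] a(1) n by (auto dest: spec[of _ n])
    then obtain b where b: "b \<in> U n" "norm (a - b) < e / 2"
      using quotient_norm_lessD[of "U n" a] subalgebra_1[OF U_sub] by blast
    have "norm b \<le> R + e" using norm_triangle_ineq2[of b a] b(2) a(2) e by (simp add: norm_minus_commute)
    then obtain x where x: "x \<in> F" "dist x b < e / 2" using F(2) b(1) by auto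
    then have "dist x a < e" using b(2) dist_triangle[of x a b] by (simp add: dist_norm norm_minus_commute)
    with x(1) show "a \<in> (\<Union>x\<in>F. ball x e)" by auto
  qed
  with F(1) show "\<exists>k. finite k \<and> ?T \<subseteq> (\<Union>x\<in>k. ball x e)" by blast
qed

text \<open>The term of index 0 in the supremum puts a scalar near \<open>a\<close>. Taking
  self-adjoint parts makes that scalar real without increasing the distance, as \<open>a\<close> is
  self-adjoint. The added 1 is slack for the infimum in the quotient norm.\<close>

lemma L_ball_shift:
  assumes "star a = a" "L a \<le> 1"
  obtains t where "norm (a - of_real t) \<le> \<beta> 0 + 1"
proof -
  have "quotient_norm (U 0) a < \<beta> 0 + 1" using L_le_iff[of 1 a] assms(2) by (auto dest: spec[of _ 0])
  then obtain b where b: "b \<in> U 0" "norm (a - b) < \<beta> 0 + 1"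
    using quotient_norm_lessD[of "U 0" a] subalgebra_1[OF U_sub] by blast
  have "(1/2) *\<^sub>R (b + star b) \<in> U 0"
    by (intro subalgebra_scaleR[OF U_sub] subalgebra_add[OF U_sub] subalgebra_star[OF U_sub] b)
  then obtain t where t: "(1/2) *\<^sub>R (b + star b) = of_real t"
    using sa_U_0[of "(1/2) *\<^sub>R (b + star b)"] by (auto simp: star_scaleR star_add add.commute)
  have "(1/2) *\<^sub>R ((a - b) + star (a - b)) = (1/2) *\<^sub>R (a + a) - (1/2) *\<^sub>R (b + star b)"
    by (simp add: star_diff assms(1) algebra_simps)
  also have "\<dots> = a - of_real t" by (simp add: t flip: scaleR_2)
  finally have "norm (a - of_real t) \<le> norm (a - b)" by (metis norm_real_part_le)
  with b(2) that[of t] show thesis by simp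
qed

text \<open>Serves the seminorm and its closure alike, on the whole algebra and on each
  \<open>U n\<close>. Domination of \<open>L\<close> places the unit ball of \<open>M\<close> in the
  compact set found for \<open>L\<close>; agreement on self-adjoint elements of the
  \<open>U n\<close> gives a dense domain and, with domination, the kernel. The remaining hypotheses
  have to be checked for each of the two.\<close>

lemma leibniz_qcms_AF:
  fixes M :: "'a \<Rightarrow> ennreal"
  assumes S: "S = UNIV \<or> (\<exists>n. S = U n)"
    and ge: "\<And>a. L a \<le> M a" and eq: "\<And>a n. \<lbrakk>a \<in> U n; star a = a\<rbrakk> \<Longrightarrow> M a = L a"
    and add: "\<And>a b. M (a + b) \<le> M a + M b"
    and scale: "\<And>a t. M (t *\<^sub>R a) = ennreal \<bar>t\<bar> * M a"
    and jordan: "\<And>a b. \<lbrakk>star a = a; M a < \<infinity>; star b = b; M b < \<infinity>\<rbrakk> \<Longrightarrow>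
      M ((1 / 2) *\<^sub>C (a * b + b * a)) \<le> ennreal (norm a) * M b + ennreal (norm b) * M a"
    and lie: "\<And>a b. \<lbrakk>star a = a; M a < \<infinity>; star b = b; M b < \<infinity>\<rbrakk> \<Longrightarrow>
      M ((1 / (2 * \<i>)) *\<^sub>C (a * b - b * a)) \<le> ennreal (norm a) * M b + ennreal (norm b) * M a"
    and lsc: "\<And>r. closed {a. M a \<le> r}"
  shows "leibniz_qcms (as_cstar S, M)"
proof (rule leibniz_qcmsI)
  show sub: "unital_cstar_subalgebra S" using S U_sub subalgebra_UNIV by auto
  show "compact ({a. star a = a \<and> L a \<le> 1 \<and> norm a \<le> \<beta> 0 + 1} \<inter> S)"
    by (intro compact_Int_closed compact_L_ball subalgebra_closed[OF sub])
  have rS: "of_real t \<in> S" for t using S of_real_in_U by auto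
  show "\<exists>k\<in>{a. star a = a \<and> L a \<le> 1 \<and> norm a \<le> \<beta> 0 + 1} \<inter> S. \<exists>t. star k = k \<and> a = k + of_real t"
    if a: "a \<in> S" "star a = a" "M a \<le> 1" for a
  proof -
    have La: "L a \<le> 1" using ge a(3) order_trans by blast
    obtain t where t: "norm (a - of_real t) \<le> \<beta> 0 + 1" using L_ball_shift[OF a(2) La] .
    have "L (a - of_real t) = L a" using L_shift[of a "- t"] by simp
    then show ?thesis
      using a t La rS by (intro bexI[of _ "a - of_real t"] exI[of _ t]) (auto simp: star_diff star_of_real subalgebra_diff[OF sub])
  qed
  show "M a = 0 \<longleftrightarrow> (\<exists>t. a = of_real t)" if "a \<in> S" "star a = a" for a
  proof
    assume "M a = 0"
    then have "L a = 0" using ge[of a] by simp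
    then show "\<exists>t. a = of_real t" using sa_U_0 that(2) by (simp add: L_eq_0_iff)
  next
    assume "\<exists>t. a = of_real t"
    then show "M a = 0" using eq[OF of_real_in_U star_of_real] L_of_real by auto
  qed
  show "closed {a \<in> S. star a = a \<and> M a \<le> r}" for r
  proof -
    have "{a \<in> S. star a = a \<and> M a \<le> r} = S \<inter> {a. star a = a} \<inter> {a. M a \<le> r}" by auto
    then show ?thesis by (simp add: closed_Int closed_sa lsc subalgebra_closed[OF sub])
  qed
  show "\<exists>b\<in>S. star b = b \<and> M b < \<infinity> \<and> norm (a - b) < e" if a: "a \<in> S" "star a = a" and e: "0 < e" for a e
    using S
  proof
    assume "S = UNIV"
    obtain n x where x: "x \<in> U n" "norm (x - a) < e"
      using closure_approachable[of a "\<Union>n. U n"] U_dense e by (auto simp: dist_norm)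
    define b where "b = (1/2) *\<^sub>R (x + star x)"
    have b: "b \<in> U n" "star b = b"
      using x(1) by (simp_all add: b_def subalgebra_props[OF U_sub] star_scaleR star_add add.commute)
    have "a - b = (1/2) *\<^sub>R ((a - x) + star (a - x))"
      using scaleR_half_double[of a] by (simp add: b_def star_diff a algebra_simps)
    then have "norm (a - b) < e"
      using norm_real_part_le[of "a - x"] x(2) by (simp add: norm_minus_commute)
    then show ?thesis using b \<open>S = UNIV\<close> eq[OF b] L_finite[OF b(1)] by auto
  next
    assume "\<exists>n. S = U n"
    then show ?thesis using a e eq[of a] L_finite[of a] by (intro bexI[of _ a]) auto
  qed
qed (use add scale jordan lie in auto)

section \<open>The closure of the Lip-norm\<close>

definition "lip_core = {b \<in> (\<Union>n. U n). star b = b \<and> L b \<le> 1}"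
text \<open>The set whose Minkowski gauge is \<open>L'\<close>. The proofs below rest on its being
  closed, absolutely convex and invariant under adding real scalars.\<close>

definition "lip_hull = closure lip_core"

lemma lip_core_I: "b \<in> U n \<Longrightarrow> star b = b \<Longrightarrow> L b \<le> 1 \<Longrightarrow> b \<in> lip_core"
  by (auto simp: lip_core_def)

lemma lip_core_combine:
  assumes "x \<in> lip_core" "y \<in> lip_core" "\<bar>s\<bar> + \<bar>t\<bar> \<le> 1"
  shows "s *\<^sub>R x + t *\<^sub>R y \<in> lip_core"
proof -
  obtain m n where mn: "x \<in> U m" "y \<in> U n" using assms by (auto simp: lip_core_def)
  then have xy: "x \<in> U (max m n)" "y \<in> U (max m n)"
    using U_subset[of m "max m n"] U_subset[of n "max m n"] by auto
  have "L (s *\<^sub>R x + t *\<^sub>R y) \<le> ennreal \<bar>s\<bar> * L x + ennreal \<bar>t\<bar> * L y"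
    using L_add[of "s *\<^sub>R x" "t *\<^sub>R y"] by (simp add: L_scaleR)
  also have "\<dots> \<le> ennreal \<bar>s\<bar> * 1 + ennreal \<bar>t\<bar> * 1"
    using assms by (intro add_mono mult_left_mono) (auto simp: lip_core_def)
  also have "\<dots> \<le> 1" using assms(3) by (simp flip: ennreal_plus)
  finally show ?thesis
    using assms xy by (intro lip_core_I[of _ "max m n"]) (auto simp: lip_core_def star_simps subalgebra_props[OF U_sub])
qed

lemma lip_hull_combine:
  assumes "x \<in> lip_hull" "y \<in> lip_hull" "\<bar>s\<bar> + \<bar>t\<bar> \<le> 1"
  shows "s *\<^sub>R x + t *\<^sub>R y \<in> lip_hull"
proof -
  obtain f g where "\<And>n. f n \<in> lip_core" "f \<longlonglongrightarrow> x" "\<And>n. g n \<in> lip_core" "g \<longlonglongrightarrow> y"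
    using assms by (auto simp: lip_hull_def closure_sequential)
  then show ?thesis
    unfolding lip_hull_def closure_sequential using lip_core_combine assms(3)
    by (intro exI[of _ "\<lambda>n. s *\<^sub>R f n + t *\<^sub>R g n"]) (auto intro!: tendsto_intros)
qed

lemma lip_hull_scale: "x \<in> lip_hull \<Longrightarrow> \<bar>t\<bar> \<le> 1 \<Longrightarrow> t *\<^sub>R x \<in> lip_hull"
  using lip_hull_combine[of x x t 0] by simp

lemma closed_lip_hull: "closed lip_hull"
  by (simp add: lip_hull_def)

lemma lip_hull_subset: "lip_hull \<subseteq> {x. star x = x \<and> L x \<le> 1}"
proof -
  have "closed ({x. star x = x} \<inter> {x. L x \<le> 1})" by (intro closed_Int closed_sa closed_L_le)
  then show ?thesis unfolding lip_hull_def by (intro closure_minimal) (auto simp: lip_core_def Int_def)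
qed

lemma lip_hull_I: "b \<in> U n \<Longrightarrow> star b = b \<Longrightarrow> L b \<le> 1 \<Longrightarrow> b \<in> lip_hull"
  using lip_core_I closure_subset[of lip_core] by (auto simp: lip_hull_def)

lemma lip_hull_shift:
  assumes "x \<in> lip_hull"
  shows "x + of_real t \<in> lip_hull"
proof -
  obtain f where f: "\<And>n. f n \<in> lip_core" "f \<longlonglongrightarrow> x" using assms by (auto simp: lip_hull_def closure_sequential)
  have "f n + of_real t \<in> lip_core" for n
  proof -
    obtain m where "f n \<in> U m" using f(1)[of n] by (auto simp: lip_core_def)
    then show ?thesis
      using f(1)[of n] by (intro lip_core_I[of _ m]) (auto simp: lip_core_def L_shift star_add star_of_real subalgebra_add[OF U_sub] of_real_in_U)
  qed
  moreover have "(\<lambda>n. f n + of_real t) \<longlonglongrightarrow> x + of_real t" by (intro tendsto_intros f(2))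
  ultimately show ?thesis unfolding lip_hull_def closure_sequential by (intro exI[of _ "\<lambda>n. f n + of_real t"]) simp
qed

lemma L'_eq: "L' a = Inf (ennreal ` {r. 0 < r \<and> (1 / r) *\<^sub>R a \<in> lip_hull})"
  by (simp add: lip_closure_def lip_hull_def lip_core_def)

text \<open>The infimum is attained because the hull is closed: for every \<open>s > r\<close> a
  smaller admissible radius can be enlarged to \<open>s\<close> by shrinking, and then
  \<open>s\<close> tends to \<open>r\<close>.\<close>

lemma L'_le_iff:
  assumes r: "0 < r"
  shows "L' a \<le> ennreal r \<longleftrightarrow> (1 / r) *\<^sub>R a \<in> lip_hull"
proof
  assume "(1 / r) *\<^sub>R a \<in> lip_hull"
  then show "L' a \<le> ennreal r" unfolding L'_eq using r by (intro Inf_lower) auto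
next
  assume le: "L' a \<le> ennreal r"
  have *: "(1 / s) *\<^sub>R a \<in> lip_hull" if s: "r < s" for s
  proof -
    have "L' a < ennreal s" by (rule le_less_trans[OF le]) (use r s in \<open>simp add: ennreal_lessI\<close>)
    then obtain \<rho> where \<rho>: "0 < \<rho>" "(1 / \<rho>) *\<^sub>R a \<in> lip_hull" "ennreal \<rho> < ennreal s"
      unfolding L'_eq Inf_less_iff by auto
    then have "\<rho> < s" by (simp add: ennreal_less_iff)
    have "(\<rho> / s) *\<^sub>R (1 / \<rho>) *\<^sub>R a \<in> lip_hull" by (rule lip_hull_scale[OF \<rho>(2)]) (use \<rho>(1) \<open>\<rho> < s\<close> in simp)
    then show ?thesis using \<rho>(1) by simp
  qed
  have "(\<lambda>n. r + 1 / real (Suc n)) \<longlonglongrightarrow> r + 0" by (intro tendsto_intros LIMSEQ_Suc[OF lim_1_over_n])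
  then have "(\<lambda>n. (1 / (r + 1 / real (Suc n))) *\<^sub>R a) \<longlonglongrightarrow> (1 / r) *\<^sub>R a"
    using r by (intro tendsto_intros) auto
  then show "(1 / r) *\<^sub>R a \<in> lip_hull" by (rule closed_sequentially[OF closed_lip_hull, rotated]) (rule *, simp)
qed

lemma L'_leI: "0 < r \<Longrightarrow> (1 / r) *\<^sub>R a \<in> lip_hull \<Longrightarrow> L' a \<le> ennreal r"
  by (simp only: L'_le_iff)

text \<open>Sublevel sets of \<open>L\<close> are closed, so \<open>L\<close> stays at most 1 when
  passing from the core to its closure; scaling does the rest.\<close>

lemma L'_ge: "L a \<le> L' a"
  unfolding L'_eq
proof (rule Inf_greatest)
  fix y assume "y \<in> ennreal ` {r. 0 < r \<and> (1 / r) *\<^sub>R a \<in> lip_hull}"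
  then obtain r where r: "y = ennreal r" "0 < r" "(1 / r) *\<^sub>R a \<in> lip_hull" by auto
  then have "L ((1 / r) *\<^sub>R a) \<le> 1" using lip_hull_subset by auto
  then have "ennreal r * L ((1 / r) *\<^sub>R a) \<le> ennreal r * 1" by (intro mult_left_mono) auto
  moreover have "ennreal r * L ((1 / r) *\<^sub>R a) = L (r *\<^sub>R (1 / r) *\<^sub>R a)" using r(2) by (simp only: L_scaleR) simp
  ultimately show "L a \<le> y" using r by simp
qed

text \<open>Turns an inequality proved for every admissible radius \<open>r\<close> into one for
  \<open>L' a\<close>. Estimates with two arguments apply it once for each.\<close>

lemma L'_boundI:
  assumes "L' a < \<infinity>" "\<And>r. \<lbrakk>0 < r; (1 / r) *\<^sub>R a \<in> lip_hull\<rbrakk> \<Longrightarrow> Y \<le> ennreal (c * r) + Z" "0 \<le> c"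
  shows "Y \<le> ennreal c * L' a + Z"
proof (rule ennreal_le_epsilon)
  fix e :: real assume e: "0 < e"
  obtain l where l: "L' a = ennreal l" "0 \<le> l" using assms(1) by (cases "L' a") auto
  \<comment> \<open>The slack keeps the radius positive even if \<open>l = 0\<close>, and
    \<open>c\<close> times it is at most \<open>e\<close>, also for \<open>c = 0\<close>.\<close>
  define r where "r = l + e / (c + 1)"
  have r: "0 < r" using l e assms(3) by (simp add: r_def add_nonneg_pos)
  have "L' a \<le> ennreal r" using l e assms(3) by (simp add: r_def ennreal_leI)
  then have "Y \<le> ennreal (c * r) + Z" using assms(2)[OF r] L'_le_iff[OF r] by simp
  also have "ennreal (c * r) \<le> ennreal (c * l + e)"
  proof (rule ennreal_leI)
    have "c * (e / (c + 1)) \<le> e" using e assms(3) by (simp add: field_simps)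
    then show "c * r \<le> c * l + e" by (simp add: r_def algebra_simps)
  qed
  also have "ennreal (c * l + e) + Z = ennreal c * L' a + Z + ennreal e"
    using l e assms(3) by (simp add: ennreal_mult ennreal_plus ac_simps)
  finally show "Y \<le> ennreal c * L' a + Z + ennreal e" by (simp add: add_right_mono)
qed

lemma L'_eq_L: "a \<in> U n \<Longrightarrow> star a = a \<Longrightarrow> L' a = L a"
proof (rule antisym[OF _ L'_ge])
  assume a: "a \<in> U n" "star a = a"
  obtain l where l: "L a = ennreal l" "0 \<le> l" using L_finite[OF a(1)] by (cases "L a") auto
  show "L' a \<le> L a"
  proof (rule ennreal_le_epsilon)
    fix e :: real assume e: "0 < e"
    \<comment> \<open>Division by \<open>l + e\<close>, because \<open>l\<close> is 0 for
      scalars.\<close>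
    have "L ((1 / (l + e)) *\<^sub>R a) = ennreal (1 / (l + e) * l)"
      unfolding L_scaleR l(1) using l(2) e by (subst ennreal_mult) auto
    also have "\<dots> \<le> 1" using l e by (simp add: field_simps)
    finally have "(1 / (l + e)) *\<^sub>R a \<in> lip_hull"
      using a by (intro lip_hull_I[of _ n]) (auto simp: star_scaleR subalgebra_scaleR[OF U_sub])
    with l e have "L' a \<le> ennreal (l + e)" by (intro L'_leI) simp
    then show "L' a \<le> L a + ennreal e" using l e by simp
  qed
qed

lemma L'_add: "L' (a + b) \<le> L' a + L' b"
proof (cases "L' a < \<infinity> \<and> L' b < \<infinity>")
  case True
  have *: "L' (a + b) \<le> ennreal s + ennreal r" if r: "0 < r" "(1 / r) *\<^sub>R a \<in> lip_hull" and s: "0 < s" "(1 / s) *\<^sub>R b \<in> lip_hull" for r s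
  proof -
    \<comment> \<open>The point \<open>a + b\<close> divided by \<open>r + s\<close> is the convex
      combination of \<open>a / r\<close> and \<open>b / s\<close> with these weights.\<close>
    have "(r / (r + s)) *\<^sub>R (1 / r) *\<^sub>R a + (s / (r + s)) *\<^sub>R (1 / s) *\<^sub>R b \<in> lip_hull"
      by (rule lip_hull_combine[OF r(2) s(2)]) (use r(1) s(1) in \<open>simp flip: add_divide_distrib\<close>)
    also have "(r / (r + s)) *\<^sub>R (1 / r) *\<^sub>R a + (s / (r + s)) *\<^sub>R (1 / s) *\<^sub>R b = (1 / (r + s)) *\<^sub>R (a + b)"
      using r(1) s(1) by (simp add: scaleR_add_right)
    finally have "L' (a + b) \<le> ennreal (r + s)" using r(1) s(1) by (intro L'_leI) simp
    then show ?thesis using r(1) s(1) by (simp add: add.commute)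
  qed
  have "L' (a + b) \<le> ennreal 1 * L' b + ennreal r" if "0 < r" "(1 / r) *\<^sub>R a \<in> lip_hull" for r
    by (rule L'_boundI) (use True *[OF that] in simp_all)
  then have "L' (a + b) \<le> ennreal 1 * L' a + L' b"
    by (intro L'_boundI) (use True in \<open>simp_all add: add.commute\<close>)
  then show ?thesis by simp
next
  case False
  then show ?thesis by (auto simp: top.not_eq_extremum[symmetric])
qed

lemma L'_scaleR: "L' (t *\<^sub>R a) = ennreal \<bar>t\<bar> * L' a"
proof (cases "t = 0")
  \<comment> \<open>Separate because \<open>L' a\<close> may be infinite, and 0 times infinity is 0
    in \<open>ennreal\<close>.\<close>
  case True
  have "L' 0 = L 0" by (rule L'_eq_L[of _ 0]) (simp_all add: subalgebra_0[OF U_sub])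
  then show ?thesis using True L_of_real[of 0] by simp
next
  case False
  have le: "L' (t *\<^sub>R a) \<le> ennreal \<bar>t\<bar> * L' a" if t: "t \<noteq> 0" for t a
  proof (cases "L' a < \<infinity>")
    case True
    have "L' (t *\<^sub>R a) \<le> ennreal \<bar>t\<bar> * L' a + 0"
    proof (rule L'_boundI[OF True])
      fix r assume r: "0 < r" "(1 / r) *\<^sub>R a \<in> lip_hull"
      have "sgn t *\<^sub>R (1 / r) *\<^sub>R a \<in> lip_hull" by (rule lip_hull_scale[OF r(2)]) (simp add: sgn_if)
      moreover have "sgn t / r = t / (\<bar>t\<bar> * r)" using t r by (simp add: sgn_if)
      ultimately have "(1 / (\<bar>t\<bar> * r)) *\<^sub>R t *\<^sub>R a \<in> lip_hull" by simp
      then have "L' (t *\<^sub>R a) \<le> ennreal (\<bar>t\<bar> * r)" using r(1) t by (intro L'_leI) simp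
      then show "L' (t *\<^sub>R a) \<le> ennreal (\<bar>t\<bar> * r) + 0" by simp
    qed simp
    then show ?thesis by simp
  next
    case False
    then show ?thesis using t by (simp add: top.not_eq_extremum[symmetric] ennreal_mult_top)
  qed
  \<comment> \<open>The reverse inequality is the same bound for the factor
    \<open>1 / t\<close>.\<close>
  have "ennreal \<bar>t\<bar> * L' a \<le> ennreal \<bar>t\<bar> * (ennreal \<bar>1 / t\<bar> * L' (t *\<^sub>R a))"
    using le[of "1 / t" "t *\<^sub>R a"] False by (intro mult_left_mono) auto
  also have "\<dots> = L' (t *\<^sub>R a)" using False by (simp flip: ennreal_mult mult.assoc)
  finally show ?thesis using le[OF False] by (simp add: antisym)
qed

text \<open>\<open>P\<close> stands for the Jordan or the Lie product. The inequality for
  \<open>L\<close> applies to approximants in the core, homogeneity moves the radii out, and the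
  closed hull absorbs the limit. The resulting bound in the radii then passes to
  \<open>L'\<close>.\<close>

lemma L'_leibniz:
  fixes P :: "'a \<Rightarrow> 'a \<Rightarrow> 'a"
  assumes PU: "\<And>n x y. x \<in> U n \<Longrightarrow> y \<in> U n \<Longrightarrow> P x y \<in> U n"
    and Psa: "\<And>x y. star x = x \<Longrightarrow> star y = y \<Longrightarrow> star (P x y) = P x y"
    and PL: "\<And>x y. L (P x y) \<le> ennreal (norm x) * L y + ennreal (norm y) * L x"
    and Pscale: "\<And>s t x y. P (s *\<^sub>R x) (t *\<^sub>R y) = (s * t) *\<^sub>R P x y"
    and Plim: "\<And>f g x y. f \<longlonglongrightarrow> x \<Longrightarrow> g \<longlonglongrightarrow> y \<Longrightarrow> (\<lambda>n. P (f n) (g n)) \<longlonglongrightarrow> P x y"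
    and fin: "L' a < \<infinity>" "L' b < \<infinity>"
  shows "L' (P a b) \<le> ennreal (norm a) * L' b + ennreal (norm b) * L' a"
proof -
  have *: "L' (P a b) \<le> ennreal (norm a * s) + ennreal (norm b * r)"
    if r: "0 < r" "(1 / r) *\<^sub>R a \<in> lip_hull" and s: "0 < s" "(1 / s) *\<^sub>R b \<in> lip_hull" for r s
  proof (rule ennreal_le_epsilon)
    fix e :: real assume e: "0 < e"
    obtain f g where f: "\<And>n. f n \<in> lip_core" "f \<longlonglongrightarrow> (1 / r) *\<^sub>R a" and g: "\<And>n. g n \<in> lip_core" "g \<longlonglongrightarrow> (1 / s) *\<^sub>R b"
      using r s by (auto simp: lip_hull_def closure_sequential)
    \<comment> \<open>The limit of \<open>(norm (f n) + norm (g n)) * (r * s)\<close> is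
      \<open>norm a * s + norm b * r\<close>. The extra \<open>e\<close> makes \<open>m\<close>
      positive and strictly larger, so that the rescaled products eventually lie in the
      hull.\<close>
    define m where "m = norm a * s + norm b * r + e"
    have m: "0 < m" using e r s by (simp add: m_def add_nonneg_pos)
    have lim: "(\<lambda>n. (norm (f n) + norm (g n)) * (r * s)) \<longlonglongrightarrow> (norm ((1 / r) *\<^sub>R a) + norm ((1 / s) *\<^sub>R b)) * (r * s)"
      by (intro tendsto_intros f g)
    have "(norm ((1 / r) *\<^sub>R a) + norm ((1 / s) *\<^sub>R b)) * (r * s) < m"
      using r s e by (simp add: m_def field_simps)
    from order_tendstoD(2)[OF lim this]
    have "\<forall>\<^sub>F n in sequentially. (r * s / m) *\<^sub>R P (f n) (g n) \<in> lip_hull"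
    proof (rule eventually_mono)
      fix n assume n: "(norm (f n) + norm (g n)) * (r * s) < m"
      obtain i j where ij: "f n \<in> U i" "g n \<in> U j" using f(1)[of n] g(1)[of n] by (auto simp: lip_core_def)
      then have U: "f n \<in> U (max i j)" "g n \<in> U (max i j)"
        using U_subset[of i "max i j"] U_subset[of j "max i j"] by auto
      have "L (P (f n) (g n)) \<le> ennreal (norm (f n)) * 1 + ennreal (norm (g n)) * 1"
        using f(1)[of n] g(1)[of n] by (intro order_trans[OF PL] add_mono mult_left_mono) (auto simp: lip_core_def)
      also have "\<dots> = ennreal (norm (f n) + norm (g n))" by simp
      finally have "L ((r * s / m) *\<^sub>R P (f n) (g n)) \<le> ennreal (r * s / m) * ennreal (norm (f n) + norm (g n))"
        unfolding L_scaleR using r s m by (intro mult_mono) auto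
      also have "\<dots> = ennreal (r * s / m * (norm (f n) + norm (g n)))"
        using r s m by (subst ennreal_mult) auto
      also have "\<dots> \<le> ennreal 1" using n m by (intro ennreal_leI) (simp add: field_simps)
      finally show "(r * s / m) *\<^sub>R P (f n) (g n) \<in> lip_hull"
        using U f(1)[of n] g(1)[of n]
        by (intro lip_hull_I[of _ "max i j"]) (auto simp: lip_core_def PU Psa star_scaleR subalgebra_scaleR[OF U_sub])
    qed
    moreover have "(\<lambda>n. (r * s / m) *\<^sub>R P (f n) (g n)) \<longlonglongrightarrow> (r * s / m) *\<^sub>R P ((1 / r) *\<^sub>R a) ((1 / s) *\<^sub>R b)"
      by (intro tendsto_intros Plim f g)
    ultimately have "(r * s / m) *\<^sub>R P ((1 / r) *\<^sub>R a) ((1 / s) *\<^sub>R b) \<in> lip_hull"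
      by (intro Lim_in_closed_set[OF closed_lip_hull _ trivial_limit_sequentially])
    also have "(r * s / m) *\<^sub>R P ((1 / r) *\<^sub>R a) ((1 / s) *\<^sub>R b) = (1 / m) *\<^sub>R P a b"
      using r(1) s(1) by (simp add: Pscale)
    finally have "L' (P a b) \<le> ennreal m" using m by (intro L'_leI)
    then show "L' (P a b) \<le> ennreal (norm a * s) + ennreal (norm b * r) + ennreal e"
      using r s e by (simp add: m_def)
  qed
  have "L' (P a b) \<le> ennreal (norm a) * L' b + ennreal (norm b * r)" if "0 < r" "(1 / r) *\<^sub>R a \<in> lip_hull" for r
    by (rule L'_boundI[OF fin(2)]) (use * that in auto)
  then have "L' (P a b) \<le> ennreal (norm b) * L' a + ennreal (norm a) * L' b"
    by (intro L'_boundI[OF fin(1)]) (auto simp: add.commute)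
  then show ?thesis by (simp add: add.commute)
qed

lemma closed_L'_le: "closed {a. L' a \<le> r}"
proof (cases r)
  case (real c)
  \<comment> \<open>Radii \<open>s > c\<close> are used because the membership criterion asks for a
    positive radius, while \<open>c\<close> may be 0.\<close>
  have "{a. L' a \<le> r} = (\<Inter>s\<in>{c<..}. {a. (1 / s) *\<^sub>R a \<in> lip_hull})"
  proof (intro equalityI subsetI)
    fix a assume "a \<in> {a. L' a \<le> r}"
    then have a: "L' a \<le> ennreal c" using real by simp
    have "(1 / s) *\<^sub>R a \<in> lip_hull" if "s > c" for s
      using order_trans[OF a ennreal_leI[of c s]] L'_le_iff[of s a] that real by simp
    then show "a \<in> (\<Inter>s\<in>{c<..}. {a. (1 / s) *\<^sub>R a \<in> lip_hull})" by auto
  next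
    fix a assume a: "a \<in> (\<Inter>s\<in>{c<..}. {a. (1 / s) *\<^sub>R a \<in> lip_hull})"
    have "L' a \<le> r"
    proof (rule ennreal_le_epsilon)
      fix e :: real assume "0 < e"
      with a real have "L' a \<le> ennreal (c + e)" by (intro L'_leI) auto
      then show "L' a \<le> r + ennreal e" using real \<open>0 < e\<close> by simp
    qed
    then show "a \<in> {a. L' a \<le> r}" by simp
  qed
  moreover have "closed {a. (1 / s) *\<^sub>R a \<in> lip_hull}" for s
    using continuous_closed_vimage[OF closed_lip_hull, of "\<lambda>a. (1 / s) *\<^sub>R a"] by (simp add: vimage_def)
  ultimately show ?thesis by auto
qed simp

lemma
  assumes "S = UNIV \<or> (\<exists>n. S = U n)"
  shows leibniz_qcms_L: "leibniz_qcms (as_cstar S, L)"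
    and leibniz_qcms_L': "leibniz_qcms (as_cstar S, L')"
proof -
  show "leibniz_qcms (as_cstar S, L)"
    by (rule leibniz_qcms_AF[OF assms]) (rule order_refl refl L_add L_scaleR L_jordan L_lie closed_L_le)+
  have lim: "(\<lambda>n. c *\<^sub>C f n) \<longlonglongrightarrow> c *\<^sub>C x" if "f \<longlonglongrightarrow> x" for c and f :: "nat \<Rightarrow> 'a" and x
    by (rule bounded_linear.tendsto[OF bounded_linear_scaleC that])
  have sc: "c *\<^sub>C t *\<^sub>R x = t *\<^sub>R c *\<^sub>C x" for c t and x :: 'a
    by (simp add: scaleR_scaleC scaleC_scaleC mult.commute)
  have "L' ((1 / 2) *\<^sub>C (a * b + b * a)) \<le> ennreal (norm a) * L' b + ennreal (norm b) * L' a"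
    if "L' a < \<infinity>" "L' b < \<infinity>" for a b
    by (rule L'_leibniz[where P="\<lambda>a b. (1 / 2) *\<^sub>C (a * b + b * a)", OF _ star_jordan L_jordan _ _ that])
      (auto simp: subalgebra_props[OF U_sub] mult.commute simp flip: sc scaleR_add_right intro!: lim tendsto_intros)
  moreover have "L' ((1 / (2 * \<i>)) *\<^sub>C (a * b - b * a)) \<le> ennreal (norm a) * L' b + ennreal (norm b) * L' a"
    if "L' a < \<infinity>" "L' b < \<infinity>" for a b
    by (rule L'_leibniz[where P="\<lambda>a b. (1 / (2 * \<i>)) *\<^sub>C (a * b - b * a)", OF _ star_lie L_lie _ _ that])
      (auto simp: subalgebra_props[OF U_sub] mult.commute simp flip: sc scaleR_right_diff_distrib intro!: lim tendsto_intros)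
  ultimately show "leibniz_qcms (as_cstar S, L')"
    by (intro leibniz_qcms_AF[OF assms]) (auto intro: L'_ge L'_eq_L L'_add L'_scaleR closed_L'_le)
qed

text \<open>Since the infimum is attained, the unit ball of the closure is the hull itself and no
  larger.\<close>

lemma lip_ball_L': "lip_ball (as_cstar UNIV, L') = lip_hull"
proof -
  have "L' a \<le> 1 \<longleftrightarrow> a \<in> lip_hull" for a using L'_le_iff[of 1 a] by simp
  then show ?thesis using lip_hull_subset by (auto simp: lip_ball_def self_adjoint_as_cstar)
qed

text \<open>By compactness, finitely many elements of \<open>lip_core\<close>, hence one \<open>U N\<close>, approximate \<open>lip_hull\<close> up to scalars.\<close>

lemma lip_hull_approx:
  assumes e: "0 < e"
  obtains N where "\<And>n a. \<lbrakk>N \<le> n; a \<in> lip_hull\<rbrakk> \<Longrightarrow> \<exists>b\<in>U n. star b = b \<and> L b \<le> 1 \<and> norm (a - b) < e"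
proof -
  define R where "R = \<beta> 0 + 1"
  have "compact ({a. star a = a \<and> L a \<le> 1 \<and> norm a \<le> R} \<inter> lip_hull)"
    by (intro compact_Int_closed compact_L_ball closed_lip_hull)
  moreover have "{a. star a = a \<and> L a \<le> 1 \<and> norm a \<le> R} \<inter> lip_hull = lip_hull \<inter> cball 0 R" using lip_hull_subset by auto
  ultimately have "compact (lip_hull \<inter> cball 0 R)" by simp
  from compact_imp_seq_compact[OF this, THEN seq_compact_imp_totally_bounded] e
  obtain F where F: "finite F" "F \<subseteq> lip_hull \<inter> cball 0 R" "lip_hull \<inter> cball 0 R \<subseteq> (\<Union>x\<in>F. ball x (e / 2))"
    by (meson half_gt_zero)
  have "\<exists>x n. x \<in> lip_core \<and> x \<in> U n \<and> norm (x - k) < e / 2" if "k \<in> F" for k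
  proof -
    have "k \<in> closure lip_core" using F(2) that by (auto simp: lip_hull_def)
    with e obtain x where "x \<in> lip_core" "dist x k < e / 2" unfolding closure_approachable by (meson half_gt_zero)
    then show ?thesis by (auto simp: lip_core_def dist_norm)
  qed
  then obtain x \<nu> where x: "\<And>k. k \<in> F \<Longrightarrow> x k \<in> lip_core \<and> x k \<in> U (\<nu> k) \<and> norm (x k - k) < e / 2" by metis
  obtain N where N: "\<And>k. k \<in> F \<Longrightarrow> \<nu> k \<le> N"
    using finite_nat_set_iff_bounded_le[of "\<nu> ` F"] F(1) by auto
  show thesis
  proof (rule that)
    fix n a assume n: "N \<le> n" and a: "a \<in> lip_hull"
    then have "star a = a" "L a \<le> 1" using lip_hull_subset by auto
    then obtain t where t: "norm (a - of_real t) \<le> R" unfolding R_def by (rule L_ball_shift)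
    have "a - of_real t \<in> lip_hull \<inter> cball 0 R" using lip_hull_shift[OF a, of "- t"] t by simp
    then obtain k where k: "k \<in> F" "norm (k - (a - of_real t)) < e / 2" using F(3) by (auto simp: dist_norm)
    define b where "b = x k + of_real t"
    have "a - b = ((a - of_real t) - k) + (k - x k)" by (simp add: b_def)
    then have "norm (a - b) \<le> norm (k - (a - of_real t)) + norm (x k - k)"
      by (metis norm_triangle_ineq norm_minus_commute)
    then have "norm (a - b) < e" using k x[OF k(1)] by simp
    moreover have "x k \<in> U n" using x[OF k(1)] N[OF k(1)] n U_subset[of "\<nu> k" n] by auto
    then have "b \<in> U n" by (simp add: b_def subalgebra_add[OF U_sub] of_real_in_U)
    moreover have "star b = b" "L b \<le> 1" using x[OF k(1)] by (auto simp: b_def lip_core_def star_add star_of_real L_shift)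
    ultimately show "\<exists>b\<in>U n. star b = b \<and> L b \<le> 1 \<and> norm (a - b) < e" by blast
  qed
qed

text \<open>With \<open>M\<close> abstract both limits are covered: only values on self-adjoint
  elements of \<open>U n\<close> enter, so the unit balls of the approximating spaces are those of
  \<open>L\<close> in either case.\<close>

lemma propinquity_tendsto_0:
  assumes M: "\<And>n. leibniz_qcms (as_cstar (U n), M)" and eq: "\<And>a n. \<lbrakk>a \<in> U n; star a = a\<rbrakk> \<Longrightarrow> M a = L a"
  shows "(\<lambda>n. propinquity 1 0 (as_cstar (U n), M) (as_cstar UNIV, L')) \<longlonglongrightarrow> 0"
proof (rule order_tendstoI)
  fix c :: ennreal assume "0 < c"
  then obtain d where d: "0 < d" "d < c" using dense by blast
  then obtain e where e: "d = ennreal e" "0 < e" by (cases d) (auto simp: top_unique)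
  from lip_hull_approx[OF e(2)]
  obtain N where N: "\<And>n a. \<lbrakk>N \<le> n; a \<in> lip_hull\<rbrakk> \<Longrightarrow> \<exists>b\<in>U n. star b = b \<and> L b \<le> 1 \<and> norm (a - b) < e"
    by blast
  have states: "states (as_cstar (UNIV::'a set)) \<noteq> {}"
    using states_scalars_nonempty state_extension[OF U_sub[of 0]] unfolding U_0 by blast
  have "propinquity 1 0 (as_cstar (U n), M) (as_cstar UNIV, L') \<le> d" if n: "N \<le> n" for n
  proof -
    have ball: "lip_ball (as_cstar (U n), M) = {b \<in> U n. star b = b \<and> L b \<le> 1}"
      using eq by (auto simp: lip_ball_def self_adjoint_as_cstar)
    have "hausdorff_distance (\<lambda>a b. ennreal (norm (a - b))) {b \<in> U n. star b = b \<and> L b \<le> 1} lip_hull \<le> d"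
      unfolding hausdorff_distance_def
    proof (intro max.boundedI SUP_least)
      \<comment> \<open>This unit ball is part of the hull, so this half of the Hausdorff distance
        is 0; the approximation is used in the other half.\<close>
      fix a assume "a \<in> {b \<in> U n. star b = b \<and> L b \<le> 1}"
      then have "a \<in> lip_hull" using lip_hull_I by auto
      then have "(INF y\<in>lip_hull. ennreal (norm (a - y))) \<le> ennreal (norm (a - a))" by (rule INF_lower)
      then show "(INF y\<in>lip_hull. ennreal (norm (a - y))) \<le> d" by simp
    next
      fix a assume "a \<in> lip_hull"
      from N[OF n this] obtain b where b: "b \<in> {b \<in> U n. star b = b \<and> L b \<le> 1}" "norm (a - b) < e" by blast
      have "(INF x\<in>{b \<in> U n. star b = b \<and> L b \<le> 1}. ennreal (norm (x - a))) \<le> ennreal (norm (b - a))"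
        by (rule INF_lower[OF b(1)])
      also have "\<dots> \<le> d" using b(2) by (simp add: e ennreal_leI norm_minus_commute)
      finally show "(INF x\<in>{b \<in> U n. star b = b \<and> L b \<le> 1}. ennreal (norm (x - a))) \<le> d" .
    qed
    then have "bridge_length (as_cstar (U n), M) (as_cstar UNIV, L') inclusion_bridge \<le> d"
      by (simp add: bridge_length_inclusion[OF U_sub subalgebra_UNIV] ball lip_ball_L')
    moreover have "propinquity 1 0 (as_cstar (U n), M) (as_cstar UNIV, L')
        \<le> bridge_length (as_cstar (U n), M) (as_cstar UNIV, L') inclusion_bridge"
      by (intro propinquity_le_bridge_length M leibniz_qcms_L') (simp_all add: is_bridge_inclusion[OF states])
    ultimately show ?thesis by simp
  qed
  then show "\<forall>\<^sub>F n in sequentially. propinquity 1 0 (as_cstar (U n), M) (as_cstar UNIV, L') < c"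
    using d(2) unfolding eventually_sequentially by (meson le_less_trans)
qed simp

end

theorem theorem4p10:
  fixes U :: "nat \<Rightarrow> 'a::cstar_algebra set" and \<beta> :: "nat \<Rightarrow> real"
  assumes "incseq U"
    and "\<And>n. unital_cstar_subalgebra (U n)"
    and "\<And>n. finite_dimensional (U n)"
    and "closure (\<Union>n. U n) = UNIV"
    and "U 0 = range (\<lambda>c. c *\<^sub>C 1)"
    and "\<And>n. 0 < \<beta> n"
    and "\<beta> \<longlonglongrightarrow> 0"
  shows "let A = as_cstar UNIV; A\<^sub>n = (\<lambda>n. as_cstar (U n));
             L = lip_beta U \<beta>; L' = lip_closure U L
         in (\<Union>n. U n) \<subseteq> {a. L a < \<infinity>} \<and>
            leibniz_qcms (A, L) \<and> (\<forall>n. leibniz_qcms (A\<^sub>n n, L)) \<and>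
            leibniz_qcms (A, L') \<and> (\<forall>n. leibniz_qcms (A\<^sub>n n, L')) \<and>
            (\<lambda>n. propinquity 1 0 (A\<^sub>n n, L') (A, L')) \<longlonglongrightarrow> 0 \<and>
            (\<lambda>n. propinquity 1 0 (A\<^sub>n n, L) (A, L')) \<longlonglongrightarrow> 0"
proof -
  have L: "leibniz_qcms (as_cstar S, lip_beta U \<beta>)" if "S = UNIV \<or> (\<exists>n. S = U n)" for S
    by (rule leibniz_qcms_L[OF assms that])
  have L': "leibniz_qcms (as_cstar S, lip_closure U (lip_beta U \<beta>))" if "S = UNIV \<or> (\<exists>n. S = U n)" for S
    by (rule leibniz_qcms_L'[OF assms that])
  have "(\<Union>n. U n) \<subseteq> {a. lip_beta U \<beta> a < \<infinity>}" using L_finite[OF assms] by blast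
  moreover have "(\<lambda>n. propinquity 1 0 (as_cstar (U n), lip_closure U (lip_beta U \<beta>))
      (as_cstar UNIV, lip_closure U (lip_beta U \<beta>))) \<longlonglongrightarrow> 0"
    by (rule propinquity_tendsto_0[OF assms]) (use L' L'_eq_L[OF assms] in auto)
  moreover have "(\<lambda>n. propinquity 1 0 (as_cstar (U n), lip_beta U \<beta>)
      (as_cstar UNIV, lip_closure U (lip_beta U \<beta>))) \<longlonglongrightarrow> 0"
    by (rule propinquity_tendsto_0[OF assms]) (use L in auto)
  ultimately show ?thesis using L L' by (simp add: Let_def) blast
qed

end
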